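(* Let $q$ be an integer less than $s$ and suppose that the null hypothesis $H_0$ holds, i.e. the true parameter belongs to $\Theta_q$. Let $\hat W_n=\arg\min_{W\in\Theta_s}U_n(W)$ and $\hat W_n^0=\arg\min_{W\in\Theta_q}U_n(W)$, where $\Theta_q$ is viewed as a subset of $\Theta_s$. Then the test statistic $$T_n=n\left(\min_{W\in\Theta_q}U_n(W)-\min_{W\in\Theta_s}U_n(W)\right)$$ satisfies, as $n\to\infty$, $$T_n=\sqrt n\left(\hat W_n-\hat W_n^0\right)^T I_0\,\sqrt n\left(\hat W_n-\hat W_n^0\right)+o_P(1)\ \stackrel{\mathcal D}{\longrightarrow}\ \chi^2_{s-q},$$ i.e. $T_n$ converges in distribution to the chi-square distribution with $s-q$ degrees of freedom. Here $I_0$ is the matrix whose component $(k,l)$ is $$\mathrm{tr}\left(\Gamma_0^{-1}E\left(\frac{\partial F_{W^0}(Z)}{\partial W_k}\frac{\partial F_{W^0}(Z)}{\partial W_l}^T\right)\right).$$ This holds even if the noise is not Gaussian, and $T_n$ is computed without knowledge of the noise covariance $\Gamma_0$.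
   Context: Model. $(Y_t,Z_t)_{t\in\mathbb N}$ is an i.i.d. sequence of random vectors, each with the same law as a generic pair $(Y,Z)$, where $Y_t$ is $d$-dimensional, $Z_t$ is $L$-dimensional, and $Y_t=F_{W^0}(Z_t)+\varepsilon_t$, where $W^0$ is the true parameter and $(\varepsilon_t)$ is an i.i.d. centered noise with unknown invertible covariance matrix $\Gamma_0$. It is assumed that the square of the noise and the cube of $Z$ are integrable: $E\|\varepsilon_t\|^2<\infty$ and $E\|Z\|^3<\infty$. MLP functions. $F_W=(F_W^1,\dots,F_W^d)^T$ is the function represented by a one-hidden-layer multilayer perceptron (MLP) with $H$ hidden units and weight vector $W$ (the $a_{ij}$ and $w_{jk}$): $F_W^i(z)=\sum_{j=1}^H a_{ij}\tanh\left(\sum_{k=1}^L w_{jk}z_k+w_{j0}\right)+a_{i0}$. $\frac{\partial F_W(z)}{\partial W_k}$ denotes the $d$-dimensional vector of partial derivatives of the components of $F_W(z)$ with respect to the weight $W_k$. Hypotheses tested. $H_0: W\in\Theta_q\subset\mathbb R^q$ against $H_1: W\in\Theta_s\subset\mathbb R^s$, where $\Theta_q$ and $\Theta_s$ are compact and $\Theta_q\subset\Theta_s$. $H_0$ expresses that $W$ belongs to a subset $\Theta_q$ of $\Theta_s$ with parametric dimension less than $s$ or, equivalently, that $s-q$ weights of the MLP in $\Theta_s$ are null. Identifiability. Two weight vectors are considered equivalent if one is obtained from the other by a transformation in the finite group generated by sign changes of hidden units (flipping the sign of all incoming and outgoing weights of a unit) and permutations of hidden units; parameters are considered in the quotient space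 by this group. In this space the model is assumed identifiable: the true model belongs to the considered family and the MLPs considered have no redundant units, so that $W^0$ is the only parameter representing the true function. The assumptions are taken to be such that the limiting Hessian matrix $2I_0$ of $U_n$ at $W^0$ is positive definite. Cost function. $U_n(W):=\log\det\left(\frac1n\sum_{t=1}^n (Y_t-F_W(Z_t))(Y_t-F_W(Z_t))^T\right)$.
   Formalization: Added: W^0 is interior to Θ_s and, within the q-dimensional coordinate subspace, to Θ_q (if Θ_s=Θ_q={W^0}, T_n=0 and the claim fails); the noise ε_t is independent of Z_t (heteroscedastic noise breaks the limit); identifiability is understood almost surely under the law of Z. *)

theory Defs
  imports "HOL-Probability.Probability"
begin

text \<open>
  Positions of the weights: \<open>Inl (i, Some j)\<close> stands for \<open>a_ij\<close>, \<open>Inl (i, None)\<close> for the bias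
  \<open>a_i0\<close>, \<open>Inr (j, Some k)\<close> for \<open>w_jk\<close> and \<open>Inr (j, None)\<close> for the bias \<open>w_j0\<close>, where \<open>'d\<close>, \<open>'l\<close>
  and \<open>'h\<close> index the outputs, the inputs and the hidden units.
\<close>

type_synonym ('d, 'l, 'h) weight = "('d \<times> 'h option) + ('h \<times> 'l option)"

definition mlp :: "real ^ ('d::finite, 'l::finite, 'h::finite) weight \<Rightarrow> real ^ 'l \<Rightarrow> real ^ 'd" where
  "mlp W z = (\<chi> i. (\<Sum>j\<in>UNIV. W $ Inl (i, Some j) *
      tanh ((\<Sum>k\<in>UNIV. W $ Inr (j, Some k) * z $ k) + W $ Inr (j, None))) + W $ Inl (i, None))"

definition mlp_partial ::
  "real ^ ('d::finite, 'l::finite, 'h::finite) weight \<Rightarrow> ('d, 'l, 'h) weight \<Rightarrow> real ^ 'l \<Rightarrow> real ^ 'd" where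
  "mlp_partial W k z = vector_derivative (\<lambda>x. mlp (W + x *\<^sub>R axis k 1) z) (at 0)"

text \<open>
  The group generated by sign changes and permutations of the hidden units consists of the maps
  \<open>hidden_sym p \<sigma>\<close> with \<open>p\<close> a permutation of the units and \<open>\<sigma>\<close> a family of signs.
\<close>

definition hidden_sym ::
  "('h \<Rightarrow> 'h) \<Rightarrow> ('h \<Rightarrow> real) \<Rightarrow> real ^ ('d::finite, 'l::finite, 'h::finite) weight
    \<Rightarrow> real ^ ('d, 'l, 'h) weight" where
  "hidden_sym p \<sigma> W = (\<chi> v. case v of
      Inl (i, None) \<Rightarrow> W $ Inl (i, None)
    | Inl (i, Some j) \<Rightarrow> \<sigma> j * W $ Inl (i, Some (p j))
    | Inr (j, k) \<Rightarrow> \<sigma> j * W $ Inr (p j, k))"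

definition mlp_equiv ::
  "real ^ ('d::finite, 'l::finite, 'h::finite) weight \<Rightarrow> real ^ ('d, 'l, 'h) weight \<Rightarrow> bool" where
  "mlp_equiv W W' \<longleftrightarrow> (\<exists>p \<sigma>. bij p \<and> (\<forall>j. \<sigma> j \<in> {1, -1}) \<and> W' = hidden_sym p \<sigma> W)"

definition null_outside :: "'k::finite set \<Rightarrow> (real ^ 'k) set" where
  "null_outside K = {W. \<forall>k. k \<notin> K \<longrightarrow> W $ k = 0}"

definition outer :: "real ^ 'd::finite \<Rightarrow> real ^ 'd \<Rightarrow> real ^ 'd ^ 'd" where
  "outer u v = (\<chi> i j. u $ i * v $ j)"

definition pos_def :: "real ^ 'k::finite ^ 'k \<Rightarrow> bool" where
  "pos_def A \<longleftrightarrow> (\<forall>x. x \<noteq> 0 \<longrightarrow> 0 < x \<bullet> (A *v x))"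

text \<open>
  The empirical covariance matrices are positive semidefinite but may be singular, and the library
  has \<open>ln 0 = 0\<close>; the logarithm of the determinant must be \<open>-\<infinity>\<close> there for minimisers to be the
  intended ones. It is applied to nonnegative reals only.
\<close>

definition log_ext :: "real \<Rightarrow> ereal" where
  "log_ext x = (if x = 0 then - \<infinity> else ereal (ln x))"

definition cost ::
  "nat \<Rightarrow> (nat \<Rightarrow> real ^ 'd) \<Rightarrow> (nat \<Rightarrow> real ^ 'l)
    \<Rightarrow> real ^ ('d::finite, 'l::finite, 'h::finite) weight \<Rightarrow> ereal" where
  "cost n y z W = log_ext (det ((1 / real n) *\<^sub>R
      (\<Sum>t = 1..n. outer (y t - mlp W (z t)) (y t - mlp W (z t)))))"

text \<open>
  \<open>real_of_ereal\<close> sends infinite values to \<open>0\<close>; this only matters for samples whose empirical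
  residual covariance is singular for some parameter.
\<close>

definition test_statistic ::
  "nat \<Rightarrow> (nat \<Rightarrow> real ^ 'd) \<Rightarrow> (nat \<Rightarrow> real ^ 'l)
    \<Rightarrow> (real ^ ('d::finite, 'l::finite, 'h::finite) weight) set
    \<Rightarrow> (real ^ ('d, 'l, 'h) weight) set \<Rightarrow> real" where
  "test_statistic n y z \<Theta>q \<Theta>s =
    real n * real_of_ereal ((INF W\<in>\<Theta>q. cost n y z W) - (INF W\<in>\<Theta>s. cost n y z W))"

definition iid_seq :: "'a measure \<Rightarrow> (nat \<Rightarrow> 'a \<Rightarrow> 'b::topological_space) \<Rightarrow> bool" where
  "iid_seq M X \<longleftrightarrow> prob_space.indep_vars M (\<lambda>_. borel) X UNIV \<and>
    (\<forall>t. distr M borel (X t) = distr M borel (X 0))"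

text \<open>The library's \<open>indep_var\<close> forces both random variables to have the same value type.\<close>

definition indep_rv ::
  "'a measure \<Rightarrow> ('a \<Rightarrow> 'b::topological_space) \<Rightarrow> ('a \<Rightarrow> 'c::topological_space) \<Rightarrow> bool" where
  "indep_rv M X Y \<longleftrightarrow> X \<in> borel_measurable M \<and> Y \<in> borel_measurable M \<and>
    prob_space.indep_set M {X -` A \<inter> space M | A. A \<in> sets borel}
      {Y -` B \<inter> space M | B. B \<in> sets borel}"

definition small_oP_1 :: "'a measure \<Rightarrow> (nat \<Rightarrow> 'a \<Rightarrow> real) \<Rightarrow> bool" where
  "small_oP_1 M R \<longleftrightarrow>
    (\<forall>e>0. (\<lambda>n. measure M {\<omega> \<in> space M. \<bar>R n \<omega>\<bar> > e}) \<longlonglongrightarrow> 0)"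

definition chi_square :: "nat \<Rightarrow> real measure" where
  "chi_square k = distr (PiM {..<k} (\<lambda>_. density lborel std_normal_density)) borel
    (\<lambda>x. \<Sum>i<k. (x i)\<^sup>2)"

definition info_matrix ::
  "'a measure \<Rightarrow> ('a \<Rightarrow> real ^ 'l) \<Rightarrow> real ^ 'd ^ 'd
    \<Rightarrow> real ^ ('d::finite, 'l::finite, 'h::finite) weight
    \<Rightarrow> real ^ ('d, 'l, 'h) weight ^ ('d, 'l, 'h) weight" where
  "info_matrix M Z \<Gamma> W = (\<chi> k l. trace (matrix_inv \<Gamma> **
    (LINT \<omega>|M. outer (mlp_partial W k (Z \<omega>)) (mlp_partial W l (Z \<omega>)))))"

end

theory Submission
  imports Defs
begin

text \<open>
  Near \<open>W0\<close> the cost satisfies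
  \<open>U_n (W0 + h) - U_n W0 = h \<bullet> I0 h - 2 n\<^sup>-\<^sup>1\<^sup>/\<^sup>2 g_n \<bullet> h + o_P(\<bar>h\<bar>\<^sup>2 + n\<^sup>-\<^sup>1\<^sup>/\<^sup>2 \<bar>h\<bar>)\<close>, uniformly in small \<open>h\<close>, where
  \<open>g_n\<close> is a normalised sum of i.i.d. centered vectors with covariance \<open>I0\<close>. Only the strict
  differentiability of \<open>ln det\<close> at \<open>\<Gamma>0\<close> is needed, because the change of the empirical covariance
  is itself of order \<open>\<bar>h\<bar>\<^sup>2 + n\<^sup>-\<^sup>1\<^sup>/\<^sup>2 \<bar>h\<bar>\<close>. Both estimators are consistent since
  \<open>det \<Gamma>0 < det (\<Gamma>0 + P)\<close> for nonzero positive semidefinite \<open>P\<close>, so at scale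
  \<open>n\<^sup>-\<^sup>1\<^sup>/\<^sup>2\<close> they are close to the minimisers of the quadratic form on the whole space and on the null
  subspace. The statistic is then the squared \<open>I0\<close>-length of the difference of these two minimisers,
  which is \<open>\<Sum>i<s - q. (e_i \<bullet> g_n)\<^sup>2\<close> for an \<open>I0\<close>-orthonormal basis \<open>e_i\<close> of the \<open>I0\<close>-orthogonal complement of the
  subspace. Its Laplace transform is obtained from the one-dimensional central limit theorem by
  Gaussian mixing.
\<close>

section \<open>Determinants and positive definite matrices\<close>

text \<open>With only second moments of the noise, the empirical covariance at the true weights
  converges to \<open>\<Gamma>0\<close> without any known rate. An ordinary derivative of
  \<open>ln det\<close> at \<open>\<Gamma>0\<close> would leave an error governed by that distance;
  the strict one leaves an error proportional to the difference of the two matrices compared.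

  Uniformity in \<open>h\<close> comes from finite dimension: linear and quadratic terms in
  \<open>h\<close> are expanded along the coordinate axes, so finitely many averages have to
  converge, and remainders are bounded by a power of \<open>norm h\<close> times the average of one
  integrable weight. The third moment of the input comes from the cubic Taylor remainder of the
  network times the noise. The quadratic Taylor term meets the noise only linearly, so it averages
  out and \<open>I0\<close> contains first derivatives only.

  Because \<open>W0\<close> is interior to the large parameter set, and interior to the small one
  relative to the null subspace, balls of radius of order \<open>sqrt n\<close> are available after
  rescaling, and the comparison of minimisers becomes a deterministic lemma about functions close to
  a quadratic form.\<close>

lemma outer_nth [simp]: "outer u v $ i $ j = u $ i * v $ j"
  by (simp add: outer_def)

lemma norm_outer: "norm (outer u v) = norm u * norm v"
proof -
  have row: "norm (outer u v $ i) = norm (u $ i) * norm v" for i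
  proof -
    have "outer u v $ i = (u $ i) *\<^sub>R v" by (simp add: vec_eq_iff)
    then show ?thesis by simp
  qed
  show ?thesis
    unfolding norm_vec_def[of "outer u v"] norm_vec_def[of u]
    by (simp add: row L2_set_left_distrib)
qed

lemma bounded_bilinear_outer: "bounded_bilinear outer"
  by (rule bounded_bilinear.intro)
     (auto simp: vec_eq_iff algebra_simps norm_outer intro!: exI[of _ 1])

lemmas outer_diff_left = bounded_bilinear.diff_left[OF bounded_bilinear_outer]
  and outer_diff_right = bounded_bilinear.diff_right[OF bounded_bilinear_outer]

lemma norm_matrix_le_entries:
  fixes A :: "real ^ 'n ^ 'm"
  shows "norm A \<le> (\<Sum>i\<in>UNIV. \<Sum>j\<in>UNIV. \<bar>A $ i $ j\<bar>)"
proof -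
  have "norm A \<le> (\<Sum>i\<in>UNIV. norm (A $ i))"
    unfolding norm_vec_def[of A] by (rule L2_set_le_sum) simp
  also have "\<dots> \<le> (\<Sum>i\<in>UNIV. \<Sum>j\<in>UNIV. \<bar>A $ i $ j\<bar>)"
    by (intro sum_mono norm_le_l1_cart)
  finally show ?thesis .
qed

lemma trace_matrix_mul_outer: "trace (A ** outer u v) = v \<bullet> (A *v u)"
  by (simp add: trace_def matrix_matrix_mult_def inner_vec_def matrix_vector_mult_def
      sum_distrib_left algebra_simps)

lemma bounded_linear_trace_mul:
  fixes A :: "real ^ 'n ^ 'n"
  shows "bounded_linear (\<lambda>X. trace (A ** X))"
  unfolding linear_conv_bounded_linear[symmetric]
  by (rule linearI)
     (simp_all add: trace_def matrix_matrix_mult_def sum.distrib algebra_simps sum_distrib_left)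

lemma matrix_inv_left_right:
  fixes A :: "real ^ 'n ^ 'n"
  assumes "invertible A"
  shows "A ** matrix_inv A = mat 1" "matrix_inv A ** A = mat 1"
proof -
  have "\<exists>B. A ** B = mat 1 \<and> B ** A = mat 1"
    using assms by (simp add: invertible_def)
  then have "A ** matrix_inv A = mat 1 \<and> matrix_inv A ** A = mat 1"
    unfolding matrix_inv_def by (rule someI_ex)
  then show "A ** matrix_inv A = mat 1" "matrix_inv A ** A = mat 1" by auto
qed

section \<open>Derivative of the determinant and of its logarithm\<close>

definition det_deriv :: "real ^ 'n ^ 'n \<Rightarrow> real ^ 'n ^ 'n \<Rightarrow> real" where
  "det_deriv A X = (\<Sum>p\<in>{p. p permutes UNIV}. of_int (sign p) *
     (\<Sum>i\<in>UNIV. X $ i $ p i * (\<Prod>j\<in>UNIV - {i}. A $ j $ p j)))"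

lemma has_derivative_det: "(det has_derivative det_deriv A) (at (A :: real ^ 'n ^ 'n))"
proof -
  have entry: "((\<lambda>x. x $ i $ j) has_derivative (\<lambda>y. y $ i $ j)) (at A)" for i j :: 'n
    by (intro bounded_linear_imp_has_derivative bounded_linear_compose[OF bounded_linear_vec_nth bounded_linear_vec_nth])
  show ?thesis
    unfolding det_def[abs_def] det_deriv_def[abs_def]
    by (intro has_derivative_sum has_derivative_mult_right has_derivative_prod entry)
qed

lemma continuous_det_deriv: "continuous_on UNIV (\<lambda>A :: real ^ 'n ^ 'n. det_deriv A X)"
  unfolding det_deriv_def by (intro continuous_intros)

lemma continuous_on_det: "continuous_on S (det :: real ^ 'n ^ 'n \<Rightarrow> real)"
  using has_derivative_continuous[OF has_derivative_det]
  by (meson continuous_at_imp_continuous_on)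

text \<open>A permutation other than the identity moves at least two points, so after one factor is
  removed a zero off-diagonal entry of \<open>mat 1\<close> is still in the product: only the
  identity permutation contributes.\<close>

lemma det_deriv_mat_1: "det_deriv (mat 1) X = trace (X :: real ^ 'n ^ 'n)"
proof -
  have inner: "(\<Sum>p\<in>{p. p permutes UNIV}. of_int (sign p) *
      (X $ i $ p i * (\<Prod>j\<in>UNIV - {i}. mat 1 $ j $ p j))) = X $ i $ i" for i :: 'n
  proof -
    have "(\<Prod>j\<in>UNIV - {i}. (mat 1 :: real ^ 'n ^ 'n) $ j $ p j) = 0"
      if p: "p permutes UNIV" "p \<noteq> id" for p
    proof -
      have "\<exists>j. j \<noteq> i \<and> p j \<noteq> j"
      proof (rule ccontr)
        assume "\<not> ?thesis"
        then have fixp: "p j = j" if "j \<noteq> i" for j using that by auto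
        have "p i = i" using fixp[of "p i"] permutes_inj[OF p(1)] by (metis injD)
        then have "p j = j" for j using fixp by (cases "j = i") auto
        then have "p = id" by (auto simp: fun_eq_iff)
        with p show False by simp
      qed
      then obtain j where "j \<in> UNIV - {i}" "p j \<noteq> j" by auto
      then show ?thesis by (intro prod_zero bexI[of _ j]) (auto simp: mat_def)
    qed
    then have "(\<Sum>p\<in>{p. p permutes UNIV}. of_int (sign p) *
      (X $ i $ p i * (\<Prod>j\<in>UNIV - {i}. mat 1 $ j $ p j))) =
      (\<Sum>p\<in>{id}. of_int (sign p) *
      (X $ i $ p i * (\<Prod>j\<in>UNIV - {i}. mat 1 $ j $ p j)))"
      by (intro sum.mono_neutral_right) (auto simp: permutes_id)
    also have "\<dots> = X $ i $ i" by (simp add: mat_def)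
    finally show ?thesis .
  qed
  show ?thesis
    unfolding det_deriv_def sum_distrib_left trace_def
    by (subst sum.swap) (simp only: inner)
qed

text \<open>Jacobi's formula. Factoring \<open>det B\<close> as \<open>det A\<close> times
  \<open>det (matrix_inv A ** B)\<close> moves the differentiation to the identity matrix, where it
  gives a trace; uniqueness of derivatives does the rest.\<close>

lemma det_deriv_invertible:
  fixes A :: "real ^ 'n ^ 'n"
  assumes "invertible A"
  shows "det_deriv A X = det A * trace (matrix_inv A ** X)"
proof -
  note inv = matrix_inv_left_right[OF assms]
  have "((\<lambda>B. det A * det (matrix_inv A ** B)) has_derivative
      (\<lambda>X. det A * det_deriv (matrix_inv A ** A) (matrix_inv A ** X))) (at A)"
  proof (intro has_derivative_mult_right has_derivative_compose[OF _ has_derivative_det])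
    have "bounded_linear (\<lambda>B. matrix_inv A ** B)"
      unfolding linear_conv_bounded_linear[symmetric]
      by (rule linearI) (simp_all add: vec_eq_iff matrix_matrix_mult_def sum_distrib_left sum.distrib algebra_simps)
    then show "((**) (matrix_inv A) has_derivative (**) (matrix_inv A)) (at A)"
      by (rule bounded_linear_imp_has_derivative)
  qed
  moreover have "det A * det (matrix_inv A ** B) = det B" for B
    unfolding det_mul[symmetric] by (simp add: matrix_mul_assoc inv)
  ultimately have "(det has_derivative (\<lambda>X. det A * det_deriv (matrix_inv A ** A) (matrix_inv A ** X))) (at A)"
    by simp
  from has_derivative_unique[OF this has_derivative_det] show ?thesis
    by (metis inv(2) det_deriv_mat_1)
qed

lemma has_derivative_ln_det:
  fixes A :: "real ^ 'n ^ 'n"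
  assumes "det A > 0"
  shows "((\<lambda>B. ln (det B)) has_derivative (\<lambda>X. trace (matrix_inv A ** X))) (at A)"
proof -
  have inv: "invertible A" using assms by (simp add: invertible_det_nz)
  have "((\<lambda>B. ln (det B)) has_derivative (\<lambda>X. det_deriv A X * (1 / det A))) (at A)"
    using has_derivative_ln[OF assms has_derivative_det] by (simp add: divide_inverse)
  moreover have "(\<lambda>X. det_deriv A X * (1 / det A)) = (\<lambda>X. trace (matrix_inv A ** X))"
    using assms by (simp add: det_deriv_invertible[OF inv])
  ultimately show ?thesis by simp
qed

text \<open>If the directional derivatives are continuous at the single point \<open>a\<close>, the
  operator norm of \<open>f' x - f' a\<close> is small for \<open>x\<close> near \<open>a\<close>,
  and the mean value inequality on a ball, which is convex, compares any two of its points.\<close>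

lemma strict_derivative:
  fixes f :: "'a::euclidean_space \<Rightarrow> real"
  assumes deriv: "\<And>x. x \<in> ball a r \<Longrightarrow> (f has_derivative f' x) (at x)"
    and cont: "\<And>b. b \<in> Basis \<Longrightarrow> continuous (at a) (\<lambda>x. f' x b)"
    and "0 < r" "0 < \<eta>"
  shows "\<exists>\<delta>>0. \<delta> \<le> r \<and> (\<forall>x\<in>ball a \<delta>. \<forall>y\<in>ball a \<delta>. \<bar>f x - f y - f' a (x - y)\<bar> \<le> \<eta> * norm (x - y))"
proof -
  \<comment> \<open>An error of \<zeta> in each of the \<open>DIM('a)\<close> basis directions adds
    up to an operator norm of at most \<eta>.\<close>
  define \<zeta> where "\<zeta> = \<eta> / DIM('a)"
  have \<zeta>: "\<zeta> > 0" using assms by (simp add: \<zeta>_def)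
  have "\<forall>b\<in>Basis. eventually (\<lambda>x. \<bar>f' x b - f' a b\<bar> < \<zeta>) (nhds a)"
  proof
    fix b :: 'a assume "b \<in> Basis"
    from cont[OF this] have "((\<lambda>x. f' x b) \<longlongrightarrow> f' a b) (at a)"
      by (simp only: continuous_at)
    from tendstoD[OF this \<zeta>] show "eventually (\<lambda>x. \<bar>f' x b - f' a b\<bar> < \<zeta>) (nhds a)"
      using \<zeta> by (simp add: dist_real_def eventually_nhds_conv_at)
  qed
  then have "eventually (\<lambda>x. \<forall>b\<in>Basis. \<bar>f' x b - f' a b\<bar> < \<zeta>) (nhds a)"
    by (subst eventually_ball_finite_distrib) auto
  then obtain \<delta>0 where \<delta>0: "\<delta>0 > 0" "\<And>x b. dist x a < \<delta>0 \<Longrightarrow> b \<in> Basis \<Longrightarrow> \<bar>f' x b - f' a b\<bar> < \<zeta>"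
    unfolding eventually_nhds_metric by blast
  define \<delta> where "\<delta> = min r \<delta>0"
  have \<delta>: "\<delta> > 0" "\<delta> \<le> r" "\<delta> \<le> \<delta>0" using \<delta>0 assms by (auto simp: \<delta>_def)
  have lin: "linear (f' x)" if "x \<in> ball a r" for x
    using deriv[OF that] has_derivative_linear by blast
  have expand: "f' x v = (\<Sum>b\<in>Basis. (v \<bullet> b) * f' x b)" if "x \<in> ball a r" for x v
  proof -
    have "f' x v = f' x (\<Sum>b\<in>Basis. (v \<bullet> b) *\<^sub>R b)" by (simp add: euclidean_representation)
    also have "\<dots> = (\<Sum>b\<in>Basis. (v \<bullet> b) * f' x b)"
      by (simp add: linear_sum[OF lin[OF that]] linear_scale[OF lin[OF that]])
    finally show ?thesis .
  qed
  have op: "onorm (f' x - f' a) \<le> \<eta>" if x: "x \<in> ball a \<delta>" for x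
  proof (rule onorm_le)
    fix v
    have xr: "x \<in> ball a r" "a \<in> ball a r" using x \<delta> assms by auto
    have "(f' x - f' a) v = f' x v - f' a v" by simp
    also have "\<dots> = (\<Sum>b\<in>Basis. (v \<bullet> b) * f' x b) - (\<Sum>b\<in>Basis. (v \<bullet> b) * f' a b)"
      using expand[OF xr(1), of v] expand[OF xr(2), of v] by (simp only:)
    also have "\<dots> = (\<Sum>b\<in>Basis. (v \<bullet> b) * (f' x b - f' a b))"
      by (simp add: sum_subtractf algebra_simps)
    finally have "norm ((f' x - f' a) v) \<le> (\<Sum>b\<in>Basis. \<bar>v \<bullet> b\<bar> * \<bar>f' x b - f' a b\<bar>)"
      using sum_abs[of "\<lambda>b. (v \<bullet> b) * (f' x b - f' a b)" Basis] by (simp add: abs_mult)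
    also have "\<dots> \<le> (\<Sum>b\<in>(Basis::'a set). norm v * \<zeta>)"
    proof (intro sum_mono mult_mono)
      fix b :: 'a assume b: "b \<in> Basis"
      show "\<bar>v \<bullet> b\<bar> \<le> norm v" using b by (rule Basis_le_norm)
      have "dist x a < \<delta>0" using x \<delta> by (simp add: dist_commute)
      from \<delta>0(2)[OF this b] show "\<bar>f' x b - f' a b\<bar> \<le> \<zeta>" by simp
    qed auto
    also have "\<dots> = \<eta> * norm v" by (simp add: \<zeta>_def)
    finally show "norm ((f' x - f' a) v) \<le> \<eta> * norm v" .
  qed
  show ?thesis
  proof (intro exI[of _ \<delta>] conjI ballI)
    fix x y assume xy: "x \<in> ball a \<delta>" "y \<in> ball a \<delta>"
    have "norm (f x - f y - f' a (x - y)) \<le> norm (x - y) * \<eta>"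
    proof (rule differentiable_bound_linearization[where S = "ball a \<delta>"])
      show "y + t *\<^sub>R (x - y) \<in> ball a \<delta>" if "t \<in> {0..1}" for t
      proof -
        have "y + t *\<^sub>R (x - y) = (1 - t) *\<^sub>R y + t *\<^sub>R x" by (simp add: algebra_simps)
        then show ?thesis using that convexD_alt[OF convex_ball xy(2,1), of t] by simp
      qed
      show "(f has_derivative f' x) (at x within ball a \<delta>)" if "x \<in> ball a \<delta>" for x
        by (rule has_derivative_at_withinI[OF deriv]) (use that \<delta> in simp)
    qed (use op \<delta> in auto)
    then show "\<bar>f x - f y - f' a (x - y)\<bar> \<le> \<eta> * norm (x - y)" by (simp add: mult.commute)
  qed (use \<delta> in auto)
qed

lemma ln_det_strict_derivative:
  fixes \<Gamma> :: "real ^ 'n ^ 'n"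
  assumes "det \<Gamma> > 0" "\<eta> > 0"
  shows "\<exists>\<delta>>0. \<forall>A\<in>ball \<Gamma> \<delta>. \<forall>B\<in>ball \<Gamma> \<delta>. det A > 0 \<and>
    \<bar>ln (det A) - ln (det B) - trace (matrix_inv \<Gamma> ** (A - B))\<bar> \<le> \<eta> * norm (A - B)"
proof -
  have "open {A :: real ^ 'n ^ 'n. det A > 0}"
    by (intro open_Collect_less continuous_intros continuous_on_det)
  then obtain r where r: "r > 0" "ball \<Gamma> r \<subseteq> {A. det A > 0}"
    using assms(1) unfolding open_contains_ball by blast
  have "\<exists>\<delta>>0. \<delta> \<le> r \<and> (\<forall>A\<in>ball \<Gamma> \<delta>. \<forall>B\<in>ball \<Gamma> \<delta>.
    \<bar>ln (det A) - ln (det B) - trace (matrix_inv \<Gamma> ** (A - B))\<bar> \<le> \<eta> * norm (A - B))"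
  proof (rule strict_derivative[where f' = "\<lambda>A X. trace (matrix_inv A ** X)"])
    show "((\<lambda>x. ln (det x)) has_derivative (\<lambda>X. trace (matrix_inv x ** X))) (at x)"
      if "x \<in> ball \<Gamma> r" for x
      using that r by (intro has_derivative_ln_det) auto
    fix b :: "real ^ 'n ^ 'n"
    \<comment> \<open>Continuity is read off from a quotient of polynomials in the entries, which
      near \<Gamma> agrees with the trace involving the inverse by Jacobi's formula.\<close>
    have "continuous (at \<Gamma>) (\<lambda>A. det_deriv A b / det A)"
      using assms continuous_det_deriv[of b] continuous_on_det[of UNIV]
      by (intro continuous_intros) (auto simp: continuous_on_eq_continuous_within)
    moreover have "eventually (\<lambda>A. det_deriv A b / det A = trace (matrix_inv A ** b)) (nhds \<Gamma>)"
    proof (rule eventually_nhds_in_open[THEN eventually_mono])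
      show "open (ball \<Gamma> r)" "\<Gamma> \<in> ball \<Gamma> r" using r by auto
      fix A assume "A \<in> ball \<Gamma> r"
      then have "det A \<noteq> 0" using r by auto
      then show "det_deriv A b / det A = trace (matrix_inv A ** b)"
        by (simp add: det_deriv_invertible invertible_det_nz)
    qed
    ultimately show "continuous (at \<Gamma>) (\<lambda>A. trace (matrix_inv A ** b))"
      using isCont_cong[of "\<lambda>A. det_deriv A b / det A" "\<lambda>A. trace (matrix_inv A ** b)" \<Gamma>] by blast
  qed (use r assms in auto)
  then obtain \<delta> where \<delta>: "\<delta> > 0" "\<delta> \<le> r" "\<forall>A\<in>ball \<Gamma> \<delta>. \<forall>B\<in>ball \<Gamma> \<delta>.
    \<bar>ln (det A) - ln (det B) - trace (matrix_inv \<Gamma> ** (A - B))\<bar> \<le> \<eta> * norm (A - B)" by blast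
  have "det A > 0" if "A \<in> ball \<Gamma> \<delta>" for A
    using that subset_ball[OF \<delta>(2), of \<Gamma>] r(2) by blast
  with \<delta> show ?thesis by blast
qed

section \<open>Positive definite matrices and strict monotonicity of the determinant\<close>

lemma pos_def_invertible: "pos_def A \<Longrightarrow> invertible A"
  unfolding invertible_left_inverse matrix_left_invertible_ker pos_def_def by force

text \<open>\<open>pos_def\<close> does not include symmetry, so diagonalisation is not at hand.
  Instead, the segment from the identity to \<open>A\<close> stays positive definite, hence
  invertible, and the determinant starts at 1 and cannot cross zero.\<close>

lemma pos_def_det_pos:
  fixes A :: "real ^ 'n ^ 'n"
  assumes "pos_def A"
  shows "det A > 0"
proof (rule ccontr)
  assume "\<not> det A > 0"
  define P where "P t = (1 - t) *\<^sub>R mat 1 + t *\<^sub>R A" for t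
  have pd: "pos_def (P t)" if "t \<in> {0..1}" for t
    unfolding pos_def_def
  proof (intro allI impI)
    fix x :: "real ^ 'n" assume x: "x \<noteq> 0"
    have "x \<bullet> (P t *v x) = (1 - t) * (x \<bullet> x) + t * (x \<bullet> (A *v x))"
      by (simp add: P_def matrix_vector_mult_add_rdistrib scaleR_matrix_vector_assoc[symmetric] inner_right_distrib)
    moreover have "x \<bullet> (A *v x) > 0" "x \<bullet> x > 0" using assms x by (auto simp: pos_def_def)
    ultimately show "0 < x \<bullet> (P t *v x)" using that
      by (cases "t = 0") (auto intro!: add_nonneg_pos)
  qed
  have "continuous_on {0..1} (\<lambda>t. det (P t))"
    unfolding P_def
    by (intro continuous_on_compose2[OF continuous_on_det[of UNIV]] continuous_intros) auto
  moreover have "det (P 0) = 1" "det (P 1) = det A" by (simp_all add: P_def)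
  ultimately obtain t where "0 \<le> t" "t \<le> 1" "det (P t) = 0"
    using IVT2'[of "\<lambda>t. det (P t)" 1 0 0] \<open>\<not> det A > 0\<close> by auto
  then show False using pos_def_invertible[OF pd[of t]] by (simp add: invertible_det_nz)
qed

text \<open>Substituting \<open>x = A *v y\<close> turns the inverse form at \<open>x\<close> into
  the form of \<open>A\<close> at \<open>y\<close>.\<close>

lemma pos_def_matrix_inv:
  assumes "pos_def A" shows "pos_def (matrix_inv A)"
  unfolding pos_def_def
proof (intro allI impI)
  fix x :: "real ^ 'a" assume "x \<noteq> 0"
  define y where "y = matrix_inv A *v x"
  have x: "x = A *v y"
    using matrix_inv_left_right[OF pos_def_invertible[OF assms]]
    by (simp add: y_def matrix_vector_mul_assoc)
  then have "y \<noteq> 0" using \<open>x \<noteq> 0\<close> by auto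
  then have "0 < y \<bullet> (A *v y)" using assms by (simp add: pos_def_def)
  then show "0 < x \<bullet> (matrix_inv A *v x)" by (simp add: y_def[symmetric] x[symmetric] inner_commute)
qed

text \<open>Positivity of the traces expresses that \<open>P\<close> does not vanish. In the
  application \<open>P\<close> is the mean of \<open>outer D D\<close>, its trace against
  \<open>A\<close> is the mean of the nonnegative variable \<open>D \<bullet> (A *v D)\<close>, and
  positivity of that mean can be checked through identifiability.\<close>

lemma det_strict_mono:
  fixes \<Gamma> P :: "real ^ 'n ^ 'n"
  assumes \<Gamma>: "pos_def \<Gamma>" and psd: "\<And>x. 0 \<le> x \<bullet> (P *v x)"
    and tr: "\<And>A. pos_def A \<Longrightarrow> 0 < trace (A ** P)"
  shows "det \<Gamma> < det (\<Gamma> + P)"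
proof -
  have pd: "pos_def (\<Gamma> + t *\<^sub>R P)" if "t \<ge> 0" for t
    using \<Gamma> psd that unfolding pos_def_def
    by (simp add: matrix_vector_mult_add_rdistrib scaleR_matrix_vector_assoc[symmetric]
        inner_right_distrib add_pos_nonneg)
  \<comment> \<open>\<open>ln det (\<Gamma> + t P)\<close> has derivative \<open>tr ((\<Gamma> + t P)\<^sup>-\<^sup>1 P) > 0\<close>.\<close>
  have "ln (det (\<Gamma> + 0 *\<^sub>R P)) < ln (det (\<Gamma> + 1 *\<^sub>R P))"
  proof (rule DERIV_pos_imp_increasing[of 0 1 "\<lambda>t. ln (det (\<Gamma> + t *\<^sub>R P))"])
    fix t :: real assume t: "0 \<le> t" "t \<le> 1"
    let ?A = "\<Gamma> + t *\<^sub>R P"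
    have "((\<lambda>t. ln (det (\<Gamma> + t *\<^sub>R P))) has_derivative (\<lambda>h. trace (matrix_inv ?A ** (h *\<^sub>R P)))) (at t)"
    proof (rule has_derivative_compose[where g = "\<lambda>B. ln (det B)" and f = "\<lambda>t. \<Gamma> + t *\<^sub>R P" and
        g' = "\<lambda>X. trace (matrix_inv ?A ** X)"])
      show "((\<lambda>t. \<Gamma> + t *\<^sub>R P) has_derivative (\<lambda>h. h *\<^sub>R P)) (at t)"
        by (auto intro!: derivative_eq_intros)
      show "((\<lambda>B. ln (det B)) has_derivative (\<lambda>X. trace (matrix_inv ?A ** X))) (at ?A)"
        by (intro has_derivative_ln_det pos_def_det_pos pd t)
    qed
    moreover have "(\<lambda>h. trace (matrix_inv ?A ** (h *\<^sub>R P))) = (*) (trace (matrix_inv ?A ** P))"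
      by (simp add: linear_scale[OF bounded_linear.linear[OF bounded_linear_trace_mul]] mult.commute fun_eq_iff)
    ultimately show "\<exists>y. ((\<lambda>t. ln (det (\<Gamma> + t *\<^sub>R P))) has_real_derivative y) (at t) \<and> 0 < y"
      using tr[OF pos_def_matrix_inv[OF pd[OF t(1)]]] by (auto simp: has_field_derivative_def)
  qed simp
  moreover have "det \<Gamma> > 0" by (rule pos_def_det_pos[OF \<Gamma>])
  moreover have "det (\<Gamma> + P) > 0" using pos_def_det_pos[OF pd[of 1]] by simp
  ultimately show ?thesis by simp
qed

section \<open>Weak laws for i.i.d. sequences\<close>

text \<open>The inequality of arithmetic and geometric means with a free scale \<open>e\<close>: it
  turns a small second moment into a small first absolute moment by plain integration.\<close>

lemma abs_le_square_div:
  fixes x e :: real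
  assumes "0 < e"
  shows "\<bar>x\<bar> \<le> x\<^sup>2 / (2 * e) + e / 2"
proof -
  have "0 \<le> (\<bar>x\<bar> - e)\<^sup>2 / (2 * e)" using assms by simp
  also have "\<dots> = x\<^sup>2 / (2 * e) + e / 2 - \<bar>x\<bar>"
    using assms by (simp add: power2_diff field_simps power2_eq_square)
  finally show ?thesis by simp
qed

context prob_space
begin

lemma iid_seq_measurable: "iid_seq M X \<Longrightarrow> X t \<in> borel_measurable M"
  unfolding iid_seq_def indep_vars_def by auto

lemma iid_seq_compose:
  assumes X: "iid_seq M X" and [measurable]: "\<phi> \<in> borel_measurable borel"
  shows "iid_seq M (\<lambda>t \<omega>. \<phi> (X t \<omega>))"
proof -
  note [measurable] = iid_seq_measurable[OF X]
  have "distr M borel (\<lambda>\<omega>. \<phi> (X t \<omega>)) = distr (distr M borel (X t)) borel \<phi>" for t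
    by (simp add: distr_distr comp_def)
  moreover have "distr M borel (X t) = distr M borel (X 0)" for t
    using X by (simp add: iid_seq_def)
  moreover have "indep_vars (\<lambda>_. borel) (\<lambda>t \<omega>. \<phi> (X t \<omega>)) UNIV"
    by (rule indep_vars_compose2[of "\<lambda>_. borel" X]) (use X in \<open>auto simp: iid_seq_def\<close>)
  ultimately show ?thesis unfolding iid_seq_def by metis
qed

lemma iid_seq_integral:
  fixes \<phi> :: "_ \<Rightarrow> 'b::{banach, second_countable_topology}"
  assumes X: "iid_seq M X" and [measurable]: "\<phi> \<in> borel_measurable borel"
  shows "integrable M (\<lambda>\<omega>. \<phi> (X t \<omega>)) \<longleftrightarrow> integrable M (\<lambda>\<omega>. \<phi> (X 0 \<omega>))"
    and "(LINT \<omega>|M. \<phi> (X t \<omega>)) = (LINT \<omega>|M. \<phi> (X 0 \<omega>))"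
proof -
  note [measurable] = iid_seq_measurable[OF X]
  have eq: "distr M borel (X t) = distr M borel (X 0)"
    using X by (simp add: iid_seq_def)
  have "integrable (distr M borel (X t)) \<phi> \<longleftrightarrow> integrable (distr M borel (X 0)) \<phi>"
    by (simp add: eq)
  then show "integrable M (\<lambda>\<omega>. \<phi> (X t \<omega>)) \<longleftrightarrow> integrable M (\<lambda>\<omega>. \<phi> (X 0 \<omega>))"
    by (simp add: integrable_distr_eq)
  have "integral\<^sup>L (distr M borel (X t)) \<phi> = integral\<^sup>L (distr M borel (X 0)) \<phi>"
    by (simp add: eq)
  then show "(LINT \<omega>|M. \<phi> (X t \<omega>)) = (LINT \<omega>|M. \<phi> (X 0 \<omega>))"
    by (simp add: integral_distr)
qed

lemma iid_seq_integrable_iff: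
  fixes \<xi> :: "nat \<Rightarrow> 'a \<Rightarrow> real"
  assumes "iid_seq M \<xi>"
  shows "integrable M (\<xi> t) \<longleftrightarrow> integrable M (\<xi> 0)"
    and "expectation (\<xi> t) = expectation (\<xi> 0)"
    and "integrable M (\<lambda>\<omega>. (\<xi> t \<omega>)\<^sup>2) \<longleftrightarrow> integrable M (\<lambda>\<omega>. (\<xi> 0 \<omega>)\<^sup>2)"
    and "expectation (\<lambda>\<omega>. (\<xi> t \<omega>)\<^sup>2) = expectation (\<lambda>\<omega>. (\<xi> 0 \<omega>)\<^sup>2)"
  using iid_seq_integral[OF assms, of "\<lambda>x. x" t] iid_seq_integral[OF assms, of "\<lambda>x. x\<^sup>2" t] by simp_all

text \<open>Distinct terms are independent and centered, so their products integrate to zero and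
  only the diagonal of the double sum survives.\<close>

lemma second_moment_iid_sum:
  fixes \<xi> :: "nat \<Rightarrow> 'a \<Rightarrow> real"
  assumes iid: "iid_seq M \<xi>" and sq: "integrable M (\<lambda>\<omega>. (\<xi> 0 \<omega>)\<^sup>2)"
    and mean: "expectation (\<xi> 0) = 0" and "finite A"
  shows "integrable M (\<lambda>\<omega>. (\<Sum>t\<in>A. \<xi> t \<omega>)\<^sup>2)"
    and "expectation (\<lambda>\<omega>. (\<Sum>t\<in>A. \<xi> t \<omega>)\<^sup>2) = real (card A) * expectation (\<lambda>\<omega>. (\<xi> 0 \<omega>)\<^sup>2)"
proof -
  note [measurable] = iid_seq_measurable[OF iid]
  have sqt: "integrable M (\<lambda>\<omega>. (\<xi> t \<omega>)\<^sup>2)" for t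
    using sq iid_seq_integrable_iff(3)[OF iid] by simp
  have int: "integrable M (\<xi> t)" for t
    by (rule square_integrable_imp_integrable[OF _ sqt]) simp
  have prod: "integrable M (\<lambda>\<omega>. \<xi> t \<omega> * \<xi> u \<omega>) \<and>
      expectation (\<lambda>\<omega>. \<xi> t \<omega> * \<xi> u \<omega>) = (if t = u then expectation (\<lambda>\<omega>. (\<xi> 0 \<omega>)\<^sup>2) else 0)" for t u
  proof (cases "t = u")
    case True
    then show ?thesis
      using sqt[of t] iid_seq_integrable_iff(4)[OF iid, of t] by (simp add: power2_eq_square)
  next
    case False
    have ind: "indep_vars (\<lambda>_. borel) \<xi> {t, u}"
      using iid unfolding iid_seq_def by (auto intro: indep_vars_subset)
    have "integrable M (\<lambda>\<omega>. \<Prod>v\<in>{t, u}. \<xi> v \<omega>)"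
      using ind int by (intro indep_vars_integrable) auto
    moreover have "expectation (\<lambda>\<omega>. \<Prod>v\<in>{t, u}. \<xi> v \<omega>) = (\<Prod>v\<in>{t, u}. expectation (\<xi> v))"
      using ind int by (intro indep_vars_lebesgue_integral) auto
    moreover have "(\<Prod>v\<in>{t, u}. expectation (\<xi> v)) = 0"
      using False iid_seq_integrable_iff(2)[OF iid] mean by simp
    ultimately show ?thesis using False by simp
  qed
  have eq: "(\<Sum>t\<in>A. \<xi> t \<omega>)\<^sup>2 = (\<Sum>t\<in>A. \<Sum>u\<in>A. \<xi> t \<omega> * \<xi> u \<omega>)" for \<omega>
    by (simp add: power2_eq_square sum_product)
  show "integrable M (\<lambda>\<omega>. (\<Sum>t\<in>A. \<xi> t \<omega>)\<^sup>2)"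
    unfolding eq using prod by (intro Bochner_Integration.integrable_sum) blast
  have "expectation (\<lambda>\<omega>. (\<Sum>t\<in>A. \<xi> t \<omega>)\<^sup>2) =
    (\<Sum>t\<in>A. \<Sum>u\<in>A. if t = u then expectation (\<lambda>\<omega>. (\<xi> 0 \<omega>)\<^sup>2) else 0)"
    unfolding eq using prod by (simp add: Bochner_Integration.integral_sum Bochner_Integration.integrable_sum)
  then show "expectation (\<lambda>\<omega>. (\<Sum>t\<in>A. \<xi> t \<omega>)\<^sup>2) = real (card A) * expectation (\<lambda>\<omega>. (\<xi> 0 \<omega>)\<^sup>2)"
    using \<open>finite A\<close> by simp
qed

lemma truncation_L1:
  fixes f :: "'a \<Rightarrow> real"
  assumes f: "integrable M f" and "0 < e"
  shows "\<exists>k::nat. expectation (\<lambda>\<omega>. \<bar>f \<omega> - max (- real k) (min (real k) (f \<omega>))\<bar>) < e"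
proof -
  note [measurable] = borel_measurable_integrable[OF f]
  have "(\<lambda>k. expectation (\<lambda>\<omega>. \<bar>f \<omega> - max (- real k) (min (real k) (f \<omega>))\<bar>)) \<longlonglongrightarrow> expectation (\<lambda>\<omega>. 0)"
  proof (rule integral_dominated_convergence)
    show "integrable M (\<lambda>\<omega>. \<bar>f \<omega>\<bar>)" using f by simp
    show "AE \<omega> in M. (\<lambda>k. \<bar>f \<omega> - max (- real k) (min (real k) (f \<omega>))\<bar>) \<longlonglongrightarrow> 0"
    proof (rule AE_I2)
      fix \<omega>
      have "eventually (\<lambda>k. \<bar>f \<omega>\<bar> \<le> real k) sequentially"
        using filterlim_real_sequentially by (simp add: filterlim_at_top)
      then have "eventually (\<lambda>k. \<bar>f \<omega> - max (- real k) (min (real k) (f \<omega>))\<bar> = 0) sequentially"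
        by eventually_elim auto
      then show "(\<lambda>k. \<bar>f \<omega> - max (- real k) (min (real k) (f \<omega>))\<bar>) \<longlonglongrightarrow> 0"
        by (rule tendsto_eventually)
    qed
    show "AE \<omega> in M. norm \<bar>f \<omega> - max (- real k) (min (real k) (f \<omega>))\<bar> \<le> \<bar>f \<omega>\<bar>" for k
      by (rule AE_I2) (auto simp: max_def min_def)
  qed auto
  then have "eventually (\<lambda>k. expectation (\<lambda>\<omega>. \<bar>f \<omega> - max (- real k) (min (real k) (f \<omega>))\<bar>) < e) sequentially"
    using \<open>0 < e\<close> by (auto dest: order_tendstoD)
  then show ?thesis by (auto simp: eventually_sequentially)
qed

lemma weak_law_L1:
  fixes \<xi> :: "nat \<Rightarrow> 'a \<Rightarrow> real"
  assumes iid: "iid_seq M \<xi>" and int: "integrable M (\<xi> 0)"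
  shows "(\<lambda>n. expectation (\<lambda>\<omega>. \<bar>(1 / real n) * (\<Sum>t = 1..n. \<xi> t \<omega>) - expectation (\<xi> 0)\<bar>)) \<longlonglongrightarrow> 0"
proof (rule LIMSEQ_I)
  fix r :: real assume "0 < r"
  \<comment> \<open>The four error terms below are at most \<open>e / 2\<close>,
    \<open>e / 2\<close>, \<open>e\<close> and \<open>e\<close>, in total
    \<open>3 * e < r\<close>.\<close>
  define e where "e = r / 4"
  have e: "e > 0" using \<open>0 < r\<close> by (simp add: e_def)
  obtain k :: nat where k: "expectation (\<lambda>\<omega>. \<bar>\<xi> 0 \<omega> - max (- real k) (min (real k) (\<xi> 0 \<omega>))\<bar>) < e"
    using truncation_L1[OF int e] by blast
  define T where "T x = max (- real k) (min (real k) x)" for x :: real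
  have [measurable]: "T \<in> borel_measurable borel" unfolding T_def by measurable
  note [measurable] = iid_seq_measurable[OF iid]
  have T_bound: "\<bar>T x\<bar> \<le> real k" for x by (auto simp: T_def)
  have T_int: "integrable M (\<lambda>\<omega>. T (\<xi> t \<omega>))" for t
    by (rule integrable_const_bound[of _ "real k"]) (auto simp: T_bound)
  define m where "m = expectation (\<lambda>\<omega>. T (\<xi> 0 \<omega>))"
  define \<eta> where "\<eta> t \<omega> = T (\<xi> t \<omega>) - m" for t \<omega>
  have \<eta>_iid: "iid_seq M \<eta>"
    unfolding \<eta>_def by (rule iid_seq_compose[OF iid, of "\<lambda>x. T x - m"]) measurable
  note [measurable] = iid_seq_measurable[OF \<eta>_iid]
  have \<eta>_sq: "integrable M (\<lambda>\<omega>. (\<eta> 0 \<omega>)\<^sup>2)"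
  proof (rule integrable_const_bound[of _ "(real k + \<bar>m\<bar>)\<^sup>2"])
    have "\<bar>\<eta> 0 \<omega>\<bar> \<le> real k + \<bar>m\<bar>" for \<omega>
      using T_bound[of "\<xi> 0 \<omega>"] by (simp add: \<eta>_def)
    then show "AE \<omega> in M. norm ((\<eta> 0 \<omega>)\<^sup>2) \<le> (real k + \<bar>m\<bar>)\<^sup>2"
      by (intro AE_I2) (metis abs_le_square_iff abs_of_nonneg abs_ge_zero add_nonneg_nonneg of_nat_0_le_iff power2_abs real_norm_def norm_power)
  qed measurable
  have \<eta>_mean: "expectation (\<eta> 0) = 0"
    unfolding \<eta>_def using T_int by (simp add: m_def prob_space)
  define v where "v = expectation (\<lambda>\<omega>. (\<eta> 0 \<omega>)\<^sup>2)"
  have v: "v \<ge> 0" unfolding v_def by (rule Bochner_Integration.integral_nonneg) simp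
  define \<zeta> where "\<zeta> t \<omega> = \<xi> t \<omega> - T (\<xi> t \<omega>)" for t \<omega>
  have \<zeta>_int: "integrable M (\<zeta> t)" for t
    unfolding \<zeta>_def using int T_int iid_seq_integrable_iff(1)[OF iid, of t] by auto
  have \<zeta>_abs: "expectation (\<lambda>\<omega>. \<bar>\<zeta> t \<omega>\<bar>) < e" for t
    using iid_seq_integral(2)[OF iid, of "\<lambda>x. \<bar>x - T x\<bar>" t] k by (simp add: \<zeta>_def T_def)
  have mean: "expectation (\<xi> 0) = m + expectation (\<zeta> 0)"
    unfolding \<zeta>_def m_def using int T_int by simp
  obtain N :: nat where N: "real N > v / e\<^sup>2" using reals_Archimedean2 by blast
  show "\<exists>no. \<forall>n\<ge>no. norm (expectation (\<lambda>\<omega>. \<bar>(1 / real n) * (\<Sum>t = 1..n. \<xi> t \<omega>) - expectation (\<xi> 0)\<bar>) - 0) < r"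
  proof (intro exI[of _ "Suc N"] allI impI)
    fix n assume n: "n \<ge> Suc N"
    then have n0: "real n > 0" and nN: "v / e\<^sup>2 < real n" using N by auto
    let ?S = "\<lambda>\<omega>. (1 / real n) * (\<Sum>t = 1..n. \<eta> t \<omega>)"
    note sm = second_moment_iid_sum[OF \<eta>_iid \<eta>_sq \<eta>_mean, of "{1..n}"]
    have S_sq: "(?S \<omega>)\<^sup>2 = (1 / (real n)\<^sup>2) * (\<Sum>t = 1..n. \<eta> t \<omega>)\<^sup>2" for \<omega>
      by (simp add: power_mult_distrib power_divide)
    have S_int: "integrable M (\<lambda>\<omega>. (?S \<omega>)\<^sup>2)"
      unfolding S_sq using sm(1) by simp
    have "expectation (\<lambda>\<omega>. (?S \<omega>)\<^sup>2) = v / real n"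
      unfolding S_sq using sm(2) n0 by (simp add: v_def power2_eq_square)
    also have "\<dots> < e\<^sup>2" using nN n0 e by (simp add: field_simps)
    finally have S2: "expectation (\<lambda>\<omega>. (?S \<omega>)\<^sup>2) < e\<^sup>2" .
    \<comment> \<open>The dominating function collects the centered truncated average, the
      truncation errors in the sample, and the truncation error of the mean.\<close>
    let ?B = "\<lambda>\<omega>. ((?S \<omega>)\<^sup>2 / (2 * e) + e / 2) + (1 / real n) * (\<Sum>t = 1..n. \<bar>\<zeta> t \<omega>\<bar>) + \<bar>expectation (\<zeta> 0)\<bar>"
    have B_int: "integrable M ?B"
      using S_int \<zeta>_int by (intro Bochner_Integration.integrable_add integrable_mult_right
          Bochner_Integration.integrable_sum integrable_abs integrable_divide integrable_const) auto
    have pt: "\<bar>(1 / real n) * (\<Sum>t = 1..n. \<xi> t \<omega>) - expectation (\<xi> 0)\<bar> \<le> ?B \<omega>" for \<omega>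
    proof -
      have "(\<Sum>t = 1..n. \<xi> t \<omega>) = (\<Sum>t = 1..n. \<eta> t \<omega>) + (\<Sum>t = 1..n. \<zeta> t \<omega>) + real n * m"
        by (simp add: \<eta>_def \<zeta>_def sum.distrib sum_subtractf)
      then have "(1 / real n) * (\<Sum>t = 1..n. \<xi> t \<omega>) - expectation (\<xi> 0)
        = ?S \<omega> + (1 / real n) * (\<Sum>t = 1..n. \<zeta> t \<omega>) - expectation (\<zeta> 0)"
        using n0 by (simp add: mean field_simps)
      moreover have "\<bar>?S \<omega>\<bar> \<le> (?S \<omega>)\<^sup>2 / (2 * e) + e / 2"
        by (rule abs_le_square_div[OF e])
      moreover have "\<bar>(1 / real n) * (\<Sum>t = 1..n. \<zeta> t \<omega>)\<bar> \<le> (1 / real n) * (\<Sum>t = 1..n. \<bar>\<zeta> t \<omega>\<bar>)"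
        using n0 by (simp add: abs_mult divide_right_mono)
      ultimately show ?thesis by linarith
    qed
    have "expectation (\<lambda>\<omega>. \<bar>(1 / real n) * (\<Sum>t = 1..n. \<xi> t \<omega>) - expectation (\<xi> 0)\<bar>) \<le> expectation ?B"
    proof (rule integral_mono)
      show "integrable M (\<lambda>\<omega>. \<bar>(1 / real n) * (\<Sum>t = 1..n. \<xi> t \<omega>) - expectation (\<xi> 0)\<bar>)"
        using int iid_seq_integrable_iff(1)[OF iid]
        by (intro integrable_abs Bochner_Integration.integrable_diff integrable_mult_right
            Bochner_Integration.integrable_sum) auto
    qed (use B_int pt in auto)
    also have "expectation ?B = (expectation (\<lambda>\<omega>. (?S \<omega>)\<^sup>2) / (2 * e) + e / 2)
        + (1 / real n) * (\<Sum>t = 1..n. expectation (\<lambda>\<omega>. \<bar>\<zeta> t \<omega>\<bar>)) + \<bar>expectation (\<zeta> 0)\<bar>"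
      using S_int \<zeta>_int by (simp add: prob_space Bochner_Integration.integral_sum Bochner_Integration.integrable_sum)
    also have "\<dots> < (e / 2 + e / 2) + e + e"
    proof -
      have "expectation (\<lambda>\<omega>. (?S \<omega>)\<^sup>2) / (2 * e) < e / 2"
        using divide_strict_right_mono[OF S2, of "2 * e"] e by (simp add: power2_eq_square)
      moreover have "(\<Sum>t = 1..n. expectation (\<lambda>\<omega>. \<bar>\<zeta> t \<omega>\<bar>)) \<le> (\<Sum>t = 1..n. e)"
        by (intro sum_mono less_imp_le \<zeta>_abs)
      then have "(1 / real n) * (\<Sum>t = 1..n. expectation (\<lambda>\<omega>. \<bar>\<zeta> t \<omega>\<bar>)) \<le> e"
        using n0 by (simp add: field_simps)
      moreover have "\<bar>expectation (\<zeta> 0)\<bar> \<le> expectation (\<lambda>\<omega>. \<bar>\<zeta> 0 \<omega>\<bar>)"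
        by (rule integral_abs_bound)
      then have "\<bar>expectation (\<zeta> 0)\<bar> < e" using \<zeta>_abs[of 0] by linarith
      ultimately show ?thesis by linarith
    qed
    also have "\<dots> < r" using \<open>0 < r\<close> by (simp add: e_def)
    finally show "norm (expectation (\<lambda>\<omega>. \<bar>(1 / real n) * (\<Sum>t = 1..n. \<xi> t \<omega>) - expectation (\<xi> 0)\<bar>) - 0) < r"
      by (simp add: Bochner_Integration.integral_nonneg)
  qed
qed

end

text \<open>
  ``With probability tending to one''; the inner events \<open>A\<close> make sense of this for predicates such as
  suprema over a continuum of parameters, whose truth sets need not be measurable.
\<close>

definition whp :: "'a measure \<Rightarrow> (nat \<Rightarrow> 'a \<Rightarrow> bool) \<Rightarrow> bool" where
  "whp M P \<longleftrightarrow> (\<forall>\<gamma>>0. \<exists>N. \<forall>n\<ge>N. \<exists>A\<in>sets M. measure M A \<ge> 1 - \<gamma> \<and> (\<forall>\<omega>\<in>A. P n \<omega>))"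

text \<open>Tightness from above only; it is applied to nonnegative variables.\<close>

definition tight :: "'a measure \<Rightarrow> (nat \<Rightarrow> 'a \<Rightarrow> real) \<Rightarrow> bool" where
  "tight M a \<longleftrightarrow> (\<forall>\<gamma>>0. \<exists>K. \<forall>n\<ge>1. \<exists>A\<in>sets M. measure M A \<ge> 1 - \<gamma> \<and> (\<forall>\<omega>\<in>A. a n \<omega> \<le> K))"

section \<open>Calculus of events with probability tending to one\<close>

context prob_space
begin

lemma prob_Int_ge:
  assumes "A \<in> sets M" "B \<in> sets M" "prob A \<ge> 1 - a" "prob B \<ge> 1 - b"
  shows "prob (A \<inter> B) \<ge> 1 - (a + b)"
proof -
  have "prob (A \<union> B) \<le> 1" by simp
  moreover have "prob (A \<union> B) = prob A + prob B - prob (A \<inter> B)"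
    using assms by (intro measure_Un3) (auto simp: fmeasurable_eq_sets)
  ultimately show ?thesis using assms by linarith
qed

lemma whp_mono:
  assumes "whp M P" and "\<And>n \<omega>. n \<ge> N \<Longrightarrow> \<omega> \<in> space M \<Longrightarrow> P n \<omega> \<Longrightarrow> Q n \<omega>"
  shows "whp M Q"
  unfolding whp_def
proof (intro allI impI)
  fix \<gamma> :: real assume "\<gamma> > 0"
  then obtain N' where N': "\<forall>n\<ge>N'. \<exists>A\<in>sets M. prob A \<ge> 1 - \<gamma> \<and> (\<forall>\<omega>\<in>A. P n \<omega>)"
    using assms(1) unfolding whp_def by blast
  have "\<forall>n\<ge>max N N'. \<exists>A\<in>sets M. prob A \<ge> 1 - \<gamma> \<and> (\<forall>\<omega>\<in>A. Q n \<omega>)"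
  proof (intro allI impI)
    fix n assume n: "n \<ge> max N N'"
    then obtain A where A: "A \<in> sets M" "prob A \<ge> 1 - \<gamma>" "\<forall>\<omega>\<in>A. P n \<omega>"
      using N' by auto
    then have "A \<subseteq> space M" by (simp add: sets.sets_into_space)
    with A show "\<exists>A\<in>sets M. prob A \<ge> 1 - \<gamma> \<and> (\<forall>\<omega>\<in>A. Q n \<omega>)"
      using n assms(2)[of n] by (intro bexI[of _ A]) auto
  qed
  then show "\<exists>N. \<forall>n\<ge>N. \<exists>A\<in>sets M. prob A \<ge> 1 - \<gamma> \<and> (\<forall>\<omega>\<in>A. Q n \<omega>)" by blast
qed

lemma whp_conj:
  assumes "whp M P" "whp M Q"
  shows "whp M (\<lambda>n \<omega>. P n \<omega> \<and> Q n \<omega>)"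
  unfolding whp_def
proof (intro allI impI)
  fix \<gamma> :: real assume "\<gamma> > 0"
  then have "\<gamma> / 2 > 0" by simp
  obtain N1 where N1: "\<forall>n\<ge>N1. \<exists>A\<in>sets M. prob A \<ge> 1 - \<gamma> / 2 \<and> (\<forall>\<omega>\<in>A. P n \<omega>)"
    using assms(1) \<open>\<gamma> / 2 > 0\<close> unfolding whp_def by blast
  obtain N2 where N2: "\<forall>n\<ge>N2. \<exists>A\<in>sets M. prob A \<ge> 1 - \<gamma> / 2 \<and> (\<forall>\<omega>\<in>A. Q n \<omega>)"
    using assms(2) \<open>\<gamma> / 2 > 0\<close> unfolding whp_def by blast
  have "\<forall>n\<ge>max N1 N2. \<exists>A\<in>sets M. prob A \<ge> 1 - \<gamma> \<and> (\<forall>\<omega>\<in>A. P n \<omega> \<and> Q n \<omega>)"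
  proof (intro allI impI)
    fix n assume n: "n \<ge> max N1 N2"
    obtain A where A: "A \<in> sets M" "prob A \<ge> 1 - \<gamma> / 2" "\<forall>\<omega>\<in>A. P n \<omega>" using N1 n by auto
    obtain B where B: "B \<in> sets M" "prob B \<ge> 1 - \<gamma> / 2" "\<forall>\<omega>\<in>B. Q n \<omega>" using N2 n by auto
    show "\<exists>A\<in>sets M. prob A \<ge> 1 - \<gamma> \<and> (\<forall>\<omega>\<in>A. P n \<omega> \<and> Q n \<omega>)"
      using A B prob_Int_ge[OF A(1) B(1) A(2) B(2)] by (intro bexI[of _ "A \<inter> B"]) auto
  qed
  then show "\<exists>N. \<forall>n\<ge>N. \<exists>A\<in>sets M. prob A \<ge> 1 - \<gamma> \<and> (\<forall>\<omega>\<in>A. P n \<omega> \<and> Q n \<omega>)" by blast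
qed

lemma whp_True: "whp M (\<lambda>n \<omega>. True)"
  unfolding whp_def by (auto intro!: bexI[of _ "space M"] simp: prob_space)

lemma whp_ball:
  assumes "finite I" "\<And>i. i \<in> I \<Longrightarrow> whp M (P i)"
  shows "whp M (\<lambda>n \<omega>. \<forall>i\<in>I. P i n \<omega>)"
  using assms
proof (induction I)
  case empty
  then show ?case using whp_True by simp
next
  case (insert i I)
  then have "whp M (\<lambda>n \<omega>. P i n \<omega> \<and> (\<forall>i\<in>I. P i n \<omega>))" by (intro whp_conj) auto
  then show ?case by simp
qed

text \<open>Tightness provides a bound \<open>K\<close> that holds with probability close to one for
  every \<open>n\<close>, so an asymptotic claim may be proved separately for each fixed
  \<open>K\<close>. The bound on the noise sums enters the limit theorem this way.\<close>

lemma whp_tight: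
  assumes "tight M a" and "\<And>K. whp M (\<lambda>n \<omega>. a n \<omega> \<le> K \<longrightarrow> P n \<omega>)"
  shows "whp M P"
  unfolding whp_def
proof (intro allI impI)
  fix \<gamma> :: real assume "\<gamma> > 0"
  then have g: "\<gamma> / 2 > 0" by simp
  then obtain K where K: "\<forall>n\<ge>1. \<exists>A\<in>sets M. prob A \<ge> 1 - \<gamma> / 2 \<and> (\<forall>\<omega>\<in>A. a n \<omega> \<le> K)"
    using assms(1) unfolding tight_def by blast
  obtain N where N: "\<forall>n\<ge>N. \<exists>A\<in>sets M. prob A \<ge> 1 - \<gamma> / 2 \<and> (\<forall>\<omega>\<in>A. a n \<omega> \<le> K \<longrightarrow> P n \<omega>)"
    using assms(2)[of K] g unfolding whp_def by blast
  have "\<forall>n\<ge>max N 1. \<exists>A\<in>sets M. prob A \<ge> 1 - \<gamma> \<and> (\<forall>\<omega>\<in>A. P n \<omega>)"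
  proof (intro allI impI)
    fix n assume n: "n \<ge> max N 1"
    obtain A where A: "A \<in> sets M" "prob A \<ge> 1 - \<gamma> / 2" "\<forall>\<omega>\<in>A. a n \<omega> \<le> K" using K n by auto
    obtain B where B: "B \<in> sets M" "prob B \<ge> 1 - \<gamma> / 2" "\<forall>\<omega>\<in>B. a n \<omega> \<le> K \<longrightarrow> P n \<omega>" using N n by auto
    show "\<exists>A\<in>sets M. prob A \<ge> 1 - \<gamma> \<and> (\<forall>\<omega>\<in>A. P n \<omega>)"
      using A B prob_Int_ge[OF A(1) B(1) A(2) B(2)] by (intro bexI[of _ "A \<inter> B"]) auto
  qed
  then show "\<exists>N. \<forall>n\<ge>N. \<exists>A\<in>sets M. prob A \<ge> 1 - \<gamma> \<and> (\<forall>\<omega>\<in>A. P n \<omega>)" by blast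
qed

text \<open>Markov's inequality, turned around so as to produce the measurable good event that
  \<open>whp\<close> and \<open>tight\<close> ask for.\<close>

lemma Markov_complement:
  assumes u: "integrable M u" "\<And>\<omega>. 0 \<le> u \<omega>" and c: "0 < c" and bound: "expectation u \<le> \<gamma> * c"
  shows "\<exists>A\<in>sets M. prob A \<ge> 1 - \<gamma> \<and> (\<forall>\<omega>\<in>A. u \<omega> \<le> c)"
proof (intro bexI conjI ballI)
  note [measurable] = borel_measurable_integrable[OF u(1)]
  let ?B = "{\<omega> \<in> space M. c \<le> u \<omega>}"
  show "space M - ?B \<in> sets M" by measurable
  have "prob ?B \<le> expectation u / c"
    using integral_Markov_inequality_measure[OF u(1), of "{}" c] u(2) c by simp
  also have "\<dots> \<le> \<gamma>" using bound c by (simp add: field_simps)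
  finally have "prob ?B \<le> \<gamma>" .
  then show "prob (space M - ?B) \<ge> 1 - \<gamma>"
    using prob_compl[of ?B] by simp
  show "u \<omega> \<le> c" if "\<omega> \<in> space M - ?B" for \<omega> using that by auto
qed

lemma whp_weak_law:
  fixes \<xi> :: "nat \<Rightarrow> 'a \<Rightarrow> real"
  assumes iid: "iid_seq M \<xi>" and int: "integrable M (\<xi> 0)" and "0 < e"
  shows "whp M (\<lambda>n \<omega>. \<bar>(1 / real n) * (\<Sum>t = 1..n. \<xi> t \<omega>) - expectation (\<xi> 0)\<bar> \<le> e)"
  unfolding whp_def
proof (intro allI impI)
  fix \<gamma> :: real assume "\<gamma> > 0"
  with \<open>0 < e\<close> have "0 < \<gamma> * e" by simp
  from order_tendstoD(2)[OF weak_law_L1[OF iid int] this]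
  obtain N where N: "\<And>n. n \<ge> N \<Longrightarrow>
    expectation (\<lambda>\<omega>. \<bar>(1 / real n) * (\<Sum>t = 1..n. \<xi> t \<omega>) - expectation (\<xi> 0)\<bar>) < \<gamma> * e"
    unfolding eventually_sequentially by blast
  have "integrable M (\<xi> t)" for t using int iid_seq_integrable_iff(1)[OF iid] by simp
  then have "integrable M (\<lambda>\<omega>. \<bar>(1 / real n) * (\<Sum>t = 1..n. \<xi> t \<omega>) - expectation (\<xi> 0)\<bar>)" for n
    by (intro integrable_abs Bochner_Integration.integrable_diff integrable_mult_right
        Bochner_Integration.integrable_sum) auto
  from Markov_complement[OF this _ \<open>0 < e\<close> less_imp_le[OF N]]
  show "\<exists>N. \<forall>n\<ge>N. \<exists>A\<in>sets M. prob A \<ge> 1 - \<gamma> \<and>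
      (\<forall>\<omega>\<in>A. \<bar>(1 / real n) * (\<Sum>t = 1..n. \<xi> t \<omega>) - expectation (\<xi> 0)\<bar> \<le> e)"
    by (intro exI[of _ N] allI impI) simp
qed

lemma tight_normalized_sum:
  fixes \<xi> :: "nat \<Rightarrow> 'a \<Rightarrow> real"
  assumes iid: "iid_seq M \<xi>" and sq: "integrable M (\<lambda>\<omega>. (\<xi> 0 \<omega>)\<^sup>2)" and mean: "expectation (\<xi> 0) = 0"
  shows "tight M (\<lambda>n \<omega>. \<bar>(\<Sum>t = 1..n. \<xi> t \<omega>) / sqrt (real n)\<bar>)"
  unfolding tight_def
proof (intro allI impI)
  fix \<gamma> :: real assume \<gamma>: "\<gamma> > 0"
  define v where "v = expectation (\<lambda>\<omega>. (\<xi> 0 \<omega>)\<^sup>2)"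
  have v: "v \<ge> 0" unfolding v_def by (rule Bochner_Integration.integral_nonneg) simp
  \<comment> \<open>The summand 1 keeps \<open>c\<close> positive when the variance \<open>v\<close>
    is zero.\<close>
  define c where "c = v / \<gamma> + 1"
  have c: "c > 0" "v \<le> \<gamma> * c" using v \<gamma> by (auto simp: c_def field_simps intro: add_nonneg_pos)
  have "\<exists>A\<in>sets M. prob A \<ge> 1 - \<gamma> \<and> (\<forall>\<omega>\<in>A. \<bar>(\<Sum>t = 1..n. \<xi> t \<omega>) / sqrt (real n)\<bar> \<le> sqrt c)"
    if n: "n \<ge> 1" for n
  proof -
    let ?u = "\<lambda>\<omega>. (1 / real n) * (\<Sum>t = 1..n. \<xi> t \<omega>)\<^sup>2"
    note sm = second_moment_iid_sum[OF iid sq mean, of "{1..n}"]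
    have "expectation ?u = v" using sm(2) n by (simp add: v_def)
    then obtain A where A: "A \<in> sets M" "prob A \<ge> 1 - \<gamma>" "\<forall>\<omega>\<in>A. ?u \<omega> \<le> c"
      using Markov_complement[of ?u c \<gamma>] sm(1) c by auto
    have "\<bar>(\<Sum>t = 1..n. \<xi> t \<omega>) / sqrt (real n)\<bar> \<le> sqrt c" if "\<omega> \<in> A" for \<omega>
    proof (rule real_le_rsqrt)
      show "\<bar>(\<Sum>t = 1..n. \<xi> t \<omega>) / sqrt (real n)\<bar>\<^sup>2 \<le> c"
        using A(3) that n by (simp add: power_divide)
    qed
    with A show ?thesis by blast
  qed
  then show "\<exists>K. \<forall>n\<ge>1. \<exists>A\<in>sets M. prob A \<ge> 1 - \<gamma> \<and>
      (\<forall>\<omega>\<in>A. \<bar>(\<Sum>t = 1..n. \<xi> t \<omega>) / sqrt (real n)\<bar> \<le> K)" by blast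
qed

lemma tight_add:
  assumes "tight M a" "tight M b" shows "tight M (\<lambda>n \<omega>. a n \<omega> + b n \<omega>)"
  unfolding tight_def
proof (intro allI impI)
  fix \<gamma> :: real assume "\<gamma> > 0"
  then have g: "\<gamma> / 2 > 0" by simp
  obtain K where K: "\<forall>n\<ge>1. \<exists>A\<in>sets M. prob A \<ge> 1 - \<gamma> / 2 \<and> (\<forall>\<omega>\<in>A. a n \<omega> \<le> K)"
    using assms(1) g unfolding tight_def by blast
  obtain L where L: "\<forall>n\<ge>1. \<exists>A\<in>sets M. prob A \<ge> 1 - \<gamma> / 2 \<and> (\<forall>\<omega>\<in>A. b n \<omega> \<le> L)"
    using assms(2) g unfolding tight_def by blast
  have "\<forall>n\<ge>1. \<exists>A\<in>sets M. prob A \<ge> 1 - \<gamma> \<and> (\<forall>\<omega>\<in>A. a n \<omega> + b n \<omega> \<le> K + L)"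
  proof (intro allI impI)
    fix n :: nat assume n: "n \<ge> 1"
    obtain A where A: "A \<in> sets M" "prob A \<ge> 1 - \<gamma> / 2" "\<forall>\<omega>\<in>A. a n \<omega> \<le> K" using K n by auto
    obtain B where B: "B \<in> sets M" "prob B \<ge> 1 - \<gamma> / 2" "\<forall>\<omega>\<in>B. b n \<omega> \<le> L" using L n by auto
    show "\<exists>A\<in>sets M. prob A \<ge> 1 - \<gamma> \<and> (\<forall>\<omega>\<in>A. a n \<omega> + b n \<omega> \<le> K + L)"
      using A B prob_Int_ge[OF A(1) B(1) A(2) B(2)]
      by (intro bexI[of _ "A \<inter> B"]) (auto intro: add_mono)
  qed
  then show "\<exists>K. \<forall>n\<ge>1. \<exists>A\<in>sets M. prob A \<ge> 1 - \<gamma> \<and> (\<forall>\<omega>\<in>A. a n \<omega> + b n \<omega> \<le> K)" by blast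
qed

lemma tight_sum:
  assumes "finite I" "\<And>i. i \<in> I \<Longrightarrow> tight M (a i)"
  shows "tight M (\<lambda>n \<omega>. \<Sum>i\<in>I. a i n \<omega>)"
  using assms
proof (induction I)
  case empty
  show ?case unfolding tight_def
    by (auto intro!: exI[of _ 0] bexI[of _ "space M"] simp: prob_space)
next
  case (insert i I)
  then show ?case by (simp add: tight_add)
qed

text \<open>\<open>indep_rv\<close> speaks of preimages under variables of possibly different types.
  After composition with real functions the preimages form smaller families, closed under
  intersection, and the sigma-algebras they generate are independent. This is independence of two
  real variables, for which the product rule is available.\<close>

lemma indep_rv_mult:
  fixes f g :: "_ \<Rightarrow> real"
  assumes ind: "indep_rv M U V"
    and [measurable]: "f \<in> borel_measurable borel" "g \<in> borel_measurable borel"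
    and int: "integrable M (\<lambda>\<omega>. f (U \<omega>))" "integrable M (\<lambda>\<omega>. g (V \<omega>))"
  shows "integrable M (\<lambda>\<omega>. f (U \<omega>) * g (V \<omega>))"
    and "expectation (\<lambda>\<omega>. f (U \<omega>) * g (V \<omega>)) = expectation (\<lambda>\<omega>. f (U \<omega>)) * expectation (\<lambda>\<omega>. g (V \<omega>))"
proof -
  have [measurable]: "U \<in> borel_measurable M" "V \<in> borel_measurable M"
    and sets: "indep_set {U -` A \<inter> space M | A. A \<in> sets borel} {V -` A \<inter> space M | A. A \<in> sets borel}"
    using ind by (auto simp: indep_rv_def)
  have pre: "{(\<lambda>\<omega>. h (W \<omega>)) -` A \<inter> space M | A. A \<in> sets (borel :: real measure)} \<subseteq> {W -` A \<inter> space M | A. A \<in> sets borel}"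
    if h: "h \<in> borel_measurable borel" for h and W :: "_ \<Rightarrow> 'z::topological_space"
  proof clarify
    fix A :: "real set" assume "A \<in> sets borel"
    then have "h -` A \<in> sets borel" using measurable_sets[OF h, of A] by simp
    then show "\<exists>B. (\<lambda>\<omega>. h (W \<omega>)) -` A \<inter> space M = W -` B \<inter> space M \<and> B \<in> sets borel"
      by (intro exI[of _ "h -` A"]) auto
  qed
  have stable: "Int_stable {W -` A \<inter> space M | A. A \<in> sets (borel :: real measure)}" for W
  proof (rule Int_stableI)
    fix a b
    assume "a \<in> {W -` A \<inter> space M | A. A \<in> sets (borel :: real measure)}"
      "b \<in> {W -` A \<inter> space M | A. A \<in> sets (borel :: real measure)}"
    then obtain A B where "a = W -` A \<inter> space M" "b = W -` B \<inter> space M"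
        "A \<in> sets (borel :: real measure)" "B \<in> sets (borel :: real measure)" by auto
    then have "a \<inter> b = W -` (A \<inter> B) \<inter> space M" "A \<inter> B \<in> sets (borel :: real measure)" by auto
    then show "a \<inter> b \<in> {W -` A \<inter> space M | A. A \<in> sets (borel :: real measure)}" by blast
  qed
  have "indep_set {(\<lambda>\<omega>. f (U \<omega>)) -` A \<inter> space M | A. A \<in> sets borel}
      {(\<lambda>\<omega>. g (V \<omega>)) -` A \<inter> space M | A. A \<in> sets borel}"
    using sets pre[of f U] pre[of g V] unfolding indep_sets2_eq by (meson assms(2,3) order_trans subset_iff)
  then have "indep_set (sigma_sets (space M) {(\<lambda>\<omega>. f (U \<omega>)) -` A \<inter> space M | A. A \<in> sets borel})
      (sigma_sets (space M) {(\<lambda>\<omega>. g (V \<omega>)) -` A \<inter> space M | A. A \<in> sets borel})"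
    by (intro indep_set_sigma_sets stable)
  then have "indep_var borel (\<lambda>\<omega>. f (U \<omega>)) borel (\<lambda>\<omega>. g (V \<omega>))"
    unfolding indep_var_eq by auto
  then show "integrable M (\<lambda>\<omega>. f (U \<omega>) * g (V \<omega>))"
    and "expectation (\<lambda>\<omega>. f (U \<omega>) * g (V \<omega>)) = expectation (\<lambda>\<omega>. f (U \<omega>)) * expectation (\<lambda>\<omega>. g (V \<omega>))"
    using int by (auto intro: indep_var_integrable indep_var_lebesgue_integral)
qed

end

section \<open>Convergence to the chi-square distribution\<close>

context prob_space
begin

text \<open>Averages here run over the times \<open>1..n\<close>, while the central limit theorem
  sums from index 0; the shift bridges the two.\<close>

lemma indep_vars_Suc:
  assumes "indep_vars (\<lambda>_. N) X UNIV"
  shows "indep_vars (\<lambda>_. N) (\<lambda>i. X (Suc i)) UNIV"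
  unfolding indep_vars_def2 indep_sets_def
proof (intro conjI ballI allI impI)
  have rv: "random_variable N (X i)" for i using assms by (simp add: indep_vars_def)
  then show "random_variable N (X (Suc i))" for i by simp
  show "{X (Suc i) -` A \<inter> space M |A. A \<in> sets N} \<subseteq> events" for i
    using rv[of "Suc i"] by (auto intro: measurable_sets)
  fix J :: "nat set" and A
  assume J: "J \<subseteq> UNIV" "J \<noteq> {}" "finite J"
    and A: "A \<in> (\<Pi> i\<in>J. {X (Suc i) -` A \<inter> space M |A. A \<in> sets N})"
  have "prob (\<Inter>j\<in>Suc ` J. A (j - 1)) = (\<Prod>j\<in>Suc ` J. prob (A (j - 1)))"
    using assms J A unfolding indep_vars_def2
    by (intro indep_setsD[of "\<lambda>i. {X i -` A \<inter> space M |A. A \<in> sets N}" UNIV]) auto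
  then show "prob (\<Inter>j\<in>J. A j) = (\<Prod>j\<in>J. prob (A j))"
    by (simp add: prod.reindex)
qed

text \<open>The central limit theorem requires a positive variance \<open>v\<close>: it is applied
  to the sums divided by \<open>sqrt v\<close>, and evaluating the characteristic functions at
  \<open>sqrt v\<close> undoes the scaling. If the variance is zero, the sums vanish almost
  surely.\<close>

lemma iid_sum_char_tendsto:
  fixes \<xi> :: "nat \<Rightarrow> 'a \<Rightarrow> real"
  assumes iid: "iid_seq M \<xi>" and sq: "integrable M (\<lambda>\<omega>. (\<xi> 0 \<omega>)\<^sup>2)" and mean: "expectation (\<xi> 0) = 0"
  shows "(\<lambda>n. CLINT \<omega>|M. iexp ((\<Sum>t = 1..n. \<xi> t \<omega>) / sqrt (real n)))
    \<longlonglongrightarrow> complex_of_real (exp (- expectation (\<lambda>\<omega>. (\<xi> 0 \<omega>)\<^sup>2) / 2))"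
proof (cases "expectation (\<lambda>\<omega>. (\<xi> 0 \<omega>)\<^sup>2) = 0")
  case True
  note [measurable] = iid_seq_measurable[OF iid]
  have "(CLINT \<omega>|M. iexp ((\<Sum>t = 1..n. \<xi> t \<omega>) / sqrt (real n))) = 1" for n
  proof -
    note sm = second_moment_iid_sum[OF iid sq mean, of "{1..n}"]
    have "expectation (\<lambda>\<omega>. (\<Sum>t = 1..n. \<xi> t \<omega>)\<^sup>2) = 0" using sm(2) True by simp
    then have "AE \<omega> in M. (\<Sum>t = 1..n. \<xi> t \<omega>)\<^sup>2 = 0"
      using integral_nonneg_eq_0_iff_AE[OF sm(1)] by simp
    then have "AE \<omega> in M. iexp ((\<Sum>t = 1..n. \<xi> t \<omega>) / sqrt (real n)) = 1"
      by (rule AE_mp) (simp del: of_real_sum of_real_divide)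
    then have "(CLINT \<omega>|M. iexp ((\<Sum>t = 1..n. \<xi> t \<omega>) / sqrt (real n))) = (CLINT \<omega>|M. 1)"
      by (intro integral_cong_AE) simp_all
    then show ?thesis by (simp add: prob_space)
  qed
  then show ?thesis by (simp add: True)
next
  case False
  note [measurable] = iid_seq_measurable[OF iid]
  define v where "v = expectation (\<lambda>\<omega>. (\<xi> 0 \<omega>)\<^sup>2)"
  have "v \<ge> 0" unfolding v_def by (rule Bochner_Integration.integral_nonneg) simp
  then have v: "v > 0" using False unfolding v_def by linarith
  define X where "X i = \<xi> (Suc i)" for i
  have "weak_conv_m (\<lambda>n. distr M borel (\<lambda>\<omega>. (\<Sum>i<n. X i \<omega>) / sqrt (real n * (sqrt v)\<^sup>2))) std_normal_distribution"
  proof (rule central_limit_theorem_zero_mean)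
    show "indep_vars (\<lambda>i. borel) X UNIV"
      using iid unfolding X_def iid_seq_def by (intro indep_vars_Suc) auto
    show "expectation (X n) = 0" for n using iid_seq_integrable_iff(2)[OF iid] mean by (simp add: X_def)
    show "integrable M (\<lambda>x. (X n x)\<^sup>2)" for n using iid_seq_integrable_iff(3)[OF iid] sq by (simp add: X_def)
    show "variance (X n) = (sqrt v)\<^sup>2" for n
      using iid_seq_integrable_iff(2,4)[OF iid] mean v by (simp add: X_def v_def)
    show "distr M borel (X n) = distr M borel (\<xi> 0)" for n using iid by (simp add: X_def iid_seq_def)
  qed (use v in auto)
  then have "(\<lambda>n. char (distr M borel (\<lambda>\<omega>. (\<Sum>i<n. X i \<omega>) / sqrt (real n * (sqrt v)\<^sup>2))) (sqrt v))
      \<longlonglongrightarrow> char std_normal_distribution (sqrt v)"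
    by (intro levy_continuity1 real_distribution_distr) (auto simp: X_def real_dist_normal_dist)
  moreover have "char (distr M borel (\<lambda>\<omega>. (\<Sum>i<n. X i \<omega>) / sqrt (real n * (sqrt v)\<^sup>2))) (sqrt v)
      = (CLINT \<omega>|M. iexp ((\<Sum>t = 1..n. \<xi> t \<omega>) / sqrt (real n)))" for n
  proof -
    have "(\<Sum>i<n. X i \<omega>) = (\<Sum>t = 1..n. \<xi> t \<omega>)" for \<omega>
      unfolding X_def by (rule sum.reindex_bij_witness[of _ "\<lambda>t. t - 1" Suc]) auto
    then have "sqrt v * ((\<Sum>i<n. X i \<omega>) / sqrt (real n * (sqrt v)\<^sup>2)) = (\<Sum>t = 1..n. \<xi> t \<omega>) / sqrt (real n)" for \<omega>
      using v by (simp add: real_sqrt_mult)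
    then show ?thesis
      unfolding char_def by (subst integral_distr) (auto simp: X_def simp del: of_real_mult of_real_divide)
  qed
  ultimately show ?thesis using v by (simp add: char_std_normal_distribution v_def)
qed

end

section \<open>Standard Gaussian vectors and Laplace transforms of sums of squares\<close>

abbreviation gauss_vec :: "nat \<Rightarrow> (nat \<Rightarrow> real) measure" where
  "gauss_vec r \<equiv> PiM {..<r} (\<lambda>_. std_normal_distribution)"

lemma product_prob_space_std_normal: "product_prob_space (\<lambda>_::nat. std_normal_distribution)"
  by (intro product_prob_spaceI prob_space_normal_density) simp

lemma prob_space_gauss_vec: "prob_space (gauss_vec r)"
  by (intro prob_space_PiM prob_space_normal_density) simp

lemma gauss_vec_char:
  "(CLINT g|gauss_vec r. iexp (\<Sum>i<r. c i * g i)) = complex_of_real (exp (- (\<Sum>i<r. (c i)\<^sup>2) / 2))"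
proof -
  interpret product_prob_space "\<lambda>_::nat. std_normal_distribution" by (rule product_prob_space_std_normal)
  have "iexp (\<Sum>i<r. c i * g i) = (\<Prod>i<r. iexp (c i * g i))" for g :: "nat \<Rightarrow> real"
    by (simp add: exp_sum sum_distrib_left)
  then have "(CLINT g|gauss_vec r. iexp (\<Sum>i<r. c i * g i)) = (CLINT g|gauss_vec r. (\<Prod>i<r. iexp (c i * g i)))"
    by simp
  also have "\<dots> = (\<Prod>i<r. CLINT x|std_normal_distribution. iexp (c i * x))"
  proof (rule product_integral_prod)
    show "integrable std_normal_distribution (\<lambda>x. iexp (c i * x))" for i
      by (intro prob_space.integrable_iexp prob_space_normal_density) auto
  qed simp
  also have "\<dots> = (\<Prod>i<r. complex_of_real (exp (- ((c i)\<^sup>2) / 2)))"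
    by (simp add: char_std_normal_distribution char_def[symmetric] del: of_real_mult)
  also have "\<dots> = complex_of_real (exp (- (\<Sum>i<r. (c i)\<^sup>2) / 2))"
    by (simp add: exp_sum[symmetric] sum_negf sum_divide_distrib flip: of_real_prod)
  finally show ?thesis .
qed

context prob_space
begin

lemma laplace_sum_squares_tendsto:
  fixes X :: "nat \<Rightarrow> nat \<Rightarrow> 'a \<Rightarrow> real"
  assumes meas[measurable]: "\<And>n i. X n i \<in> borel_measurable M"
    and conv: "\<And>c. (\<lambda>n. CLINT \<omega>|M. iexp (\<Sum>i<r. c i * X n i \<omega>)) \<longlonglongrightarrow> complex_of_real (exp (- (\<Sum>i<r. (c i)\<^sup>2) / 2))"
    and "\<kappa> \<ge> 0"
  shows "(\<lambda>n. expectation (\<lambda>\<omega>. exp (- \<kappa> * (\<Sum>i<r. (X n i \<omega>)\<^sup>2) / 2)))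
    \<longlonglongrightarrow> (LINT g|gauss_vec r. exp (- \<kappa> * (\<Sum>i<r. (g i)\<^sup>2) / 2))"
proof -
  interpret G: prob_space "gauss_vec r" by (rule prob_space_gauss_vec)
  interpret P: pair_prob_space M "gauss_vec r" ..
  \<comment> \<open>Gaussian mixing: \<open>exp (- \<kappa> \<bar>x\<bar>\<^sup>2 / 2)\<close> is the mean of \<open>exp (i \<surd>\<kappa> g \<bullet> x)\<close> over a standard Gaussian \<open>g\<close>,
    so Laplace transforms of \<open>\<bar>X\<bar>\<^sup>2\<close> are governed by characteristic functions of linear combinations.\<close>
  have sq: "(sqrt \<kappa> * x)\<^sup>2 = \<kappa> * x\<^sup>2" for x using \<open>\<kappa> \<ge> 0\<close> by (simp add: power_mult_distrib)
  have swap: "complex_of_real (expectation (\<lambda>\<omega>. exp (- \<kappa> * (\<Sum>i<r. (X n i \<omega>)\<^sup>2) / 2)))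
    = (CLINT g|gauss_vec r. CLINT \<omega>|M. iexp (\<Sum>i<r. (sqrt \<kappa> * g i) * X n i \<omega>))" for n
  proof -
    have "complex_of_real (expectation (\<lambda>\<omega>. exp (- \<kappa> * (\<Sum>i<r. (X n i \<omega>)\<^sup>2) / 2)))
      = (CLINT \<omega>|M. complex_of_real (exp (- \<kappa> * (\<Sum>i<r. (X n i \<omega>)\<^sup>2) / 2)))"
      by (rule integral_complex_of_real[symmetric])
    also have "\<dots> = (CLINT \<omega>|M. CLINT g|gauss_vec r. iexp (\<Sum>i<r. (sqrt \<kappa> * X n i \<omega>) * g i))"
      by (simp only: gauss_vec_char sq sum_distrib_left[symmetric] mult_minus_left)
    also have "\<dots> = (CLINT \<omega>|M. CLINT g|gauss_vec r. iexp (\<Sum>i<r. (sqrt \<kappa> * g i) * X n i \<omega>))"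
      by (simp only: mult.assoc mult.commute[of "X n _ _"])
    also have "\<dots> = (CLINT g|gauss_vec r. CLINT \<omega>|M. iexp (\<Sum>i<r. (sqrt \<kappa> * g i) * X n i \<omega>))"
    proof (rule P.Fubini_integral[symmetric])
      have "(\<lambda>x. iexp (\<Sum>i<r. (sqrt \<kappa> * snd x i) * X n i (fst x))) \<in> borel_measurable (M \<Otimes>\<^sub>M gauss_vec r)"
        by measurable
      then show "integrable (M \<Otimes>\<^sub>M gauss_vec r) (\<lambda>(\<omega>, g). iexp (\<Sum>i<r. (sqrt \<kappa> * g i) * X n i \<omega>))"
        by (intro P.integrable_const_bound[of _ 1]) (auto simp: case_prod_beta' simp del: of_real_sum of_real_mult)
    qed
    finally show ?thesis .
  qed
  have "(\<lambda>n. CLINT g|gauss_vec r. CLINT \<omega>|M. iexp (\<Sum>i<r. (sqrt \<kappa> * g i) * X n i \<omega>))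
    \<longlonglongrightarrow> (CLINT g|gauss_vec r. complex_of_real (exp (- (\<Sum>i<r. (sqrt \<kappa> * g i)\<^sup>2) / 2)))"
  \<comment> \<open>For each fixed \<open>g\<close> the hypothesis \<open>conv\<close> applies with
    coefficients \<open>sqrt \<kappa> * g i\<close>. Characteristic functions have modulus at most
    1, and the constant 1 is integrable under the Gaussian law.\<close>
  proof (rule integral_dominated_convergence[where w = "\<lambda>_. 1"])
    show "AE g in gauss_vec r. norm (CLINT \<omega>|M. iexp (\<Sum>i<r. (sqrt \<kappa> * g i) * X n i \<omega>)) \<le> 1" for n
    proof (rule AE_I2)
      fix g :: "nat \<Rightarrow> real"
      have "norm (CLINT \<omega>|M. iexp (\<Sum>i<r. (sqrt \<kappa> * g i) * X n i \<omega>))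
          \<le> expectation (\<lambda>\<omega>. norm (iexp (\<Sum>i<r. (sqrt \<kappa> * g i) * X n i \<omega>)))"
        by (rule integral_norm_bound)
      then show "norm (CLINT \<omega>|M. iexp (\<Sum>i<r. (sqrt \<kappa> * g i) * X n i \<omega>)) \<le> 1"
        by (simp add: prob_space del: of_real_sum of_real_mult)
    qed
    show "(\<lambda>g. CLINT \<omega>|M. iexp (\<Sum>i<r. (sqrt \<kappa> * g i) * X n i \<omega>)) \<in> borel_measurable (gauss_vec r)" for n
      by (rule borel_measurable_lebesgue_integral) measurable
    show "AE g in gauss_vec r. (\<lambda>n. CLINT \<omega>|M. iexp (\<Sum>i<r. (sqrt \<kappa> * g i) * X n i \<omega>))
        \<longlonglongrightarrow> complex_of_real (exp (- (\<Sum>i<r. (sqrt \<kappa> * g i)\<^sup>2) / 2))"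
      by (intro AE_I2 conv)
  qed auto
  also have "(CLINT g|gauss_vec r. complex_of_real (exp (- (\<Sum>i<r. (sqrt \<kappa> * g i)\<^sup>2) / 2)))
     = complex_of_real (LINT g|gauss_vec r. exp (- \<kappa> * (\<Sum>i<r. (g i)\<^sup>2) / 2))"
    by (simp only: sq sum_distrib_left[symmetric] integral_complex_of_real mult_minus_left)
  finally show ?thesis unfolding swap[symmetric] by (simp only: tendsto_of_real_iff)
qed

end

section \<open>From Laplace transforms to weak convergence\<close>

lemma cts_step_bounds: "a < b \<Longrightarrow> 0 \<le> cts_step a b x" "a < b \<Longrightarrow> cts_step a b x \<le> 1"
  by (auto simp: cts_step_def field_simps)

lemma continuous_on_cts_step: "a < b \<Longrightarrow> continuous_on UNIV (cts_step a b)"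
  by (intro continuous_at_imp_continuous_on ballI isUCont_isCont cts_step_uniformly_continuous)

lemma borel_measurable_cts_step: "a < b \<Longrightarrow> cts_step a b \<in> borel_measurable borel"
  by (intro borel_measurable_continuous_onI continuous_on_cts_step)

text \<open>A continuous step vanishes beyond \<open>b\<close>, so in the variable
  \<open>y = exp (- s)\<close> it is constant near \<open>y = 0\<close>. Clipping \<open>y\<close>
  from below at \<open>exp (- b)\<close> avoids the logarithm at zero and gives a continuous
  extension to the whole line.\<close>

lemma cts_step_exp_transform:
  assumes "a < b"
  obtains f :: "real \<Rightarrow> real" where "continuous_on UNIV f" "\<And>s. f (exp (- s)) = cts_step a b s"
proof
  let ?f = "\<lambda>y. cts_step a b (- ln (max y (exp (- b))))"
  have "continuous_on UNIV (cts_step a b)"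
    by (rule continuous_on_cts_step[OF assms])
  moreover have "max y (exp (- b)) \<noteq> 0" for y :: real
    using exp_gt_zero[of "- b"] by (metis max.strict_coboundedI2 less_irrefl)
  then have "continuous_on UNIV (\<lambda>y. - ln (max y (exp (- b))))"
    by (intro continuous_on_minus continuous_on_ln continuous_on_max continuous_on_id continuous_on_const) auto
  ultimately show "continuous_on UNIV ?f"
    using continuous_on_compose2[of UNIV "cts_step a b" UNIV "\<lambda>y. - ln (max y (exp (- b)))"] by simp
  show "?f (exp (- s)) = cts_step a b s" for s
  proof (cases "s \<le> b")
    case True
    then have "max (exp (- s)) (exp (- b)) = exp (- s)" by simp
    then show ?thesis by simp
  next
    case False
    then have "max (exp (- s)) (exp (- b)) = exp (- b)" by simp
    then show ?thesis using False assms by (simp add: cts_step_def)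
  qed
qed

lemma laplace_imp_tendsto_exp_neg:
  fixes S :: "nat \<Rightarrow> 'a \<Rightarrow> real" and R :: "'b \<Rightarrow> real" and f :: "real \<Rightarrow> real"
  assumes M: "prob_space M" and N: "prob_space N"
    and [measurable]: "\<And>n. S n \<in> borel_measurable M" "R \<in> borel_measurable N"
    and nonneg: "\<And>n \<omega>. S n \<omega> \<ge> 0" "\<And>x. R x \<ge> 0"
    and laplace: "\<And>k::nat. (\<lambda>n. LINT \<omega>|M. exp (- real k * S n \<omega>)) \<longlonglongrightarrow> (LINT x|N. exp (- real k * R x))"
    and f: "continuous_on UNIV f"
  shows "(\<lambda>n. LINT \<omega>|M. f (exp (- S n \<omega>))) \<longlonglongrightarrow> (LINT x|N. f (exp (- R x)))"
proof (rule LIMSEQ_I)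
  \<comment> \<open>The Laplace transform at the integers gives the moments of \<open>exp (- S n)\<close>, which lives on \<open>{0..1}\<close>:
    approximate \<open>f\<close> by polynomials.\<close>
  interpret M: prob_space M by (rule M)
  interpret N: prob_space N by (rule N)
  have [measurable]: "f \<in> borel_measurable borel" using f by (rule borel_measurable_continuous_onI)
  fix r :: real assume "r > 0"
  \<comment> \<open>The polynomial costs \<open>r / 4\<close> under each of the two laws, and the
    convergence of its moments another \<open>r / 4\<close>: together less than
    \<open>r\<close>.\<close>
  then have "r / 4 > 0" by simp
  then obtain p where p: "real_polynomial_function p" "\<And>x. x \<in> {0..1} \<Longrightarrow> \<bar>f x - p x\<bar> < r / 4"
    using Stone_Weierstrass_real_polynomial_function[OF compact_Icc[of 0 1] continuous_on_subset[OF f subset_UNIV]]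
    by blast
  obtain a m where pa: "p = (\<lambda>x. \<Sum>i\<le>m. a i * x ^ i)"
    using p(1) unfolding real_polynomial_function_iff_sum by blast
  have pe: "p (exp (- s)) = (\<Sum>i\<le>m. a i * exp (- real i * s))" for s
    by (simp add: pa exp_of_nat_mult[symmetric])
  have intM: "integrable M (\<lambda>\<omega>. exp (- real k * S n \<omega>))" for k n
    by (rule M.integrable_const_bound[of _ 1]) (auto simp: nonneg)
  have intN: "integrable N (\<lambda>x. exp (- real k * R x))" for k
    by (rule N.integrable_const_bound[of _ 1]) (auto simp: nonneg)
  obtain B where B: "\<And>x. x \<in> {0..1} \<Longrightarrow> \<bar>f x\<bar> \<le> B"
  proof -
    have "bounded (f ` {0..1})"
      by (intro compact_imp_bounded compact_continuous_image continuous_on_subset[OF f]) auto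
    then obtain B where "\<forall>x\<in>{0..1}. norm (f x) \<le> B" unfolding bounded_iff by blast
    then show ?thesis using that[of B] by simp
  qed
  have range: "exp (- s) \<in> {0..1}" if "s \<ge> 0" for s :: real using that by simp
  have fM: "integrable M (\<lambda>\<omega>. f (exp (- S n \<omega>)))" for n
    by (rule M.integrable_const_bound[of _ B]) (use B range nonneg in auto)
  have fN: "integrable N (\<lambda>x. f (exp (- R x)))"
    by (rule N.integrable_const_bound[of _ B]) (use B range nonneg in auto)
  have pM: "integrable M (\<lambda>\<omega>. p (exp (- S n \<omega>)))" for n unfolding pe using intM by auto
  have pN: "integrable N (\<lambda>x. p (exp (- R x)))" unfolding pe using intN by auto
  have closeM: "\<bar>(LINT \<omega>|M. f (exp (- S n \<omega>))) - (LINT \<omega>|M. p (exp (- S n \<omega>)))\<bar> \<le> r / 4" for n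
  proof -
    have "\<bar>LINT \<omega>|M. f (exp (- S n \<omega>)) - p (exp (- S n \<omega>))\<bar> \<le> (LINT \<omega>|M. \<bar>f (exp (- S n \<omega>)) - p (exp (- S n \<omega>))\<bar>)"
      by (rule integral_abs_bound)
    also have "\<dots> \<le> (LINT \<omega>|M. r / 4)"
      by (rule integral_mono) (use fM pM p(2) range nonneg in \<open>auto intro: less_imp_le\<close>)
    finally show ?thesis using fM pM by (simp add: M.prob_space)
  qed
  have closeN: "\<bar>(LINT x|N. f (exp (- R x))) - (LINT x|N. p (exp (- R x)))\<bar> \<le> r / 4"
  proof -
    have "\<bar>LINT x|N. f (exp (- R x)) - p (exp (- R x))\<bar> \<le> (LINT x|N. \<bar>f (exp (- R x)) - p (exp (- R x))\<bar>)"
      by (rule integral_abs_bound)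
    also have "\<dots> \<le> (LINT x|N. r / 4)"
      by (rule integral_mono) (use fN pN p(2) range nonneg in \<open>auto intro: less_imp_le\<close>)
    finally show ?thesis using fN pN by (simp add: N.prob_space)
  qed
  have "(\<lambda>n. \<Sum>i\<le>m. a i * (LINT \<omega>|M. exp (- real i * S n \<omega>))) \<longlonglongrightarrow> (\<Sum>i\<le>m. a i * (LINT x|N. exp (- real i * R x)))"
    by (intro tendsto_intros laplace)
  then have "(\<lambda>n. LINT \<omega>|M. p (exp (- S n \<omega>))) \<longlonglongrightarrow> (LINT x|N. p (exp (- R x)))"
    unfolding pe using intM intN by (simp add: Bochner_Integration.integral_sum)
  from LIMSEQ_D[OF this \<open>r / 4 > 0\<close>] obtain n0 where
    n0: "\<And>n. n \<ge> n0 \<Longrightarrow> \<bar>(LINT \<omega>|M. p (exp (- S n \<omega>))) - (LINT x|N. p (exp (- R x)))\<bar> < r / 4" by auto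
  show "\<exists>no. \<forall>n\<ge>no. norm ((LINT \<omega>|M. f (exp (- S n \<omega>))) - (LINT x|N. f (exp (- R x)))) < r"
  proof (intro exI[of _ n0] allI impI)
    fix n assume "n \<ge> n0"
    from n0[OF this] closeM[of n] closeN \<open>r > 0\<close>
    show "norm ((LINT \<omega>|M. f (exp (- S n \<omega>))) - (LINT x|N. f (exp (- R x)))) < r"
      unfolding real_norm_def by linarith
  qed
qed

context prob_space
begin

text \<open>Slutsky's lemma for one test function. Uniform continuity handles the event on which
  \<open>T n\<close> and \<open>S n\<close> are close; since the step takes values between 0 and 1,
  the remaining event costs at most its probability.\<close>

lemma slutsky_cts_step:
  assumes [measurable]: "\<And>n. S n \<in> borel_measurable M" "\<And>n. T n \<in> borel_measurable M"
    and close: "\<And>e. e > 0 \<Longrightarrow> whp M (\<lambda>n \<omega>. \<bar>T n \<omega> - S n \<omega>\<bar> \<le> e)"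
    and lim: "(\<lambda>n. expectation (\<lambda>\<omega>. cts_step a b (S n \<omega>))) \<longlonglongrightarrow> l" and "a < b"
  shows "(\<lambda>n. expectation (\<lambda>\<omega>. cts_step a b (T n \<omega>))) \<longlonglongrightarrow> l"
proof -
  have [measurable]: "cts_step a b \<in> borel_measurable borel" by (rule borel_measurable_cts_step[OF \<open>a < b\<close>])
  have int: "integrable M (\<lambda>\<omega>. cts_step a b (U \<omega>))" if [measurable]: "U \<in> borel_measurable M" for U
    by (rule integrable_const_bound[of _ 1]) (use cts_step_bounds[OF \<open>a < b\<close>] in auto)
  have "(\<lambda>n. expectation (\<lambda>\<omega>. cts_step a b (T n \<omega>)) - expectation (\<lambda>\<omega>. cts_step a b (S n \<omega>))) \<longlonglongrightarrow> 0"
  proof (rule LIMSEQ_I)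
    fix r :: real assume r: "r > 0"
    then have r4: "r / 4 > 0" by simp
    from cts_step_uniformly_continuous[OF \<open>a < b\<close>, unfolded isUCont_def, rule_format, OF r4]
    obtain d where d: "d > 0" "\<And>x y. dist x y < d \<Longrightarrow> dist (cts_step a b x) (cts_step a b y) < r / 4"
      by blast
    from d(1) have "d / 2 > 0" by simp
    from close[OF this] r4 obtain N where
      N: "\<And>n. n \<ge> N \<Longrightarrow> \<exists>A\<in>sets M. prob A \<ge> 1 - r / 4 \<and> (\<forall>\<omega>\<in>A. \<bar>T n \<omega> - S n \<omega>\<bar> \<le> d / 2)"
      unfolding whp_def by blast
    show "\<exists>no. \<forall>n\<ge>no. norm (expectation (\<lambda>\<omega>. cts_step a b (T n \<omega>)) - expectation (\<lambda>\<omega>. cts_step a b (S n \<omega>)) - 0) < r"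
    proof (intro exI[of _ N] allI impI)
      fix n assume "n \<ge> N"
      then obtain A where A [measurable]: "A \<in> sets M" and A2: "prob A \<ge> 1 - r / 4"
        and A3: "\<And>\<omega>. \<omega> \<in> A \<Longrightarrow> \<bar>T n \<omega> - S n \<omega>\<bar> \<le> d / 2" using N by blast
      have pt: "\<bar>cts_step a b (T n \<omega>) - cts_step a b (S n \<omega>)\<bar> \<le> r / 4 + indicator (space M - A) \<omega>"
        if "\<omega> \<in> space M" for \<omega>
      proof (cases "\<omega> \<in> A")
        case True
        then have "dist (T n \<omega>) (S n \<omega>) < d" using A3[of \<omega>] d(1) by (simp add: dist_real_def)
        from d(2)[OF this] show ?thesis using True by (simp add: dist_real_def)
      next
        case False
        then show ?thesis
          using that r cts_step_bounds[OF \<open>a < b\<close>, of "T n \<omega>"] cts_step_bounds[OF \<open>a < b\<close>, of "S n \<omega>"]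
          by (simp add: abs_le_iff)
      qed
      have "\<bar>expectation (\<lambda>\<omega>. cts_step a b (T n \<omega>) - cts_step a b (S n \<omega>))\<bar>
          \<le> expectation (\<lambda>\<omega>. \<bar>cts_step a b (T n \<omega>) - cts_step a b (S n \<omega>)\<bar>)"
        by (rule integral_abs_bound)
      also have "\<dots> \<le> expectation (\<lambda>\<omega>. r / 4 + indicator (space M - A) \<omega>)"
        by (rule integral_mono) (use pt int in \<open>auto simp: less_top[symmetric]\<close>)
      also have "\<dots> = r / 4 + prob (space M - A)"
        by (simp add: prob_space less_top[symmetric])
      also have "prob (space M - A) \<le> r / 4" using A2 prob_compl[OF A] by simp
      finally show "norm (expectation (\<lambda>\<omega>. cts_step a b (T n \<omega>)) - expectation (\<lambda>\<omega>. cts_step a b (S n \<omega>)) - 0) < r"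
        using r int by (simp del: )
    qed
  qed
  from tendsto_add[OF this lim] show ?thesis by simp
qed

lemma chi_square_limit:
  fixes X :: "nat \<Rightarrow> nat \<Rightarrow> 'a \<Rightarrow> real"
  assumes meas[measurable]: "\<And>n i. X n i \<in> borel_measurable M" "\<And>n. T n \<in> borel_measurable M"
    and conv: "\<And>c. (\<lambda>n. CLINT \<omega>|M. iexp (\<Sum>i<r. c i * X n i \<omega>)) \<longlonglongrightarrow> complex_of_real (exp (- (\<Sum>i<r. (c i)\<^sup>2) / 2))"
    and close: "\<And>e. e > 0 \<Longrightarrow> whp M (\<lambda>n \<omega>. \<bar>T n \<omega> - (\<Sum>i<r. (X n i \<omega>)\<^sup>2)\<bar> \<le> e)"
  shows "weak_conv_m (\<lambda>n. distr M borel (T n)) (chi_square r)"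
proof (rule integral_cts_step_conv_imp_weak_conv)
  interpret G: prob_space "gauss_vec r" by (rule prob_space_gauss_vec)
  show "real_distribution (distr M borel (T n))" for n by (rule real_distribution_distr) simp
  have [measurable]: "(\<lambda>g. \<Sum>i<r. (g i)\<^sup>2) \<in> borel_measurable (gauss_vec r)" by measurable
  show "real_distribution (chi_square r)"
    unfolding chi_square_def by (rule G.real_distribution_distr) simp
  fix a b :: real assume "a < b"
  obtain f where f: "continuous_on UNIV f" "\<And>s. f (exp (- s)) = cts_step a b s"
    using cts_step_exp_transform[OF \<open>a < b\<close>] by blast
  have "(\<lambda>n. expectation (\<lambda>\<omega>. f (exp (- (\<Sum>i<r. (X n i \<omega>)\<^sup>2))))) \<longlonglongrightarrow> (LINT g|gauss_vec r. f (exp (- (\<Sum>i<r. (g i)\<^sup>2))))"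
  proof (rule laplace_imp_tendsto_exp_neg)
    \<comment> \<open>The parameter \<open>2 * real k\<close> cancels the factor 1/2 in the exponent
      of the Gaussian mixing identity.\<close>
    show "(\<lambda>n. expectation (\<lambda>\<omega>. exp (- real k * (\<Sum>i<r. (X n i \<omega>)\<^sup>2))))
        \<longlonglongrightarrow> (LINT g|gauss_vec r. exp (- real k * (\<Sum>i<r. (g i)\<^sup>2)))" for k
      using laplace_sum_squares_tendsto[OF meas(1) conv, of "2 * real k"] by simp
  qed (auto simp: prob_space_axioms G.prob_space_axioms sum_nonneg f(1))
  then have "(\<lambda>n. expectation (\<lambda>\<omega>. cts_step a b (\<Sum>i<r. (X n i \<omega>)\<^sup>2))) \<longlonglongrightarrow> (LINT g|gauss_vec r. cts_step a b (\<Sum>i<r. (g i)\<^sup>2))"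
    by (simp only: f(2))
  from slutsky_cts_step[OF _ _ close this \<open>a < b\<close>]
  have "(\<lambda>n. expectation (\<lambda>\<omega>. cts_step a b (T n \<omega>))) \<longlonglongrightarrow> (LINT g|gauss_vec r. cts_step a b (\<Sum>i<r. (g i)\<^sup>2))"
    by simp
  then show "(\<lambda>n. integral\<^sup>L (distr M borel (T n)) (cts_step a b)) \<longlonglongrightarrow> integral\<^sup>L (chi_square r) (cts_step a b)"
    unfolding chi_square_def by (simp add: integral_distr borel_measurable_cts_step[OF \<open>a < b\<close>])
qed

end

section \<open>Taylor expansion of the perceptron in its weights\<close>

lemma tanh_abs_le_1: "\<bar>tanh (x::real)\<bar> \<le> 1"
  using tanh_real_bounds[of x] by (simp add: abs_le_iff)

lemma tanh_square_le_1: "(tanh (x::real))\<^sup>2 \<le> 1"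
  by (simp add: abs_square_le_1 tanh_abs_le_1)

lemma DERIV_tanh_real: "(tanh has_real_derivative 1 - (tanh x)\<^sup>2) (at (x::real))"
  using has_field_derivative_tanh[OF cosh_real_nonzero DERIV_ident] by simp

lemma tanh_lipschitz: "\<bar>tanh (x::real) - tanh y\<bar> \<le> \<bar>x - y\<bar>"
proof -
  have "norm (tanh x - tanh y) \<le> 1 * norm (x - y)"
  proof (rule field_differentiable_bound[of UNIV tanh "\<lambda>x. 1 - (tanh x)\<^sup>2"])
    show "(tanh has_field_derivative 1 - (tanh x)\<^sup>2) (at x within UNIV)" for x :: real
      by (rule has_field_derivative_at_within[OF DERIV_tanh_real])
    show "norm (1 - (tanh x)\<^sup>2) \<le> 1" for x :: real
      using tanh_square_le_1[of x] zero_le_power2[of "tanh x"] by (simp only: real_norm_def abs_le_iff) linarith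
  qed auto
  then show ?thesis by simp
qed

text \<open>The derivatives of \<open>tanh\<close> of orders 0 to 3 as polynomials in
  \<open>tanh\<close>, a form from which uniform bounds follow by
  \<open>\<bar>tanh x\<bar> \<le> 1\<close>. Every larger index repeats the third
  derivative.\<close>

definition tanh_deriv :: "nat \<Rightarrow> real \<Rightarrow> real" where
  "tanh_deriv m x = (if m = 0 then tanh x else if m = 1 then 1 - (tanh x)\<^sup>2
     else if m = 2 then - 2 * tanh x * (1 - (tanh x)\<^sup>2)
     else (1 - (tanh x)\<^sup>2) * (6 * (tanh x)\<^sup>2 - 2))"

lemma tanh_deriv_bounds:
  "\<bar>tanh_deriv 1 x\<bar> \<le> 1" "\<bar>tanh_deriv 2 x\<bar> \<le> 2" "\<bar>tanh_deriv 3 x\<bar> \<le> 4"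
proof -
  have t: "0 \<le> (tanh x)\<^sup>2" "(tanh x)\<^sup>2 \<le> 1" by (simp_all add: tanh_square_le_1)
  then have a: "\<bar>1 - (tanh x)\<^sup>2\<bar> \<le> 1" by (simp add: abs_le_iff)
  then show "\<bar>tanh_deriv 1 x\<bar> \<le> 1" by (simp add: tanh_deriv_def)
  have "\<bar>tanh x\<bar> * \<bar>1 - (tanh x)\<^sup>2\<bar> \<le> 1 * 1" by (intro mult_mono tanh_abs_le_1 a) auto
  then show "\<bar>tanh_deriv 2 x\<bar> \<le> 2" by (simp add: tanh_deriv_def abs_mult)
  have "\<bar>6 * (tanh x)\<^sup>2 - 2\<bar> \<le> 4" using t by (simp only: abs_le_iff) linarith
  then have "\<bar>1 - (tanh x)\<^sup>2\<bar> * \<bar>6 * (tanh x)\<^sup>2 - 2\<bar> \<le> 1 * 4" by (intro mult_mono a) auto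
  then show "\<bar>tanh_deriv 3 x\<bar> \<le> 4" by (simp add: tanh_deriv_def abs_mult)
qed

lemma tanh_deriv_has_derivative:
  assumes "m < 3"
  shows "(tanh_deriv m has_real_derivative tanh_deriv (Suc m) x) (at x)"
proof -
  note D = DERIV_tanh_real[of x]
  have eqs: "tanh_deriv 0 = tanh" "tanh_deriv 1 = (\<lambda>x. 1 - (tanh x)\<^sup>2)"
    "tanh_deriv 2 = (\<lambda>x. - 2 * tanh x * (1 - (tanh x)\<^sup>2))"
    by (simp_all add: tanh_deriv_def fun_eq_iff)
  have 0: "(tanh_deriv 0 has_real_derivative tanh_deriv 1 x) (at x)"
    unfolding eqs by (rule D)
  have 1: "(tanh_deriv 1 has_real_derivative tanh_deriv 2 x) (at x)"
    unfolding eqs by (rule DERIV_cong[OF DERIV_diff[OF DERIV_const DERIV_power[OF D]]]) simp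
  have 2: "(tanh_deriv 2 has_real_derivative tanh_deriv 3 x) (at x)"
    unfolding eqs
    by (rule DERIV_cong[OF DERIV_mult[OF DERIV_cmult[OF D] DERIV_diff[OF DERIV_const DERIV_power[OF D]]]])
       (simp add: tanh_deriv_def algebra_simps power2_eq_square)
  from assms consider "m = 0" | "m = 1" | "m = 2" by linarith
  then show ?thesis
    by cases (use 0 1 2 in \<open>simp_all add: numeral_2_eq_2 numeral_3_eq_3\<close>)
qed

lemma tanh_taylor:
  assumes "0 < n" "n \<le> 3"
  shows "\<exists>t. tanh (u + v) = (\<Sum>m<n. tanh_deriv m u / fact m * v ^ m) + tanh_deriv n t / fact n * v ^ n"
proof (cases "v = 0")
  \<comment> \<open>Taylor's theorem requires two distinct points.\<close>
  case True
  have "(\<Sum>m<n. tanh_deriv m u / fact m * 0 ^ m) = tanh_deriv 0 u"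
    using assms by (subst sum.remove[of _ 0]) (auto simp: power_0_left intro!: sum.neutral)
  then show ?thesis using True assms by (simp add: tanh_deriv_def)
next
  case False
  have "\<exists>t. (if u + v < u then u + v < t \<and> t < u else u < t \<and> t < u + v) \<and>
     tanh (u + v) = (\<Sum>m<n. tanh_deriv m u / fact m * (u + v - u) ^ m) + tanh_deriv n t / fact n * (u + v - u) ^ n"
  proof (rule Taylor[where a = "min u (u + v)" and b = "max u (u + v)"])
    show "\<forall>m t. m < n \<and> min u (u + v) \<le> t \<and> t \<le> max u (u + v) \<longrightarrow>
        (tanh_deriv m has_real_derivative tanh_deriv (Suc m) t) (at t)"
      using assms tanh_deriv_has_derivative by auto
  qed (use assms False in \<open>auto simp: tanh_deriv_def\<close>)
  then show ?thesis by auto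
qed

text \<open>The bounds 2 and 4 on the second and third derivatives, divided by 2! and 3!, are at
  most 1; hence the constant 1 here and in the next expansion.\<close>

lemma tanh_expansion_1: "\<bar>tanh (u + v) - tanh u - v * tanh_deriv 1 u\<bar> \<le> v\<^sup>2"
proof -
  obtain t where t: "tanh (u + v) = (\<Sum>m<2. tanh_deriv m u / fact m * v ^ m) + tanh_deriv 2 t / fact 2 * v ^ 2"
    using tanh_taylor[of 2 u v] by auto
  have "tanh (u + v) - tanh u - v * tanh_deriv 1 u = tanh_deriv 2 t / 2 * v\<^sup>2"
    unfolding t by (simp add: numeral_2_eq_2 tanh_deriv_def)
  moreover have "\<bar>tanh_deriv 2 t / 2\<bar> * v\<^sup>2 \<le> 1 * v\<^sup>2"
    using tanh_deriv_bounds(2)[of t] by (intro mult_right_mono) auto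
  ultimately show ?thesis by (simp only: abs_mult abs_power2 mult_1)
qed

lemma tanh_expansion_2: "\<bar>tanh (u + v) - tanh u - v * tanh_deriv 1 u - v\<^sup>2 / 2 * tanh_deriv 2 u\<bar> \<le> \<bar>v\<bar> ^ 3"
proof -
  obtain t where t: "tanh (u + v) = (\<Sum>m<3. tanh_deriv m u / fact m * v ^ m) + tanh_deriv 3 t / fact 3 * v ^ 3"
    using tanh_taylor[of 3 u v] by auto
  have f3: "fact 3 = (6::real)" by (simp add: fact_numeral)
  have "(\<Sum>m<3. tanh_deriv m u / fact m * v ^ m) = tanh u + v * tanh_deriv 1 u + v\<^sup>2 / 2 * tanh_deriv 2 u"
    by (simp add: numeral_3_eq_3 numeral_2_eq_2 tanh_deriv_def)
  then have "tanh (u + v) - tanh u - v * tanh_deriv 1 u - v\<^sup>2 / 2 * tanh_deriv 2 u = tanh_deriv 3 t / 6 * v ^ 3"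
    unfolding t f3 by simp
  moreover have "\<bar>tanh_deriv 3 t / 6\<bar> * \<bar>v\<bar> ^ 3 \<le> 1 * \<bar>v\<bar> ^ 3"
    using tanh_deriv_bounds(3)[of t] by (intro mult_right_mono) auto
  ultimately show ?thesis by (simp only: abs_mult power_abs mult_1)
qed

lemma continuous_on_tanh_deriv:
  assumes "continuous_on S f" shows "continuous_on S (\<lambda>z. tanh_deriv m (f z))"
proof -
  have t: "continuous_on S (\<lambda>z. tanh (f z))"
    using assms by (intro continuous_on_tanh) (auto simp: cosh_real_nonzero)
  show ?thesis unfolding tanh_deriv_def by (cases "m = 0"; cases "m = 1"; cases "m = 2") (auto intro!: continuous_intros t)
qed

text \<open>\<open>J z\<close> is the derivative of \<open>\<lambda>W. F W z\<close> at \<open>W0\<close>, and \<open>B z\<close> half its second derivative.\<close>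

locale smooth_regression =
  fixes F :: "real ^ 'w::finite \<Rightarrow> real ^ 'l::finite \<Rightarrow> real ^ 'd::finite"
    and W0 :: "real ^ 'w" and \<Theta> :: "(real ^ 'w) set"
    and J :: "real ^ 'l \<Rightarrow> real ^ 'w \<Rightarrow> real ^ 'd"
    and B :: "real ^ 'l \<Rightarrow> real ^ 'w \<Rightarrow> real ^ 'w \<Rightarrow> real ^ 'd"
    and C :: real
  assumes C_ge_1: "1 \<le> C"
    and F_measurable: "F W \<in> borel_measurable borel"
    and F_bound: "W \<in> \<Theta> \<Longrightarrow> norm (F W z) \<le> C"
    and F_lipschitz: "W \<in> \<Theta> \<Longrightarrow> W' \<in> \<Theta> \<Longrightarrow> norm (F W z - F W' z) \<le> C * (1 + norm z) * norm (W - W')"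
    and F_lipschitz_W0: "norm h \<le> 1 \<Longrightarrow> norm (F (W0 + h) z - F W0 z) \<le> C * (1 + norm z) * norm h"
    and F_expansion_1: "norm h \<le> 1 \<Longrightarrow> norm (F (W0 + h) z - F W0 z - J z h) \<le> C * (1 + norm z)\<^sup>2 * (norm h)\<^sup>2"
    and F_expansion_2: "norm h \<le> 1 \<Longrightarrow>
      norm (F (W0 + h) z - F W0 z - J z h - B z h h) \<le> C * (1 + norm z) ^ 3 * norm h ^ 3"
    and J_linear: "linear (J z)"
    and J_bound: "norm (J z h) \<le> C * (1 + norm z) * norm h"
    and J_measurable: "(\<lambda>z. J z h) \<in> borel_measurable borel"
    and B_bilinear: "bilinear (B z)"
    and B_bound: "norm (B z h h') \<le> C * (1 + norm z)\<^sup>2 * norm h * norm h'"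
    and B_measurable: "(\<lambda>z. B z h h') \<in> borel_measurable borel"

section \<open>The perceptron as a smooth function of its weights\<close>

definition hidden_input :: "real ^ ('d::finite, 'l::finite, 'h::finite) weight \<Rightarrow> real ^ 'l \<Rightarrow> 'h \<Rightarrow> real" where
  "hidden_input W z j = (\<Sum>k\<in>UNIV. W $ Inr (j, Some k) * z $ k) + W $ Inr (j, None)"

lemma mlp_nth: "mlp W z $ i = (\<Sum>j\<in>UNIV. W $ Inl (i, Some j) * tanh (hidden_input W z j)) + W $ Inl (i, None)"
  by (simp add: mlp_def hidden_input_def)

lemma hidden_input_add: "hidden_input (W + V) z j = hidden_input W z j + hidden_input V z j"
  and hidden_input_diff: "hidden_input (W - V) z j = hidden_input W z j - hidden_input V z j"
  and hidden_input_scale: "hidden_input (c *\<^sub>R W) z j = c * hidden_input W z j"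
  by (simp_all add: hidden_input_def sum.distrib sum_subtractf sum_distrib_left algebra_simps)

lemma hidden_input_bound:
  fixes W :: "real ^ ('d::finite, 'l::finite, 'h::finite) weight"
  shows "\<bar>hidden_input W z j\<bar> \<le> real CARD('l) * (1 + norm z) * norm W"
proof -
  have "\<bar>hidden_input W z j\<bar> \<le> (\<Sum>k\<in>UNIV. \<bar>W $ Inr (j, Some k) * z $ k\<bar>) + \<bar>W $ Inr (j, None)\<bar>"
    unfolding hidden_input_def
    by (rule order_trans[OF abs_triangle_ineq add_right_mono[OF sum_abs]])
  also have "\<dots> \<le> (\<Sum>k\<in>(UNIV::'l set). norm W * norm z) + norm W"
    unfolding abs_mult by (intro add_mono sum_mono mult_mono component_le_norm_cart) auto
  also have "\<dots> \<le> real CARD('l) * (norm W * norm z) + real CARD('l) * norm W"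
    using mult_right_mono[of 1 "real CARD('l)" "norm W"] by simp
  finally show ?thesis by (simp add: algebra_simps)
qed

lemma continuous_on_hidden_input: "continuous_on S (\<lambda>z. hidden_input W z j)"
  unfolding hidden_input_def by (intro continuous_intros)

definition mlp_J :: "real ^ ('d::finite, 'l::finite, 'h::finite) weight \<Rightarrow> real ^ 'l
    \<Rightarrow> real ^ ('d, 'l, 'h) weight \<Rightarrow> real ^ 'd" where
  "mlp_J W z h = (\<chi> i. (\<Sum>j\<in>UNIV. h $ Inl (i, Some j) * tanh (hidden_input W z j)
      + W $ Inl (i, Some j) * hidden_input h z j * tanh_deriv 1 (hidden_input W z j)) + h $ Inl (i, None))"

text \<open>The mixed term is not symmetrised: \<open>h\<close> supplies the output weight and
  \<open>h'\<close> the hidden input. On the diagonal its coefficient is 1, because the mixed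
  derivative occurs twice in the second derivative and is then halved.\<close>

definition mlp_B :: "real ^ ('d::finite, 'l::finite, 'h::finite) weight \<Rightarrow> real ^ 'l
    \<Rightarrow> real ^ ('d, 'l, 'h) weight \<Rightarrow> real ^ ('d, 'l, 'h) weight \<Rightarrow> real ^ 'd" where
  "mlp_B W z h h' = (\<chi> i. \<Sum>j\<in>UNIV. h $ Inl (i, Some j) * hidden_input h' z j * tanh_deriv 1 (hidden_input W z j)
      + W $ Inl (i, Some j) / 2 * hidden_input h z j * hidden_input h' z j * tanh_deriv 2 (hidden_input W z j))"

lemma norm_le_card_mult:
  fixes x :: "real ^ 'd"
  assumes "\<And>i. \<bar>x $ i\<bar> \<le> c"
  shows "norm x \<le> real CARD('d) * c"
proof -
  have "norm x \<le> (\<Sum>i\<in>UNIV. \<bar>x $ i\<bar>)" by (rule norm_le_l1_cart)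
  also have "\<dots> \<le> (\<Sum>i\<in>(UNIV::'d set). c)" by (intro sum_mono assms)
  finally show ?thesis by simp
qed

lemma abs_sum_le_card_mult:
  fixes f :: "'h::finite \<Rightarrow> real"
  assumes "\<And>j. \<bar>f j\<bar> \<le> c"
  shows "\<bar>sum f UNIV\<bar> \<le> real CARD('h) * c"
  using order_trans[OF sum_abs sum_mono[of UNIV "\<lambda>j. \<bar>f j\<bar>" "\<lambda>_. c"]] assms by simp

lemma mlp_bound:
  fixes W :: "real ^ ('d::finite, 'l::finite, 'h::finite) weight"
  shows "norm (mlp W z) \<le> real CARD('d) * ((real CARD('h) + 1) * norm W)"
proof (rule norm_le_card_mult)
  fix i
  have "\<bar>\<Sum>j\<in>UNIV. W $ Inl (i, Some j) * tanh (hidden_input W z j)\<bar> \<le> real CARD('h) * (norm W * 1)"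
    unfolding abs_mult
    by (rule abs_sum_le_card_mult) (unfold abs_mult, intro mult_mono component_le_norm_cart tanh_abs_le_1, auto)
  moreover have "\<bar>W $ Inl (i, None)\<bar> \<le> norm W" by (rule component_le_norm_cart)
  ultimately show "\<bar>mlp W z $ i\<bar> \<le> (real CARD('h) + 1) * norm W"
    unfolding mlp_nth by (simp add: algebra_simps)
qed

text \<open>Each product of an output weight and an activation is varied one factor at a time.
  Activations are bounded by 1, and their variation is at most that of the hidden input, which is
  linear in the weights with a coefficient growing like \<open>norm z\<close>; the factor
  \<open>R\<close> bounds the output weight left in front.\<close>

lemma mlp_lipschitz:
  fixes W W' :: "real ^ ('d::finite, 'l::finite, 'h::finite) weight"
  assumes "norm W' \<le> R"
  shows "norm (mlp W z - mlp W' z) \<le> real CARD('d) * ((real CARD('h) * (1 + R * real CARD('l)) + 1) * (1 + norm z) * norm (W - W'))"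
proof (rule norm_le_card_mult)
  fix i
  have R: "R \<ge> 0" using order_trans[OF norm_ge_zero assms] .
  let ?D = "norm (W - W')"
  let ?t = "\<lambda>j. W $ Inl (i, Some j) * tanh (hidden_input W z j) - W' $ Inl (i, Some j) * tanh (hidden_input W' z j)"
  have t_bound: "\<bar>?t j\<bar> \<le> (1 + R * real CARD('l)) * (1 + norm z) * ?D" for j
  proof -
    have "?t j = (W - W') $ Inl (i, Some j) * tanh (hidden_input W z j)
        + W' $ Inl (i, Some j) * (tanh (hidden_input W z j) - tanh (hidden_input W' z j))"
      by (simp add: algebra_simps)
    moreover have "\<bar>(W - W') $ Inl (i, Some j) * tanh (hidden_input W z j)\<bar> \<le> ?D * 1"
      unfolding abs_mult by (intro mult_mono component_le_norm_cart tanh_abs_le_1) auto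
    moreover have "\<bar>tanh (hidden_input W z j) - tanh (hidden_input W' z j)\<bar> \<le> real CARD('l) * (1 + norm z) * ?D"
      using tanh_lipschitz hidden_input_bound[of "W - W'" z j] unfolding hidden_input_diff by (rule order_trans)
    then have "\<bar>W' $ Inl (i, Some j) * (tanh (hidden_input W z j) - tanh (hidden_input W' z j))\<bar>
        \<le> R * (real CARD('l) * (1 + norm z) * ?D)"
      unfolding abs_mult using R by (intro mult_mono order_trans[OF component_le_norm_cart assms]) auto
    ultimately have "\<bar>?t j\<bar> \<le> ?D + R * (real CARD('l) * (1 + norm z) * ?D)" by linarith
    moreover have "?D \<le> (1 + norm z) * ?D" by (simp add: mult_right_mono algebra_simps)
    ultimately have "\<bar>?t j\<bar> \<le> (1 + norm z) * ?D + R * (real CARD('l) * (1 + norm z) * ?D)" by linarith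
    then show ?thesis by (simp add: algebra_simps)
  qed
  have "(mlp W z - mlp W' z) $ i = (\<Sum>j\<in>UNIV. ?t j) + (W - W') $ Inl (i, None)"
    by (simp add: mlp_nth sum_subtractf)
  moreover have "\<bar>\<Sum>j\<in>UNIV. ?t j\<bar> \<le> real CARD('h) * ((1 + R * real CARD('l)) * (1 + norm z) * ?D)"
    by (rule abs_sum_le_card_mult) (rule t_bound)
  moreover have "\<bar>(W - W') $ Inl (i, None)\<bar> \<le> ?D" by (rule component_le_norm_cart)
  moreover have "?D \<le> (1 + norm z) * ?D" by (simp add: mult_right_mono algebra_simps)
  ultimately have "\<bar>(mlp W z - mlp W' z) $ i\<bar> \<le> real CARD('h) * ((1 + R * real CARD('l)) * (1 + norm z) * ?D) + (1 + norm z) * ?D"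
    by linarith
  then show "\<bar>(mlp W z - mlp W' z) $ i\<bar> \<le> (real CARD('h) * (1 + R * real CARD('l)) + 1) * (1 + norm z) * ?D"
    by (simp add: algebra_simps)
qed

text \<open>The product of an output-weight increment and an activation increment is already of
  second order; what remains is the first-order Taylor remainder of \<open>tanh\<close>, weighted by
  an output weight of \<open>W0\<close>.\<close>

lemma mlp_expansion_1:
  fixes W0 :: "real ^ ('d::finite, 'l::finite, 'h::finite) weight"
  shows "norm (mlp (W0 + h) z - mlp W0 z - mlp_J W0 z h) \<le> real CARD('d) * (real CARD('h) * ((real CARD('l) + norm W0 * (real CARD('l))\<^sup>2) * ((1 + norm z)\<^sup>2 * (norm h)\<^sup>2)))"
proof (rule norm_le_card_mult)
  fix i
  let ?u = "hidden_input W0 z" and ?v = "hidden_input h z" and ?Z = "1 + norm z"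
  let ?a = "\<lambda>j. W0 $ Inl (i, Some j)" and ?al = "\<lambda>j. h $ Inl (i, Some j)"
  let ?t = "\<lambda>j. ?al j * (tanh (?u j + ?v j) - tanh (?u j))
      + ?a j * (tanh (?u j + ?v j) - tanh (?u j) - ?v j * tanh_deriv 1 (?u j))"
  have "(mlp (W0 + h) z - mlp W0 z - mlp_J W0 z h) $ i = (\<Sum>j\<in>UNIV. ?t j)"
    by (simp add: mlp_nth mlp_J_def hidden_input_add sum_subtractf sum.distrib algebra_simps)
  moreover have "\<bar>?t j\<bar> \<le> (real CARD('l) + norm W0 * (real CARD('l))\<^sup>2) * (?Z\<^sup>2 * (norm h)\<^sup>2)" for j
  proof -
    have "\<bar>tanh (?u j + ?v j) - tanh (?u j)\<bar> \<le> real CARD('l) * ?Z * norm h"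
      using tanh_lipschitz[of "?u j + ?v j" "?u j"] hidden_input_bound[of h z j] by simp
    then have "\<bar>?al j * (tanh (?u j + ?v j) - tanh (?u j))\<bar> \<le> norm h * (real CARD('l) * ?Z * norm h)"
      unfolding abs_mult by (intro mult_mono component_le_norm_cart) auto
    also have "\<dots> = real CARD('l) * (?Z * (norm h)\<^sup>2)" by (simp add: power2_eq_square)
    also have "\<dots> \<le> real CARD('l) * (?Z\<^sup>2 * (norm h)\<^sup>2)"
      by (intro mult_left_mono mult_right_mono) (auto simp: power2_eq_square algebra_simps)
    finally have 1: "\<bar>?al j * (tanh (?u j + ?v j) - tanh (?u j))\<bar> \<le> real CARD('l) * (?Z\<^sup>2 * (norm h)\<^sup>2)" .
    have "(?v j)\<^sup>2 \<le> (real CARD('l) * ?Z * norm h)\<^sup>2" using hidden_input_bound[of h z j] by (metis abs_ge_zero power2_abs power_mono)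
    with tanh_expansion_1[of "?u j" "?v j"]
    have "\<bar>?a j * (tanh (?u j + ?v j) - tanh (?u j) - ?v j * tanh_deriv 1 (?u j))\<bar> \<le> norm W0 * (real CARD('l) * ?Z * norm h)\<^sup>2"
      unfolding abs_mult by (intro mult_mono component_le_norm_cart) auto
    also have "\<dots> = norm W0 * (real CARD('l))\<^sup>2 * (?Z\<^sup>2 * (norm h)\<^sup>2)" by (simp add: power_mult_distrib)
    finally have "\<bar>?t j\<bar> \<le> real CARD('l) * (?Z\<^sup>2 * (norm h)\<^sup>2) + norm W0 * (real CARD('l))\<^sup>2 * (?Z\<^sup>2 * (norm h)\<^sup>2)"
      using 1 by linarith
    then show ?thesis by (simp only: distrib_right)
  qed
  ultimately show "\<bar>(mlp (W0 + h) z - mlp W0 z - mlp_J W0 z h) $ i\<bar> \<le> real CARD('h) * ((real CARD('l) + norm W0 * (real CARD('l))\<^sup>2) * (?Z\<^sup>2 * (norm h)\<^sup>2))"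
    by (simp only:) (rule abs_sum_le_card_mult)
qed

text \<open>The same decomposition one order further: the output-weight increment multiplies the
  quadratic remainder \<open>?r\<close> of \<open>tanh\<close>, and the output weight of
  \<open>W0\<close> multiplies the cubic one.\<close>

lemma mlp_expansion_2:
  fixes W0 :: "real ^ ('d::finite, 'l::finite, 'h::finite) weight"
  shows "norm (mlp (W0 + h) z - mlp W0 z - mlp_J W0 z h - mlp_B W0 z h h)
    \<le> real CARD('d) * (real CARD('h) * (((real CARD('l))\<^sup>2 + norm W0 * real CARD('l) ^ 3) * ((1 + norm z) ^ 3 * norm h ^ 3)))"
proof (rule norm_le_card_mult)
  fix i
  let ?u = "hidden_input W0 z" and ?v = "hidden_input h z" and ?Z = "1 + norm z"
  let ?a = "\<lambda>j. W0 $ Inl (i, Some j)" and ?al = "\<lambda>j. h $ Inl (i, Some j)"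
  let ?r = "\<lambda>j. tanh (?u j + ?v j) - tanh (?u j) - ?v j * tanh_deriv 1 (?u j)"
  let ?t = "\<lambda>j. ?al j * ?r j + ?a j * (?r j - (?v j)\<^sup>2 / 2 * tanh_deriv 2 (?u j))"
  have "(mlp (W0 + h) z - mlp W0 z - mlp_J W0 z h - mlp_B W0 z h h) $ i = (\<Sum>j\<in>UNIV. ?t j)"
    by (simp add: mlp_nth mlp_J_def mlp_B_def hidden_input_add sum_subtractf sum.distrib algebra_simps power2_eq_square)
  moreover have "\<bar>?t j\<bar> \<le> ((real CARD('l))\<^sup>2 + norm W0 * real CARD('l) ^ 3) * (?Z ^ 3 * norm h ^ 3)" for j
  proof -
    have "(?v j)\<^sup>2 \<le> (real CARD('l) * ?Z * norm h)\<^sup>2" using hidden_input_bound[of h z j] by (metis abs_ge_zero power2_abs power_mono)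
    with tanh_expansion_1[of "?u j" "?v j"]
    have "\<bar>?al j * ?r j\<bar> \<le> norm h * (real CARD('l) * ?Z * norm h)\<^sup>2"
      unfolding abs_mult by (intro mult_mono component_le_norm_cart) auto
    also have "\<dots> = (real CARD('l))\<^sup>2 * (?Z\<^sup>2 * norm h ^ 3)" by (simp add: power2_eq_square power3_eq_cube)
    also have "\<dots> \<le> (real CARD('l))\<^sup>2 * (?Z ^ 3 * norm h ^ 3)"
      by (intro mult_left_mono mult_right_mono power_increasing) auto
    finally have 1: "\<bar>?al j * ?r j\<bar> \<le> (real CARD('l))\<^sup>2 * (?Z ^ 3 * norm h ^ 3)" .
    have "\<bar>?v j\<bar> ^ 3 \<le> (real CARD('l) * ?Z * norm h) ^ 3" using hidden_input_bound[of h z j] by (intro power_mono) auto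
    with tanh_expansion_2[of "?u j" "?v j"]
    have "\<bar>?r j - (?v j)\<^sup>2 / 2 * tanh_deriv 2 (?u j)\<bar> \<le> (real CARD('l) * ?Z * norm h) ^ 3"
      by (rule order_trans)
    then have "\<bar>?a j * (?r j - (?v j)\<^sup>2 / 2 * tanh_deriv 2 (?u j))\<bar> \<le> norm W0 * (real CARD('l) * ?Z * norm h) ^ 3"
      unfolding abs_mult by (intro mult_mono component_le_norm_cart) auto
    also have "\<dots> = norm W0 * real CARD('l) ^ 3 * (?Z ^ 3 * norm h ^ 3)" by (simp add: power_mult_distrib)
    finally have "\<bar>?t j\<bar> \<le> (real CARD('l))\<^sup>2 * (?Z ^ 3 * norm h ^ 3) + norm W0 * real CARD('l) ^ 3 * (?Z ^ 3 * norm h ^ 3)"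
      using 1 by linarith
    then show ?thesis by (simp add: distrib_right)
  qed
  ultimately show "\<bar>(mlp (W0 + h) z - mlp W0 z - mlp_J W0 z h - mlp_B W0 z h h) $ i\<bar>
      \<le> real CARD('h) * (((real CARD('l))\<^sup>2 + norm W0 * real CARD('l) ^ 3) * (?Z ^ 3 * norm h ^ 3))"
    by (simp only:) (rule abs_sum_le_card_mult)
qed

lemma mlp_J_bound:
  fixes W0 :: "real ^ ('d::finite, 'l::finite, 'h::finite) weight"
  shows "norm (mlp_J W0 z h) \<le> real CARD('d) * ((real CARD('h) * (1 + norm W0 * real CARD('l)) + 1) * (1 + norm z) * norm h)"
proof (rule norm_le_card_mult)
  fix i
  let ?t = "\<lambda>j. h $ Inl (i, Some j) * tanh (hidden_input W0 z j)
      + W0 $ Inl (i, Some j) * hidden_input h z j * tanh_deriv 1 (hidden_input W0 z j)"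
  have h: "norm h \<le> (1 + norm z) * norm h" by (simp add: mult_right_mono algebra_simps)
  have t: "\<bar>?t j\<bar> \<le> (1 + norm W0 * real CARD('l)) * (1 + norm z) * norm h" for j
  proof -
    have "\<bar>h $ Inl (i, Some j) * tanh (hidden_input W0 z j)\<bar> \<le> norm h * 1"
      unfolding abs_mult by (intro mult_mono component_le_norm_cart tanh_abs_le_1) auto
    moreover have "\<bar>W0 $ Inl (i, Some j) * hidden_input h z j * tanh_deriv 1 (hidden_input W0 z j)\<bar>
        \<le> norm W0 * (real CARD('l) * (1 + norm z) * norm h) * 1"
      unfolding abs_mult by (intro mult_mono component_le_norm_cart hidden_input_bound tanh_deriv_bounds(1)) auto
    ultimately have "\<bar>?t j\<bar> \<le> (1 + norm z) * norm h + norm W0 * (real CARD('l) * (1 + norm z) * norm h)"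
      using h by linarith
    then show ?thesis by (simp add: algebra_simps)
  qed
  from abs_sum_le_card_mult[of ?t, OF t]
  have "\<bar>mlp_J W0 z h $ i\<bar> \<le> real CARD('h) * ((1 + norm W0 * real CARD('l)) * (1 + norm z) * norm h) + (1 + norm z) * norm h"
    using component_le_norm_cart[of h "Inl (i, None)"] h unfolding mlp_J_def by simp
  then show "\<bar>mlp_J W0 z h $ i\<bar> \<le> (real CARD('h) * (1 + norm W0 * real CARD('l)) + 1) * (1 + norm z) * norm h"
    by (simp add: algebra_simps)
qed

lemma mlp_B_bound:
  fixes W0 :: "real ^ ('d::finite, 'l::finite, 'h::finite) weight"
  shows "norm (mlp_B W0 z h h') \<le> real CARD('d) * (real CARD('h) * ((real CARD('l) + norm W0 * (real CARD('l))\<^sup>2) * ((1 + norm z)\<^sup>2 * (norm h * norm h'))))"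
proof (rule norm_le_card_mult)
  fix i
  let ?Z = "1 + norm z"
  let ?t = "\<lambda>j. h $ Inl (i, Some j) * hidden_input h' z j * tanh_deriv 1 (hidden_input W0 z j)
      + W0 $ Inl (i, Some j) / 2 * hidden_input h z j * hidden_input h' z j * tanh_deriv 2 (hidden_input W0 z j)"
  have t: "\<bar>?t j\<bar> \<le> (real CARD('l) + norm W0 * (real CARD('l))\<^sup>2) * (?Z\<^sup>2 * (norm h * norm h'))" for j
  proof -
    have "\<bar>h $ Inl (i, Some j) * hidden_input h' z j * tanh_deriv 1 (hidden_input W0 z j)\<bar>
        \<le> norm h * (real CARD('l) * ?Z * norm h') * 1"
      unfolding abs_mult by (intro mult_mono component_le_norm_cart hidden_input_bound tanh_deriv_bounds(1)) auto
    also have "\<dots> = real CARD('l) * (?Z * (norm h * norm h'))" by simp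
    also have "\<dots> \<le> real CARD('l) * (?Z\<^sup>2 * (norm h * norm h'))"
      by (intro mult_left_mono mult_right_mono) (auto simp: power2_eq_square algebra_simps)
    finally have 1: "\<bar>h $ Inl (i, Some j) * hidden_input h' z j * tanh_deriv 1 (hidden_input W0 z j)\<bar>
        \<le> real CARD('l) * (?Z\<^sup>2 * (norm h * norm h'))" .
    have "\<bar>W0 $ Inl (i, Some j) / 2\<bar> \<le> norm W0 / 2"
      using component_le_norm_cart[of W0 "Inl (i, Some j)"] by simp
    then have "\<bar>W0 $ Inl (i, Some j) / 2 * hidden_input h z j * hidden_input h' z j * tanh_deriv 2 (hidden_input W0 z j)\<bar>
        \<le> norm W0 / 2 * (real CARD('l) * ?Z * norm h) * (real CARD('l) * ?Z * norm h') * 2"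
      unfolding abs_mult by (intro mult_mono hidden_input_bound tanh_deriv_bounds(2)) auto
    also have "\<dots> = norm W0 * (real CARD('l))\<^sup>2 * (?Z\<^sup>2 * (norm h * norm h'))" by (simp add: power2_eq_square)
    finally have "\<bar>?t j\<bar> \<le> real CARD('l) * (?Z\<^sup>2 * (norm h * norm h')) + norm W0 * (real CARD('l))\<^sup>2 * (?Z\<^sup>2 * (norm h * norm h'))"
      using 1 by linarith
    then show ?thesis by (simp add: distrib_right)
  qed
  from abs_sum_le_card_mult[of ?t, OF t]
  show "\<bar>mlp_B W0 z h h' $ i\<bar> \<le> real CARD('h) * ((real CARD('l) + norm W0 * (real CARD('l))\<^sup>2) * (?Z\<^sup>2 * (norm h * norm h')))"
    unfolding mlp_B_def by simp
qed


lemma linear_mlp_J: "linear (mlp_J W z)"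
  by (rule linearI)
     (simp_all add: mlp_J_def vec_eq_iff hidden_input_add hidden_input_scale sum.distrib sum_distrib_left algebra_simps)

lemma bilinear_mlp_B: "bilinear (mlp_B W z)"
  unfolding bilinear_def
  by (intro conjI allI linearI)
     (simp_all add: mlp_B_def vec_eq_iff hidden_input_add hidden_input_scale sum.distrib sum_distrib_left
        add_divide_distrib algebra_simps)

lemma continuous_on_tanh_hidden: "continuous_on S (\<lambda>z. tanh (hidden_input W z j))"
  by (intro continuous_on_tanh continuous_on_hidden_input) (simp add: cosh_real_nonzero)

lemma mlp_measurable: "mlp W \<in> borel_measurable borel"
proof (rule borel_measurable_continuous_onI)
  have "mlp W = (\<lambda>z. \<chi> i. (\<Sum>j\<in>UNIV. W $ Inl (i, Some j) * tanh (hidden_input W z j)) + W $ Inl (i, None))"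
    by (simp add: mlp_def hidden_input_def fun_eq_iff)
  then show "continuous_on UNIV (mlp W)"
    by (simp only:) (intro continuous_on_vec_lambda continuous_intros continuous_on_tanh_hidden)
qed

lemma mlp_J_measurable: "(\<lambda>z. mlp_J W z h) \<in> borel_measurable borel"
  unfolding mlp_J_def
  by (intro borel_measurable_continuous_onI continuous_on_vec_lambda continuous_intros
      continuous_on_hidden_input continuous_on_tanh_deriv continuous_on_tanh_hidden)

lemma mlp_B_measurable: "(\<lambda>z. mlp_B W z h h') \<in> borel_measurable borel"
  unfolding mlp_B_def
  by (intro borel_measurable_continuous_onI continuous_on_vec_lambda continuous_intros
      continuous_on_hidden_input continuous_on_tanh_deriv) auto

text \<open>Identifies the derivative in the definition of \<open>I0\<close> with the linear map of
  the expansion: by the quadratic remainder bound, the difference quotient is off by at most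
  \<open>c * \<bar>x\<bar>\<close>.\<close>

lemma mlp_partial_eq:
  fixes W :: "real ^ ('a::finite, 'b::finite, 'c::finite) weight"
  shows "mlp_partial W k z = mlp_J W z (axis k 1)"
proof -
  define c where "c = real CARD('a) * (real CARD('c) * ((real CARD('b) + norm W * (real CARD('b))\<^sup>2) * (1 + norm z)\<^sup>2))"
  have c: "norm (mlp (W + h) z - mlp W z - mlp_J W z h) \<le> c * (norm h)\<^sup>2" for h
    using mlp_expansion_1[of W h z] by (simp only: c_def mult.assoc)
  have "((\<lambda>x. mlp (W + x *\<^sub>R axis k 1) z) has_vector_derivative mlp_J W z (axis k 1)) (at 0)"
    unfolding has_vector_derivative_def has_derivative_at
  proof (intro conjI bounded_linear_scaleR_left)
    let ?q = "\<lambda>x. norm (mlp (W + (0 + x) *\<^sub>R axis k 1) z - mlp (W + 0 *\<^sub>R axis k 1) z - x *\<^sub>R mlp_J W z (axis k 1)) / norm x"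
    have "?q x \<le> c * \<bar>x\<bar>" for x
    proof -
      have "norm (mlp (W + (0 + x) *\<^sub>R axis k 1) z - mlp (W + 0 *\<^sub>R axis k 1) z - x *\<^sub>R mlp_J W z (axis k 1)) \<le> c * \<bar>x\<bar>\<^sup>2"
        using c[of "x *\<^sub>R axis k 1"] by (simp add: linear_scale[OF linear_mlp_J] norm_axis_1)
      then show ?thesis by (cases "x = 0") (simp_all add: field_simps power2_eq_square)
    qed
    moreover have "((\<lambda>x::real. c * \<bar>x\<bar>) \<longlongrightarrow> 0) (at 0)"
      by (auto intro!: tendsto_eq_intros)
    ultimately show "(?q \<longlongrightarrow> 0) (at 0)"
      by (intro tendsto_sandwich[of "\<lambda>_. 0" ?q _ "\<lambda>x. c * \<bar>x\<bar>"]) auto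
  qed
  then show ?thesis unfolding mlp_partial_def by (rule vector_derivative_at)
qed

lemma mlp_smooth_regression:
  fixes W0 :: "real ^ ('d::finite, 'l::finite, 'h::finite) weight"
  assumes "bounded \<Theta>"
  shows "\<exists>C. smooth_regression mlp W0 \<Theta> (mlp_J W0) (mlp_B W0) C"
proof -
  obtain R0 where R0: "\<And>W. W \<in> \<Theta> \<Longrightarrow> norm W \<le> R0" using assms unfolding bounded_iff by blast
  \<comment> \<open>\<open>W0\<close> may lie outside \<Theta> in this lemma, so the radius also
    covers its norm.\<close>
  define R where "R = max R0 (norm W0)"
  let ?l = "real CARD('l)" and ?H = "real CARD('h)" and ?d = "real CARD('d)"
  define c1 c2 c3 c4 c5 where "c1 = ?d * ((?H + 1) * R)" and "c2 = ?d * (?H * (1 + R * ?l) + 1)"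
    and "c3 = ?d * (?H * (?l + norm W0 * ?l\<^sup>2))" and "c4 = ?d * (?H * (?l\<^sup>2 + norm W0 * ?l ^ 3))"
    and "c5 = ?d * (?H * (1 + norm W0 * ?l) + 1)"
  have R: "0 \<le> R" "norm W0 \<le> R" "\<And>W. W \<in> \<Theta> \<Longrightarrow> norm W \<le> R"
    using R0 norm_ge_zero[of W0] by (auto simp: R_def max.coboundedI1 le_max_iff_disj simp del: norm_ge_zero)
  define C where "C = 1 + c1 + c2 + c3 + c4 + c5"
  have nn: "0 \<le> c1" "0 \<le> c2" "0 \<le> c3" "0 \<le> c4" "0 \<le> c5" using R(1) by (auto simp: c1_def c2_def c3_def c4_def c5_def)
  then have C: "1 \<le> C" "c1 \<le> C" "c2 \<le> C" "c3 \<le> C" "c4 \<le> C" "c5 \<le> C" by (auto simp: C_def)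
  have lip: "norm (mlp W z - mlp W' z) \<le> C * (1 + norm z) * norm (W - W')" if "norm W' \<le> R" for W W' :: "real ^ ('d, 'l, 'h) weight" and z
  proof -
    have "norm (mlp W z - mlp W' z) \<le> c2 * ((1 + norm z) * norm (W - W'))"
      using mlp_lipschitz[OF that, of W z] by (simp add: c2_def mult.assoc)
    also have "\<dots> \<le> C * ((1 + norm z) * norm (W - W'))" using C(3) by (intro mult_right_mono) auto
    finally show ?thesis by (simp add: mult.assoc)
  qed
  have "smooth_regression mlp W0 \<Theta> (mlp_J W0) (mlp_B W0) C"
  proof
    show "norm (mlp W z) \<le> C" if "W \<in> \<Theta>" for W z
    proof -
      have "norm (mlp W z) \<le> c1" unfolding c1_def
        by (rule order_trans[OF mlp_bound]) (use R(3)[OF that] in \<open>auto intro!: mult_left_mono\<close>)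
      then show ?thesis using C(2) by linarith
    qed
    show "norm (mlp W z - mlp W' z) \<le> C * (1 + norm z) * norm (W - W')" if "W \<in> \<Theta>" "W' \<in> \<Theta>" for W W' z
      using lip R(3)[OF that(2)] by blast
    show "norm (mlp (W0 + h) z - mlp W0 z) \<le> C * (1 + norm z) * norm h" for h z
      using lip[OF R(2), of "W0 + h" z] by simp
    show "norm (mlp (W0 + h) z - mlp W0 z - mlp_J W0 z h) \<le> C * (1 + norm z)\<^sup>2 * (norm h)\<^sup>2" for h z
    proof -
      have "norm (mlp (W0 + h) z - mlp W0 z - mlp_J W0 z h) \<le> c3 * ((1 + norm z)\<^sup>2 * (norm h)\<^sup>2)"
        using mlp_expansion_1[of W0 h z] by (simp only: c3_def mult.assoc)
      also have "\<dots> \<le> C * ((1 + norm z)\<^sup>2 * (norm h)\<^sup>2)" using C(4) by (intro mult_right_mono) auto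
      finally show ?thesis by (simp add: mult.assoc)
    qed
    show "norm (mlp (W0 + h) z - mlp W0 z - mlp_J W0 z h - mlp_B W0 z h h) \<le> C * (1 + norm z) ^ 3 * norm h ^ 3" for h z
    proof -
      have "norm (mlp (W0 + h) z - mlp W0 z - mlp_J W0 z h - mlp_B W0 z h h) \<le> c4 * ((1 + norm z) ^ 3 * norm h ^ 3)"
        using mlp_expansion_2[of W0 h z] by (simp only: c4_def mult.assoc)
      also have "\<dots> \<le> C * ((1 + norm z) ^ 3 * norm h ^ 3)" using C(5) by (intro mult_right_mono) auto
      finally show ?thesis by (simp add: mult.assoc)
    qed
    show "norm (mlp_J W0 z h) \<le> C * (1 + norm z) * norm h" for h z
    proof -
      have "norm (mlp_J W0 z h) \<le> c5 * ((1 + norm z) * norm h)"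
        using mlp_J_bound[of W0 z h] by (simp only: c5_def mult.assoc)
      also have "\<dots> \<le> C * ((1 + norm z) * norm h)" using C(6) by (intro mult_right_mono) auto
      finally show ?thesis by (simp add: mult.assoc)
    qed
    show "norm (mlp_B W0 z h h') \<le> C * (1 + norm z)\<^sup>2 * norm h * norm h'" for h h' z
    proof -
      have "norm (mlp_B W0 z h h') \<le> c3 * ((1 + norm z)\<^sup>2 * (norm h * norm h'))"
        using mlp_B_bound[of W0 z h h'] by (simp only: c3_def mult.assoc)
      also have "\<dots> \<le> C * ((1 + norm z)\<^sup>2 * (norm h * norm h'))" using C(4) by (intro mult_right_mono) auto
      finally show ?thesis by (simp add: mult.assoc)
    qed
  qed (use C in \<open>auto intro: mlp_measurable mlp_J_measurable mlp_B_measurable bilinear_mlp_B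
      simp: linear_add[OF linear_mlp_J] linear_scale[OF linear_mlp_J]\<close>)
  then show ?thesis by blast
qed

section \<open>Minimisers of perturbed quadratic forms\<close>

text \<open>On the compact unit sphere the form attains a positive minimum, and homogeneity of
  degree two carries it to all vectors.\<close>

lemma pos_def_lower_bound:
  fixes A :: "real ^ 'w::finite ^ 'w"
  assumes "pos_def A"
  shows "\<exists>c>0. \<forall>x. c * (norm x)\<^sup>2 \<le> x \<bullet> (A *v x)"
proof -
  let ?S = "sphere (0 :: real ^ 'w) 1"
  have cont: "continuous_on ?S (\<lambda>x. x \<bullet> (A *v x))"
    by (intro continuous_intros linear_continuous_on) (simp add: matrix_vector_mul_bounded_linear)
  have "axis undefined 1 \<in> ?S" by (simp add: norm_axis_1)
  then have "?S \<noteq> {}" by blast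
  from continuous_attains_inf[OF compact_sphere this cont] obtain x0 where x0: "x0 \<in> ?S" "\<And>x. x \<in> ?S \<Longrightarrow> x0 \<bullet> (A *v x0) \<le> x \<bullet> (A *v x)"
    by blast
  define c where "c = x0 \<bullet> (A *v x0)"
  have "x0 \<noteq> 0" using x0(1) by auto
  then have "c > 0" using assms by (simp add: pos_def_def c_def)
  moreover have "c * (norm x)\<^sup>2 \<le> x \<bullet> (A *v x)" for x
  proof (cases "x = 0")
    case False
    define y where "y = (1 / norm x) *\<^sub>R x"
    have xy: "x = norm x *\<^sub>R y" using False by (simp add: y_def)
    have "y \<in> ?S" using False by (simp add: y_def)
    then have "c \<le> y \<bullet> (A *v y)" using x0 by (simp add: c_def)
    then have "(norm x)\<^sup>2 * c \<le> (norm x)\<^sup>2 * (y \<bullet> (A *v y))" by (intro mult_left_mono) auto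
    also have "\<dots> = (norm x *\<^sub>R y) \<bullet> (A *v (norm x *\<^sub>R y))"
      by (simp add: matrix_vector_mult_scaleR power2_eq_square)
    finally show ?thesis using xy by (simp add: mult.commute)
  qed simp
  ultimately show ?thesis by blast
qed

section \<open>Geometry of the inner product given by a symmetric positive definite matrix\<close>

locale quadratic_form =
  fixes A :: "real ^ 'w::finite ^ 'w"
  assumes pd: "pos_def A" and sym: "\<And>x y. x \<bullet> (A *v y) = y \<bullet> (A *v x)"
begin

definition ip :: "real ^ 'w \<Rightarrow> real ^ 'w \<Rightarrow> real" where "ip x y = x \<bullet> (A *v y)"

definition nsq :: "real ^ 'w \<Rightarrow> real" where "nsq x = ip x x"

lemma ip_commute: "ip x y = ip y x" unfolding ip_def by (rule sym)

lemma ip_linear [simp]: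
  "ip (x + y) z = ip x z + ip y z" "ip x (y + z) = ip x y + ip x z"
  "ip (x - y) z = ip x z - ip y z" "ip x (y - z) = ip x y - ip x z"
  "ip (c *\<^sub>R x) y = c * ip x y" "ip x (c *\<^sub>R y) = c * ip x y"
  "ip 0 x = 0" "ip x 0 = 0"
  by (simp_all add: ip_def inner_add_left inner_add_right inner_diff_left inner_diff_right
      matrix_vector_right_distrib matrix_vector_mult_diff_distrib matrix_vector_mult_scaleR)

lemma ip_sum [simp]: "ip (\<Sum>i\<in>I. f i) y = (\<Sum>i\<in>I. ip (f i) y)" "ip y (\<Sum>i\<in>I. f i) = (\<Sum>i\<in>I. ip y (f i))"
proof -
  show 1: "ip (\<Sum>i\<in>I. f i) y = (\<Sum>i\<in>I. ip (f i) y)" for y by (simp add: ip_def inner_sum_left)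
  show "ip y (\<Sum>i\<in>I. f i) = (\<Sum>i\<in>I. ip y (f i))"
    unfolding ip_commute[of y] by (rule 1)
qed

lemma nsq_pos: "x \<noteq> 0 \<Longrightarrow> 0 < nsq x" using pd by (simp add: nsq_def ip_def pos_def_def)

lemma nsq_nonneg: "0 \<le> nsq x" using nsq_pos[of x] by (cases "x = 0") (auto simp: nsq_def)

lemma nsq_add: "nsq (x + y) = nsq x + 2 * ip x y + nsq y"
  by (simp add: nsq_def ip_commute[of y x])

lemma nsq_diff: "nsq (x - y) = nsq x - 2 * ip x y + nsq y"
  by (simp add: nsq_def ip_commute[of y x])

lemma ip_cauchy_schwarz: "\<bar>ip x y\<bar> \<le> sqrt (nsq x) * sqrt (nsq y)"
proof (cases "y = 0")
  case True then show ?thesis by (simp add: nsq_def)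
next
  case False
  then have y: "nsq y > 0" by (rule nsq_pos)
  have "0 \<le> nsq (x - (ip x y / nsq y) *\<^sub>R y)" by (rule nsq_nonneg)
  also have "\<dots> = nsq x - (ip x y)\<^sup>2 / nsq y"
    using y by (simp add: nsq_diff) (simp add: nsq_def field_simps power2_eq_square)
  finally have "(ip x y)\<^sup>2 \<le> nsq x * nsq y" using y by (simp add: field_simps)
  then have "sqrt ((ip x y)\<^sup>2) \<le> sqrt (nsq x * nsq y)" by (rule real_sqrt_le_mono)
  then show ?thesis by (simp add: real_sqrt_mult)
qed

lemma sqrt_nsq_triangle: "sqrt (nsq (x + y)) \<le> sqrt (nsq x) + sqrt (nsq y)"
proof (rule real_le_lsqrt)
  show "nsq (x + y) \<le> (sqrt (nsq x) + sqrt (nsq y))\<^sup>2"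
    using ip_cauchy_schwarz[of x y] nsq_nonneg[of x] nsq_nonneg[of y]
    by (simp add: nsq_add power2_sum abs_le_iff)
  show "0 \<le> sqrt (nsq x) + sqrt (nsq y)" by (intro add_nonneg_nonneg real_sqrt_ge_zero nsq_nonneg)
qed

text \<open>The vectors are built one at a time. Being \<open>ip\<close>-orthogonal to
  \<open>w\<close> means being Euclidean-orthogonal to \<open>A *v w\<close>, and as long as fewer
  than \<open>r\<close> vectors have been found, the images of a basis of \<open>V\<close> and of
  these vectors cannot span the space. The last claim is a dimension count: \<open>V\<close> lies in
  the Euclidean complement of the vectors \<open>A *v e i\<close>, and both have the same
  dimension.\<close>

lemma orthonormal_complement:
  fixes V :: "(real ^ 'w) set"
  assumes V: "subspace V" and dims: "dim V + r = CARD('w)"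
  obtains e :: "nat \<Rightarrow> real ^ 'w"
  where "\<And>i j. i < r \<Longrightarrow> j < r \<Longrightarrow> ip (e i) (e j) = (if i = j then 1 else 0)"
    and "\<And>i v. i < r \<Longrightarrow> v \<in> V \<Longrightarrow> ip (e i) v = 0"
    and "\<And>x. (\<And>i. i < r \<Longrightarrow> ip (e i) x = 0) \<Longrightarrow> x \<in> V"
proof -
  have "\<exists>e :: nat \<Rightarrow> real ^ 'w. (\<forall>i<m. \<forall>j<m. ip (e i) (e j) = (if i = j then 1 else 0)) \<and> (\<forall>i<m. \<forall>v\<in>V. ip (e i) v = 0)"
    if "m \<le> r" for m
    using that
  proof (induction m)
    case 0
    then show ?case by simp
  next
    case (Suc m)
    from Suc.IH[OF Suc_leD[OF Suc.prems]] obtain e :: "nat \<Rightarrow> real ^ 'w" where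
      e0: "(\<forall>i<m. \<forall>j<m. ip (e i) (e j) = (if i = j then 1 else 0)) \<and> (\<forall>i<m. \<forall>v\<in>V. ip (e i) v = 0)" ..
    then have e: "\<And>i j. i < m \<Longrightarrow> j < m \<Longrightarrow> ip (e i) (e j) = (if i = j then 1 else 0)"
         "\<And>i v. i < m \<Longrightarrow> v \<in> V \<Longrightarrow> ip (e i) v = 0" by blast+
    obtain b where b: "b \<subseteq> V" "independent b" "V \<subseteq> span b" "card b = dim V" by (rule basis_exists[of V])
    then have "finite b" by (intro independent_imp_finite)
    let ?T = "(\<lambda>x. A *v x) ` (b \<union> e ` {..<m})"
    have "dim ?T \<le> card ?T" using \<open>finite b\<close> by (intro dim_le_card') auto
    also have "\<dots> \<le> card (b \<union> e ` {..<m})" using \<open>finite b\<close> by (intro card_image_le) auto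
    also have "\<dots> \<le> card b + card (e ` {..<m})" by (rule card_Un_le)
    also have "\<dots> \<le> dim V + m" using b(4) card_image_le[of "{..<m}" e] by simp
    also have "\<dots> < DIM(real ^ 'w)" using Suc.prems dims by simp
    finally obtain y where y: "y \<noteq> 0" "\<And>w. w \<in> span ?T \<Longrightarrow> orthogonal y w"
      using orthogonal_to_subspace_exists by blast
    have yb: "ip y w = 0" if "w \<in> b \<union> e ` {..<m}" for w
      using y(2)[OF span_base[of "A *v w" ?T]] that by (auto simp: orthogonal_def ip_def)
    have yV: "ip y v = 0" if "v \<in> V" for v
    proof -
      have "v \<in> span b" using that b by auto
      then show ?thesis
      proof (induction rule: span_induct_alt)
        case (step c x y)
        then show ?case using yb[of x] by simp
      qed simp
    qed
    define x where "x = (1 / sqrt (nsq y)) *\<^sub>R y"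
    have ny: "nsq y > 0" using y(1) by (rule nsq_pos)
    have xx: "ip x x = 1" using ny by (simp add: x_def nsq_def)
    have xe: "ip x (e i) = 0" if "i < m" for i using yb[of "e i"] that by (simp add: x_def)
    have ex: "ip (e i) x = 0" if "i < m" for i using xe[OF that] ip_commute[of "e i" x] by simp
    have xV: "ip x v = 0" if "v \<in> V" for v using yV[OF that] by (simp add: x_def)
    show ?case
    proof (intro exI[of _ "e(m := x)"] conjI allI impI ballI)
      fix i j assume "i < Suc m" "j < Suc m"
      then show "ip ((e(m := x)) i) ((e(m := x)) j) = (if i = j then 1 else 0)"
        using e(1) xx xe ex by (auto simp: less_Suc_eq)
    next
      fix i v assume "i < Suc m" "v \<in> V"
      then show "ip ((e(m := x)) i) v = 0" using e(2) xV by (auto simp: less_Suc_eq)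
    qed
  qed
  from this[OF order_refl] obtain e :: "nat \<Rightarrow> real ^ 'w" where
    e0: "(\<forall>i<r. \<forall>j<r. ip (e i) (e j) = (if i = j then 1 else 0)) \<and> (\<forall>i<r. \<forall>v\<in>V. ip (e i) v = 0)" ..
  then have e: "\<And>i j. i < r \<Longrightarrow> j < r \<Longrightarrow> ip (e i) (e j) = (if i = j then 1 else 0)"
       "\<And>i v. i < r \<Longrightarrow> v \<in> V \<Longrightarrow> ip (e i) v = 0" by blast+
  let ?E = "(\<lambda>i. A *v e i) ` {..<r}"
  let ?P = "{y. \<forall>x\<in>span ?E. orthogonal x y}"
  have inj: "inj_on (\<lambda>i. A *v e i) {..<r}"
  proof (rule inj_onI)
    fix i j assume "i \<in> {..<r}" "j \<in> {..<r}" "A *v e i = A *v e j"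
    then show "i = j" using e(1)[of i i] e(1)[of i j] by (auto simp: ip_def split: if_splits)
  qed
  have indE: "independent ?E"
  proof (rule independent_if_scalars_zero)
    fix f x assume s: "(\<Sum>x\<in>?E. f x *\<^sub>R x) = 0" and "x \<in> ?E"
    then obtain j where j: "j < r" "x = A *v e j" by auto
    have "0 = e j \<bullet> (\<Sum>i<r. f (A *v e i) *\<^sub>R (A *v e i))"
      using s inj by (simp add: sum.reindex)
    also have "\<dots> = (\<Sum>i<r. f (A *v e i) * (if j = i then 1 else 0))"
      unfolding inner_sum_right inner_scaleR_right
      using e(1)[OF j(1)] by (intro sum.cong) (simp_all add: ip_def)
    also have "\<dots> = (\<Sum>i<r. if j = i then f (A *v e i) else 0)" by (intro sum.cong) auto
    also have "\<dots> = f x" using j by simp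
    finally show "f x = 0" by simp
  qed simp
  have "dim (span ?E) = r"
    unfolding dim_span dim_eq_card_independent[OF indE] card_image[OF inj] by simp
  moreover have "dim {y \<in> UNIV. \<forall>x\<in>span ?E. orthogonal x y} + dim (span ?E) = dim (UNIV :: (real ^ 'w) set)"
    by (rule dim_subspace_orthogonal_to_vectors) auto
  ultimately have "dim ?P + r = CARD('w)" by simp
  then have dimP: "dim ?P = dim V" using dims by simp
  have "V \<subseteq> ?P"
  proof clarify
    fix v x assume v: "v \<in> V" and "x \<in> span ?E"
    from this(2) show "orthogonal x v"
    proof (induction rule: span_induct_alt)
      case (step c w y)
      then obtain i where i: "i < r" "w = A *v e i" by auto
      have "w \<bullet> v = ip v (e i)" by (simp add: i ip_def inner_commute)
      then have "w \<bullet> v = 0" using e(2)[OF i(1) v] ip_commute[of v "e i"] by simp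
      then show ?case using step by (simp add: orthogonal_def inner_add_left)
    qed (simp add: orthogonal_def)
  qed
  moreover have "subspace ?P" by (rule subspace_orthogonal_to_vectors)
  ultimately have VP: "V = ?P" using V dimP by (intro subspace_dim_equal) auto
  have "x \<in> V" if x: "\<And>i. i < r \<Longrightarrow> ip (e i) x = 0" for x
  proof -
    have "orthogonal y x" if "y \<in> span ?E" for y
      using that
    proof (induction rule: span_induct_alt)
      case (step c w y)
      then obtain i where i: "i < r" "w = A *v e i" by auto
      have "w \<bullet> x = ip x (e i)" by (simp add: i ip_def inner_commute)
      then have "w \<bullet> x = 0" using x[OF i(1)] ip_commute[of x "e i"] by simp
      then show ?case using step by (simp add: orthogonal_def inner_add_left)
    qed (simp add: orthogonal_def)
    then show ?thesis using VP by blast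
  qed
  with e show ?thesis by (rule that)
qed

text \<open>The deterministic core. Here \<psi> is the rescaled cost, \<open>g\<close> the score,
  and \<open>us\<close>, \<open>uq\<close> are the minimisers of the exact quadratic form on the
  whole space and on \<open>V\<close>. The numbers \<rho> and \<open>L\<close> depend only on
  \<open>K\<close>, \<open>e\<close> and the form, so they can be fixed before the sample is drawn,
  while the radius \<open>r\<close> may grow with the sample size. Near-minimal values force small
  \<open>ip\<close>-distances, since the form grows quadratically away from its minimiser.\<close>

lemma perturbed_minimizers:
  fixes K e :: real
  assumes K: "0 \<le> K" and e: "0 < e"
  shows "\<exists>\<rho>>0. \<exists>L>0. \<forall>\<psi> g r V us uq xs xq.
    norm g \<le> K \<longrightarrow> L \<le> r \<longrightarrow>
    (\<forall>u. norm u \<le> r \<longrightarrow> \<bar>\<psi> u - (nsq u - 2 * (g \<bullet> u))\<bar> \<le> \<rho> * ((norm u)\<^sup>2 + norm u)) \<longrightarrow>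
    norm xs \<le> r \<longrightarrow> (\<forall>u. norm u \<le> r \<longrightarrow> \<psi> xs \<le> \<psi> u) \<longrightarrow>
    subspace V \<longrightarrow> xq \<in> V \<longrightarrow> norm xq \<le> r \<longrightarrow> (\<forall>u\<in>V. norm u \<le> r \<longrightarrow> \<psi> xq \<le> \<psi> u) \<longrightarrow>
    A *v us = g \<longrightarrow> uq \<in> V \<longrightarrow> (\<forall>v\<in>V. ip v (us - uq) = 0) \<longrightarrow>
    \<bar>\<psi> xq - \<psi> xs - nsq (xs - xq)\<bar> \<le> e \<and> \<bar>\<psi> xq - \<psi> xs - nsq (us - uq)\<bar> \<le> e"
proof -
  obtain c where c: "c > 0" "\<And>x. c * (norm x)\<^sup>2 \<le> nsq x"
    using pos_def_lower_bound[OF pd] by (auto simp: nsq_def ip_def)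
  \<comment> \<open>A vector with \<open>c / 2 * norm u \<le> 2 * K + 1\<close> has norm at most
    \<open>K1\<close>. All four minimisers satisfy this, so the comparison takes place in one fixed
    ball.\<close>
  define K1 where "K1 = (4 * K + 2) / c"
  \<comment> \<open>Bounds the \<open>ip\<close>-length of \<open>us - uq\<close>, because
    \<open>nsq us = g \<bullet> us \<le> K * K1\<close>.\<close>
  define Q where "Q = sqrt (K * K1)"
  \<comment> \<open>The \<open>ip\<close>-distance allowed between actual and ideal minimisers. The
    final error is at most \<open>3 * t + t * (4 * Q + 4)\<close>, whence the denominator;
    \<open>E\<close> is then chosen so that \<open>2 * E\<close> is the square of
    \<open>t\<close>.\<close>
  define t where "t = min 1 (e / (7 + 4 * Q))"
  define E where "E = t\<^sup>2 / 2"
  \<comment> \<open>The bound \<open>c / 2\<close> lets half of the quadratic growth absorb the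
    error in the a priori bound; the last quotient makes the error at most \<open>E\<close> in the
    ball of radius \<open>K1\<close>.\<close>
  define \<rho> where "\<rho> = min (min (c / 2) 1) (E / (K1\<^sup>2 + K1))"
  have K1: "K1 > 0" using K c(1) by (simp add: K1_def add_nonneg_pos)
  have Q: "Q \<ge> 0" using K K1 by (simp add: Q_def)
  have t: "0 < t" "t \<le> 1" "t * (7 + 4 * Q) \<le> e"
  proof -
    show "0 < t" "t \<le> 1" using e Q by (auto simp: t_def)
    have "t \<le> e / (7 + 4 * Q)" by (simp add: t_def)
    then show "t * (7 + 4 * Q) \<le> e" using Q by (simp add: pos_le_divide_eq)
  qed
  have E: "E > 0" "sqrt (2 * E) = t" using t by (auto simp: E_def)
  have "0 < K1\<^sup>2 + K1" using K1 by (simp add: add_pos_pos)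
  then have "0 < E / (K1\<^sup>2 + K1)" using E(1) by simp
  then have \<rho>: "\<rho> > 0" "\<rho> \<le> c / 2" "\<rho> \<le> 1"
    using c(1) unfolding \<rho>_def by linarith+
  have "\<rho> \<le> E / (K1\<^sup>2 + K1)" by (simp add: \<rho>_def)
  then have \<rho>E: "\<rho> * (K1\<^sup>2 + K1) \<le> E" using K1 by (simp add: pos_le_divide_eq add_pos_pos)
  have main: "\<bar>\<psi> xq - \<psi> xs - nsq (xs - xq)\<bar> \<le> e \<and> \<bar>\<psi> xq - \<psi> xs - nsq (us - uq)\<bar> \<le> e"
    if g: "norm g \<le> K" and r: "K1 \<le> r"
      and approx: "\<forall>u. norm u \<le> r \<longrightarrow> \<bar>\<psi> u - (nsq u - 2 * (g \<bullet> u))\<bar> \<le> \<rho> * ((norm u)\<^sup>2 + norm u)"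
      and xs: "norm xs \<le> r" "\<forall>u. norm u \<le> r \<longrightarrow> \<psi> xs \<le> \<psi> u"
      and V: "subspace V" and xq: "xq \<in> V" "norm xq \<le> r" "\<forall>u\<in>V. norm u \<le> r \<longrightarrow> \<psi> xq \<le> \<psi> u"
      and us: "A *v us = g" and uq: "uq \<in> V" "\<forall>v\<in>V. ip v (us - uq) = 0"
    for \<psi> g r V us uq xs xq
  proof -
    have gu: "g \<bullet> u = ip u us" for u by (simp add: us[symmetric] ip_def inner_commute)
    have q_eq: "nsq u - 2 * (g \<bullet> u) = nsq (u - us) - nsq us" for u by (simp add: gu nsq_diff)
    have gK: "g \<bullet> u \<le> K * norm u" for u
      using norm_cauchy_schwarz[of g u] mult_right_mono[OF g norm_ge_zero[of u]] by linarith
    have small: "norm u \<le> K1" if "nsq u \<le> (2 * K + \<rho>) * norm u + \<rho> * (norm u)\<^sup>2" for u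
    proof (cases "u = 0")
      case True then show ?thesis using K1 by simp
    next
      case False
      then have n: "norm u > 0" by simp
      have "c * (norm u)\<^sup>2 \<le> (2 * K + \<rho>) * norm u + \<rho> * (norm u)\<^sup>2" using c(2)[of u] that by linarith
      moreover have "\<rho> * (norm u)\<^sup>2 \<le> c / 2 * (norm u)\<^sup>2" using \<rho>(2) by (intro mult_right_mono) auto
      moreover have "(2 * K + \<rho>) * norm u \<le> (2 * K + 1) * norm u" using \<rho>(3) by (intro mult_right_mono) auto
      ultimately have "(c / 2 * norm u) * norm u \<le> (2 * K + 1) * norm u"
        by (simp add: power2_eq_square)
      then have "c / 2 * norm u \<le> 2 * K + 1" using n by simp
      then show ?thesis using c(1) by (simp add: K1_def pos_le_divide_eq mult.commute)
    qed
    have \<psi>0: "\<psi> 0 = 0"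
    proof -
      have "\<bar>\<psi> 0 - (nsq 0 - 2 * (g \<bullet> 0))\<bar> \<le> \<rho> * ((norm (0::real^'w))\<^sup>2 + norm (0::real^'w))"
        using approx r K1 by (intro approx[rule_format]) simp
      then show ?thesis by (simp add: nsq_def)
    qed
    have min_small: "norm x \<le> K1" if "norm x \<le> r" "\<psi> x \<le> \<psi> 0" for x
    proof (rule small)
      have "\<bar>\<psi> x - (nsq x - 2 * (g \<bullet> x))\<bar> \<le> \<rho> * ((norm x)\<^sup>2 + norm x)" using approx that(1) by blast
      then have "nsq x \<le> 2 * (g \<bullet> x) + \<rho> * ((norm x)\<^sup>2 + norm x)" using that(2) \<psi>0 by linarith
      then show "nsq x \<le> (2 * K + \<rho>) * norm x + \<rho> * (norm x)\<^sup>2"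
        using gK[of x] by (simp add: algebra_simps)
    qed
    have n0: "norm (0::real^'w) \<le> r" using r K1 by simp
    have nxs: "norm xs \<le> K1" using min_small xs n0 by blast
    have nxq: "norm xq \<le> K1" using min_small xq n0 subspace_0[OF V] by blast
    have lin_small: "norm u \<le> K1" if "nsq u \<le> K * norm u" for u
    proof (rule small)
      have "K * norm u \<le> (2 * K + \<rho>) * norm u" using K \<rho>(1) by (intro mult_right_mono) auto
      moreover have "0 \<le> \<rho> * (norm u)\<^sup>2" using \<rho>(1) by simp
      ultimately show "nsq u \<le> (2 * K + \<rho>) * norm u + \<rho> * (norm u)\<^sup>2" using that by linarith
    qed
    have us_g: "nsq us = g \<bullet> us" by (simp add: gu nsq_def)
    have nus: "norm us \<le> K1" by (rule lin_small) (use gK us_g in simp)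
    have uq_g: "nsq uq = g \<bullet> uq" using uq by (simp add: gu nsq_def)
    have nuq: "norm uq \<le> K1" by (rule lin_small) (use gK uq_g in simp)
    have ap: "\<bar>\<psi> u - (nsq (u - us) - nsq us)\<bar> \<le> E" if "norm u \<le> K1" for u
    proof -
      have "\<bar>\<psi> u - (nsq (u - us) - nsq us)\<bar> \<le> \<rho> * ((norm u)\<^sup>2 + norm u)"
        using approx that r unfolding q_eq[symmetric] by auto
      also have "\<dots> \<le> \<rho> * (K1\<^sup>2 + K1)"
        using \<rho>(1) that by (intro mult_left_mono add_mono power_mono) auto
      finally show ?thesis using \<rho>E by linarith
    qed
    \<comment> \<open>\<open>uq\<close> is the \<open>ip\<close>-projection of \<open>us\<close>
      onto \<open>V\<close>, so Pythagoras splits the form on \<open>V\<close>.\<close>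
    have pyth: "nsq (x - us) = nsq (x - uq) + nsq (us - uq)" if "x \<in> V" for x
    proof -
      have "x - uq \<in> V" using V that uq(1) by (rule subspace_diff)
      then have "ip (x - uq) (us - uq) = 0" using uq(2) by blast
      then have "nsq ((x - uq) - (us - uq)) = nsq (x - uq) + nsq (us - uq)"
        unfolding nsq_diff[of "x - uq" "us - uq"] by linarith
      moreover have "(x - uq) - (us - uq) = x - us" by simp
      ultimately show ?thesis by (simp only:)
    qed
    have z: "nsq 0 = 0" by (simp add: nsq_def)
    define S where "S = nsq (us - uq)"
    have Suq: "nsq (uq - us) = S" using pyth[OF uq(1)] by (simp add: z S_def)
    \<comment> \<open>The values of \<psi> at \<open>xs\<close> and \<open>us\<close> are each known
      up to \<open>E\<close>, so minimality of \<open>xs\<close> leaves it an excess of at most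
      \<open>2 * E\<close> in the quadratic form.\<close>
    have s1: "nsq (xs - us) \<le> 2 * E" "\<bar>\<psi> xs + nsq us\<bar> \<le> 3 * E"
    proof -
      have "\<psi> xs \<le> \<psi> us" using xs(2) nus r by auto
      moreover have "\<bar>\<psi> xs - (nsq (xs - us) - nsq us)\<bar> \<le> E" by (rule ap[OF nxs])
      moreover have "\<bar>\<psi> us - (0 - nsq us)\<bar> \<le> E" using ap[OF nus] z by simp
      ultimately show "nsq (xs - us) \<le> 2 * E" "\<bar>\<psi> xs + nsq us\<bar> \<le> 3 * E"
        using nsq_nonneg[of "xs - us"] by linarith+
    qed
    have q1: "nsq (xq - uq) \<le> 2 * E" "\<bar>\<psi> xq + nsq us - S\<bar> \<le> 3 * E"
    proof -
      have "\<psi> xq \<le> \<psi> uq" using xq(3) uq(1) nuq r by auto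
      moreover have "\<bar>\<psi> xq - (nsq (xq - uq) + S - nsq us)\<bar> \<le> E"
        using ap[OF nxq] pyth[OF xq(1)] by (simp add: S_def)
      moreover have "\<bar>\<psi> uq - (S - nsq us)\<bar> \<le> E" using ap[OF nuq] Suq by simp
      ultimately show "nsq (xq - uq) \<le> 2 * E" "\<bar>\<psi> xq + nsq us - S\<bar> \<le> 3 * E"
        using nsq_nonneg[of "xq - uq"] by linarith+
    qed
    have TS: "\<bar>\<psi> xq - \<psi> xs - S\<bar> \<le> 6 * E" using s1(2) q1(2) by linarith
    let ?m = "\<lambda>x. sqrt (nsq x)"
    have ms: "?m (xs - us) \<le> t" using real_sqrt_le_mono[OF s1(1)] E(2) by simp
    have mq: "?m (xq - uq) \<le> t" using real_sqrt_le_mono[OF q1(1)] E(2) by simp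
    have m_sym: "?m (x - y) = ?m (y - x)" for x y
      by (simp add: nsq_def)
    have up: "?m (xs - xq) \<le> ?m (us - uq) + 2 * t"
    proof -
      have "xs - xq = (xs - us) + ((us - uq) + (uq - xq))" by simp
      then have "?m (xs - xq) \<le> ?m (xs - us) + (?m (us - uq) + ?m (uq - xq))"
        using sqrt_nsq_triangle[of "xs - us" "(us - uq) + (uq - xq)"] sqrt_nsq_triangle[of "us - uq" "uq - xq"]
        by simp
      then show ?thesis using ms mq m_sym[of uq xq] by linarith
    qed
    have low: "?m (us - uq) \<le> ?m (xs - xq) + 2 * t"
    proof -
      have "us - uq = (us - xs) + ((xs - xq) + (xq - uq))" by simp
      then have "?m (us - uq) \<le> ?m (us - xs) + (?m (xs - xq) + ?m (xq - uq))"
        using sqrt_nsq_triangle[of "us - xs" "(xs - xq) + (xq - uq)"] sqrt_nsq_triangle[of "xs - xq" "xq - uq"]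
        by simp
      then show ?thesis using ms mq m_sym[of us xs] by linarith
    qed
    have SQ: "?m (us - uq) \<le> Q"
    proof -
      have "S \<le> nsq us"
      proof -
        have "nsq us = nsq (uq + (us - uq))" by simp
        also have "\<dots> = nsq uq + S" using uq unfolding nsq_add[of uq] S_def by simp
        finally show ?thesis using nsq_nonneg[of uq] by linarith
      qed
      also have "nsq us \<le> K * norm us" using us_g gK by simp
      also have "\<dots> \<le> K * K1" using nus K by (rule mult_left_mono)
      finally show ?thesis unfolding Q_def S_def by (rule real_sqrt_le_mono)
    qed
    let ?a = "?m (xs - xq)" and ?b = "?m (us - uq)"
    have ab: "0 \<le> ?a" "0 \<le> ?b" by (auto simp: nsq_nonneg)
    \<comment> \<open>The two lengths differ by at most \<open>2 * t\<close>; factoring a difference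
      of squares converts this into a bound for \<open>nsq\<close>.\<close>
    have "\<bar>nsq (xs - xq) - S\<bar> = \<bar>(?a - ?b) * (?a + ?b)\<bar>"
    proof -
      have "?a * ?a = nsq (xs - xq)" "?b * ?b = S" by (simp_all add: S_def nsq_nonneg)
      moreover have "(?a - ?b) * (?a + ?b) = ?a * ?a - ?b * ?b" by (simp add: algebra_simps)
      ultimately show ?thesis by simp
    qed
    also have "\<dots> \<le> 2 * t * (2 * Q + 2 * t)"
      unfolding abs_mult using up low SQ ab t(1) by (intro mult_mono) auto
    also have "\<dots> \<le> t * (4 * Q + 4)"
    proof -
      have "2 * t * (2 * Q + 2 * t) = t * (4 * Q + 4 * t)" by (simp add: algebra_simps)
      also have "\<dots> \<le> t * (4 * Q + 4)" using t by (intro mult_left_mono) auto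
      finally show ?thesis .
    qed
    finally have D: "\<bar>nsq (xs - xq) - S\<bar> \<le> t * (4 * Q + 4)" .
    have "6 * E = 3 * (t * t)" by (simp add: E_def power2_eq_square)
    also have "\<dots> \<le> 3 * (t * 1)" using t by (intro mult_left_mono) auto
    finally have E6: "6 * E \<le> 3 * t" by simp
    have "3 * t + t * (4 * Q + 4) = t * (7 + 4 * Q)" by (simp add: algebra_simps)
    then have fin: "3 * t + t * (4 * Q + 4) \<le> e" using t(3) by simp
    moreover have "0 \<le> t * (4 * Q + 4)" using t(1) Q by simp
    ultimately show ?thesis using TS D E6 unfolding S_def[symmetric] by linarith
  qed
  show ?thesis
    by (rule exI[of _ \<rho>], rule conjI[OF \<rho>(1)], rule exI[of _ K1], rule conjI[OF K1], intro allI impI, rule main)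
qed

end

section \<open>Consistency\<close>

lemma borel_measurable_outer:
  assumes "f \<in> borel_measurable N" "g \<in> borel_measurable N"
  shows "(\<lambda>x. outer (f x) (g x)) \<in> borel_measurable N"
  using assms
  by (rule borel_measurable_continuous_Pair)
     (intro bounded_bilinear.continuous_on[OF bounded_bilinear_outer] continuous_intros)

lemma borel_measurable_matrix_vector:
  fixes A :: "real ^ 'n ^ 'm"
  assumes "f \<in> borel_measurable N"
  shows "(\<lambda>x. A *v f x) \<in> borel_measurable N"
  using assms
  by (rule measurable_compose)
     (intro borel_measurable_continuous_onI linear_continuous_on matrix_vector_mul_bounded_linear)

lemma bounded_linear_matrix_form: "bounded_linear (\<lambda>X :: real ^ 'n ^ 'm. x \<bullet> (X *v y))"
  unfolding linear_conv_bounded_linear[symmetric]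
  by (rule linearI)
     (simp_all add: matrix_vector_mult_add_rdistrib scaleR_matrix_vector_assoc[symmetric] inner_add_right)

lemma matrix_form_outer: "x \<bullet> (outer u v *v y) = (x \<bullet> u) * (v \<bullet> y)"
proof -
  have "outer u v *v y = (v \<bullet> y) *\<^sub>R u"
    by (simp add: vec_eq_iff matrix_vector_mult_def inner_vec_def sum_distrib_left algebra_simps)
  then show ?thesis by simp
qed

lemma bounded_linear_entry: "bounded_linear (\<lambda>X :: real ^ 'n ^ 'm. X $ i $ j)"
  by (rule bounded_linear_compose[OF bounded_linear_vec_nth bounded_linear_vec_nth])

text \<open>The noise is recovered as the residual at \<open>W0\<close>, so every random quantity is
  a function of the pairs \<open>X t\<close>. Moments, independence and identifiability are stated
  at time 0; identical distribution transfers what is used to the other times.\<close>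

locale regression_sample = prob_space M + smooth_regression F W0 \<Theta> J B C
  for M :: "'a measure" and F :: "real ^ 'w::finite \<Rightarrow> real ^ 'l::finite \<Rightarrow> real ^ 'd::finite"
    and W0 \<Theta> J B C +
  fixes X :: "nat \<Rightarrow> 'a \<Rightarrow> (real ^ 'd) \<times> (real ^ 'l)" and \<Gamma> :: "real ^ 'd ^ 'd"
  assumes iid: "iid_seq M X"
    and indep: "indep_rv M (\<lambda>\<omega>. fst (X 0 \<omega>) - F W0 (snd (X 0 \<omega>))) (\<lambda>\<omega>. snd (X 0 \<omega>))"
    and e_square: "integrable M (\<lambda>\<omega>. (norm (fst (X 0 \<omega>) - F W0 (snd (X 0 \<omega>))))\<^sup>2)"
    and e_mean: "(LINT \<omega>|M. fst (X 0 \<omega>) - F W0 (snd (X 0 \<omega>))) = 0"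
    and z_cube: "integrable M (\<lambda>\<omega>. norm (snd (X 0 \<omega>)) ^ 3)"
    and cov: "(LINT \<omega>|M. outer (fst (X 0 \<omega>) - F W0 (snd (X 0 \<omega>))) (fst (X 0 \<omega>) - F W0 (snd (X 0 \<omega>)))) = \<Gamma>"
    and cov_invertible: "invertible \<Gamma>"
    and W0_in: "W0 \<in> \<Theta>" and compact: "compact \<Theta>"
    and identifiable: "W \<in> \<Theta> \<Longrightarrow> (AE \<omega> in M. F W (snd (X 0 \<omega>)) = F W0 (snd (X 0 \<omega>))) \<Longrightarrow> W = W0"
begin

definition eps :: "(real ^ 'd) \<times> (real ^ 'l) \<Rightarrow> real ^ 'd" where
  "eps p = fst p - F W0 (snd p)"

text \<open>
  Every integrand met below is dominated by a multiple of \<open>wt\<close>; the exponents are exactly what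
  the moments \<open>E \<parallel>Z\<parallel>\<^sup>3\<close> and \<open>E \<parallel>\<epsilon>\<parallel>\<^sup>2\<close> and the independence of noise and input make integrable.
\<close>

definition wt :: "(real ^ 'd) \<times> (real ^ 'l) \<Rightarrow> real" where
  "wt p = (1 + norm (snd p)) ^ 3 * (1 + norm (eps p))\<^sup>2"

definition ave :: "nat \<Rightarrow> ((real ^ 'd) \<times> (real ^ 'l) \<Rightarrow> 'b::real_vector) \<Rightarrow> 'a \<Rightarrow> 'b" where
  "ave n f \<omega> = (1 / real n) *\<^sub>R (\<Sum>t = 1..n. f (X t \<omega>))"

abbreviation "\<Gamma>i \<equiv> matrix_inv \<Gamma>"

lemma fst_borel [measurable]: "fst \<in> borel_measurable (borel :: ((real ^ 'd) \<times> (real ^ 'l)) measure)"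
  and snd_borel [measurable]: "snd \<in> borel_measurable (borel :: ((real ^ 'd) \<times> (real ^ 'l)) measure)"
  by (intro borel_measurable_continuous_onI continuous_intros)+

lemma F_snd_borel [measurable]: "(\<lambda>p. F W (snd p)) \<in> borel_measurable (borel :: ((real ^ 'd) \<times> (real ^ 'l)) measure)"
  by (rule measurable_compose[OF snd_borel F_measurable])

lemma J_snd_borel [measurable]: "(\<lambda>p. J (snd p) h) \<in> borel_measurable (borel :: ((real ^ 'd) \<times> (real ^ 'l)) measure)"
  by (rule measurable_compose[OF snd_borel J_measurable])

lemma B_snd_borel [measurable]: "(\<lambda>p. B (snd p) h h') \<in> borel_measurable (borel :: ((real ^ 'd) \<times> (real ^ 'l)) measure)"
  by (rule measurable_compose[OF snd_borel B_measurable])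

lemma eps_borel [measurable]: "eps \<in> borel_measurable borel"
  unfolding eps_def[abs_def] by measurable

lemma X_measurable [measurable]: "X t \<in> borel_measurable M"
  by (rule iid_seq_measurable[OF iid])

lemma wt_borel [measurable]: "wt \<in> borel_measurable borel"
  unfolding wt_def[abs_def] by measurable

lemma wt_nonneg: "0 \<le> wt p" by (simp add: wt_def)

lemma weight_le_wt: "j \<le> 3 \<Longrightarrow> k \<le> 2 \<Longrightarrow> (1 + norm (snd p)) ^ j * (1 + norm (eps p)) ^ k \<le> wt p"
  unfolding wt_def by (intro mult_mono power_increasing) auto

lemma wt_integrable: "integrable M (\<lambda>\<omega>. wt (X 0 \<omega>))"
  unfolding wt_def mult.commute[of "_ ^ 3"]
proof (rule indep_rv_mult(1)[where U = "\<lambda>\<omega>. eps (X 0 \<omega>)" and V = "\<lambda>\<omega>. snd (X 0 \<omega>)"])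
  show "indep_rv M (\<lambda>\<omega>. eps (X 0 \<omega>)) (\<lambda>\<omega>. snd (X 0 \<omega>))" using indep by (simp add: eps_def)
  have e2: "integrable M (\<lambda>\<omega>. 2 + 2 * (norm (eps (X 0 \<omega>)))\<^sup>2)" using e_square by (simp add: eps_def)
  have "(1 + x)\<^sup>2 \<le> 2 + 2 * x\<^sup>2" for x :: real
    using zero_le_power2[of "x - 1"] by (simp add: power2_sum power2_diff)
  then show "integrable M (\<lambda>\<omega>. (1 + norm (eps (X 0 \<omega>)))\<^sup>2)"
    by (intro Bochner_Integration.integrable_bound[OF e2] AE_I2) (simp_all add: abs_of_nonneg)
  have z3: "integrable M (\<lambda>\<omega>. 4 + 4 * norm (snd (X 0 \<omega>)) ^ 3)" using z_cube by simp
  have "(1 + x) ^ 3 \<le> 4 + 4 * x ^ 3" if "0 \<le> x" for x :: real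
  proof -
    have "4 + 4 * x ^ 3 - (1 + x) ^ 3 = 3 * ((1 + x) * (x - 1)\<^sup>2)"
      by (simp add: power3_eq_cube power2_eq_square algebra_simps)
    also have "0 \<le> \<dots>" using that by simp
    finally show ?thesis by simp
  qed
  then show "integrable M (\<lambda>\<omega>. (1 + norm (snd (X 0 \<omega>))) ^ 3)"
    by (intro Bochner_Integration.integrable_bound[OF z3] AE_I2) (simp_all add: abs_of_nonneg)
qed measurable

lemma dominated_integrable:
  fixes \<phi> :: "(real ^ 'd) \<times> (real ^ 'l) \<Rightarrow> 'b::{banach, second_countable_topology}"
  assumes [measurable]: "\<phi> \<in> borel_measurable borel" and "\<And>p. norm (\<phi> p) \<le> c * wt p"
  shows "integrable M (\<lambda>\<omega>. \<phi> (X 0 \<omega>))"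
proof (rule Bochner_Integration.integrable_bound)
  show "integrable M (\<lambda>\<omega>. c * wt (X 0 \<omega>))" using wt_integrable by simp
  show "AE \<omega> in M. norm (\<phi> (X 0 \<omega>)) \<le> norm (c * wt (X 0 \<omega>))"
    using order_trans[OF assms(2) abs_ge_self] by simp
qed measurable

lemma whp_ave:
  fixes \<phi> :: "(real ^ 'd) \<times> (real ^ 'l) \<Rightarrow> real"
  assumes "\<phi> \<in> borel_measurable borel" "\<And>p. \<bar>\<phi> p\<bar> \<le> c * wt p" "0 < \<kappa>"
  shows "whp M (\<lambda>n \<omega>. \<bar>ave n \<phi> \<omega> - expectation (\<lambda>\<omega>. \<phi> (X 0 \<omega>))\<bar> \<le> \<kappa>)"
  using whp_weak_law[OF iid_seq_compose[OF iid assms(1)] dominated_integrable[OF assms(1), of c] assms(3)] assms(2)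
  by (simp add: ave_def)

lemma eps_le_wt: "norm (eps p) \<le> wt p" "(norm (eps p))\<^sup>2 \<le> wt p" "1 \<le> wt p"
proof -
  have "norm (eps p) \<le> (1 + norm (eps p)) ^ 1" by simp
  with weight_le_wt[of 0 1 p] show "norm (eps p) \<le> wt p" by simp
  have "(norm (eps p))\<^sup>2 \<le> (1 + norm (eps p))\<^sup>2" by (intro power_mono) auto
  also have "\<dots> \<le> wt p" using weight_le_wt[of 0 2 p] by simp
  finally show "(norm (eps p))\<^sup>2 \<le> wt p" .
  from weight_le_wt[of 0 0 p] show "1 \<le> wt p" by simp
qed

lemma eps_nth_mean: "expectation (\<lambda>\<omega>. eps (X 0 \<omega>) $ i) = 0"
proof -
  have "integrable M (\<lambda>\<omega>. eps (X 0 \<omega>))"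
    by (rule dominated_integrable[of _ 1]) (use eps_le_wt in auto)
  from integral_bounded_linear[OF bounded_linear_vec_nth[of i] this]
  show ?thesis using e_mean by (simp add: eps_def)
qed

lemma outer_eps_integrable: "integrable M (\<lambda>\<omega>. outer (eps (X 0 \<omega>)) (eps (X 0 \<omega>)))"
  by (rule dominated_integrable[of _ 1])
     (use eps_le_wt(2) in \<open>auto intro!: borel_measurable_outer simp: norm_outer power2_eq_square\<close>)

text \<open>Independence factors both expectations. The first identity removes every mean that is
  linear in the noise; the second yields the variance of the score in each direction.\<close>

lemma expectation_eps_mult:
  fixes g :: "real ^ 'l \<Rightarrow> real"
  assumes [measurable]: "g \<in> borel_measurable borel" and int: "integrable M (\<lambda>\<omega>. g (snd (X 0 \<omega>)))"
  shows "expectation (\<lambda>\<omega>. eps (X 0 \<omega>) $ i * g (snd (X 0 \<omega>))) = 0"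
    and "expectation (\<lambda>\<omega>. eps (X 0 \<omega>) $ i * eps (X 0 \<omega>) $ j * g (snd (X 0 \<omega>)))
      = \<Gamma> $ i $ j * expectation (\<lambda>\<omega>. g (snd (X 0 \<omega>)))"
proof -
  have ind: "indep_rv M (\<lambda>\<omega>. eps (X 0 \<omega>)) (\<lambda>\<omega>. snd (X 0 \<omega>))" using indep by (simp add: eps_def)
  have [measurable]: "(\<lambda>x :: real ^ 'd. x $ i) \<in> borel_measurable borel" for i
    by (intro borel_measurable_continuous_onI continuous_intros)
  have 1: "integrable M (\<lambda>\<omega>. eps (X 0 \<omega>) $ i)" for i
    by (rule dominated_integrable[of _ 1])
       (use order_trans[OF component_le_norm_cart eps_le_wt(1)] in \<open>auto\<close>)
  have 2: "integrable M (\<lambda>\<omega>. eps (X 0 \<omega>) $ i * eps (X 0 \<omega>) $ j)"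
  proof (rule dominated_integrable[of _ 1])
    fix p
    have "norm (eps p $ i * eps p $ j) \<le> norm (eps p) * norm (eps p)"
      unfolding real_norm_def abs_mult by (intro mult_mono component_le_norm_cart) auto
    then show "norm (eps p $ i * eps p $ j) \<le> 1 * wt p"
      using eps_le_wt(2)[of p] by (simp add: power2_eq_square)
  qed measurable
  have "expectation (\<lambda>\<omega>. eps (X 0 \<omega>) $ i * eps (X 0 \<omega>) $ j) = \<Gamma> $ i $ j"
    using integral_bounded_linear[OF bounded_linear_entry outer_eps_integrable, of i j] cov by (simp add: eps_def)
  then show "expectation (\<lambda>\<omega>. eps (X 0 \<omega>) $ i * eps (X 0 \<omega>) $ j * g (snd (X 0 \<omega>)))
      = \<Gamma> $ i $ j * expectation (\<lambda>\<omega>. g (snd (X 0 \<omega>)))"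
    using indep_rv_mult(2)[OF ind, of "\<lambda>x. x $ i * x $ j" g] 2 int by simp
  show "expectation (\<lambda>\<omega>. eps (X 0 \<omega>) $ i * g (snd (X 0 \<omega>))) = 0"
    using indep_rv_mult(2)[OF ind, of "\<lambda>x. x $ i" g] 1 int eps_nth_mean by simp
qed

lemma \<Gamma>_form: "x \<bullet> (\<Gamma> *v y) = expectation (\<lambda>\<omega>. (x \<bullet> eps (X 0 \<omega>)) * (eps (X 0 \<omega>) \<bullet> y))"
proof -
  from integral_bounded_linear[OF bounded_linear_matrix_form outer_eps_integrable, of x y]
  show ?thesis using cov by (simp add: matrix_form_outer eps_def)
qed

lemma \<Gamma>_sym: "x \<bullet> (\<Gamma> *v y) = y \<bullet> (\<Gamma> *v x)"
  unfolding \<Gamma>_form by (simp add: inner_commute mult.commute)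

lemma eps_inner_le_wt: "\<bar>(x \<bullet> eps p) * (eps p \<bullet> y)\<bar> \<le> (norm x * norm y) * wt p"
proof -
  have "\<bar>(x \<bullet> eps p) * (eps p \<bullet> y)\<bar> \<le> (norm x * norm (eps p)) * (norm (eps p) * norm y)"
    unfolding abs_mult by (intro mult_mono Cauchy_Schwarz_ineq2) auto
  also have "\<dots> = norm x * norm y * (norm (eps p))\<^sup>2" by (simp add: power2_eq_square)
  also have "\<dots> \<le> norm x * norm y * wt p" by (intro mult_left_mono eps_le_wt) auto
  finally show ?thesis .
qed

text \<open>The form is the mean square of \<open>x \<bullet> eps\<close>. If it vanishes, the noise
  is almost surely orthogonal to \<open>x\<close>, hence \<open>\<Gamma> *v x = 0\<close>, against
  invertibility.\<close>

lemma \<Gamma>_pos_def: "pos_def \<Gamma>"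
  unfolding pos_def_def
proof (intro allI impI)
  fix x :: "real ^ 'd" assume x: "x \<noteq> 0"
  have int: "integrable M (\<lambda>\<omega>. (x \<bullet> eps (X 0 \<omega>)) * (eps (X 0 \<omega>) \<bullet> x))"
    by (rule dominated_integrable[of _ "norm x * norm x"]) (use eps_inner_le_wt in auto)
  have nonneg: "0 \<le> (x \<bullet> eps p) * (eps p \<bullet> x)" for p by (simp add: inner_commute)
  have "x \<bullet> (\<Gamma> *v x) \<noteq> 0"
  proof
    assume "x \<bullet> (\<Gamma> *v x) = 0"
    then have "AE \<omega> in M. (x \<bullet> eps (X 0 \<omega>)) * (eps (X 0 \<omega>) \<bullet> x) = 0"
      unfolding \<Gamma>_form using integral_nonneg_eq_0_iff_AE[OF int] nonneg by auto
    then have ae: "AE \<omega> in M. eps (X 0 \<omega>) \<bullet> x = 0"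
      by (rule AE_mp) (simp add: inner_commute)
    have "y \<bullet> (\<Gamma> *v x) = 0" for y
    proof -
      have "expectation (\<lambda>\<omega>. (y \<bullet> eps (X 0 \<omega>)) * (eps (X 0 \<omega>) \<bullet> x)) = expectation (\<lambda>\<omega>. 0)"
        by (rule integral_cong_AE) (use ae in \<open>auto elim: AE_mp\<close>)
      then show ?thesis by (simp add: \<Gamma>_form)
    qed
    from this[of "\<Gamma> *v x"] have "\<Gamma> *v x = 0" by simp
    then have "\<Gamma>i *v (\<Gamma> *v x) = 0" by simp
    then show False using x matrix_inv_left_right(2)[OF cov_invertible] by (simp add: matrix_vector_mul_assoc)
  qed
  moreover have "0 \<le> x \<bullet> (\<Gamma> *v x)"
    unfolding \<Gamma>_form using nonneg by (intro Bochner_Integration.integral_nonneg) auto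
  ultimately show "0 < x \<bullet> (\<Gamma> *v x)" by simp
qed

lemma \<Gamma>i_sym: "x \<bullet> (\<Gamma>i *v y) = y \<bullet> (\<Gamma>i *v x)"
proof -
  have g: "\<Gamma> *v (\<Gamma>i *v x) = x" for x
    using matrix_inv_left_right(1)[OF cov_invertible] by (simp add: matrix_vector_mul_assoc)
  have "x \<bullet> (\<Gamma>i *v y) = (\<Gamma>i *v y) \<bullet> (\<Gamma> *v (\<Gamma>i *v x))" by (simp add: g inner_commute)
  also have "\<dots> = (\<Gamma>i *v x) \<bullet> (\<Gamma> *v (\<Gamma>i *v y))" by (rule \<Gamma>_sym)
  also have "\<dots> = y \<bullet> (\<Gamma>i *v x)" by (simp add: g inner_commute)
  finally show ?thesis .
qed

end

section \<open>Uniform convergence of the empirical residual covariance\<close>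

context regression_sample
begin

definition res :: "real ^ 'w \<Rightarrow> (real ^ 'd) \<times> (real ^ 'l) \<Rightarrow> real ^ 'd" where
  "res W p = fst p - F W (snd p)"

definition emp_cov :: "nat \<Rightarrow> real ^ 'w \<Rightarrow> 'a \<Rightarrow> real ^ 'd ^ 'd" where
  "emp_cov n W \<omega> = ave n (\<lambda>p. outer (res W p) (res W p)) \<omega>"

definition lim_cov :: "real ^ 'w \<Rightarrow> real ^ 'd ^ 'd" where
  "lim_cov W = (LINT \<omega>|M. outer (res W (X 0 \<omega>)) (res W (X 0 \<omega>)))"

lemma res_borel [measurable]: "res W \<in> borel_measurable borel"
  unfolding res_def[abs_def] by measurable

lemma outer_res_borel [measurable]: "(\<lambda>p. outer (res W p) (res W p)) \<in> borel_measurable borel"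
  by (intro borel_measurable_outer res_borel)

lemma ave_linear: "linear f \<Longrightarrow> f (ave n \<phi> \<omega>) = ave n (\<lambda>p. f (\<phi> p)) \<omega>"
  by (simp add: ave_def linear_scale linear_sum)

lemma ave_add: "ave n (\<lambda>p. f p + g p) \<omega> = ave n f \<omega> + ave n g \<omega>"
  by (simp add: ave_def sum.distrib scaleR_add_right)

lemma ave_diff: "ave n (\<lambda>p. f p - g p) \<omega> = ave n f \<omega> - ave n g \<omega>"
  by (simp add: ave_def sum_subtractf scaleR_diff_right)

lemma ave_mult: "ave n (\<lambda>p. c * f p :: real) \<omega> = c * ave n f \<omega>"
  by (simp add: ave_def sum_distrib_left sum_divide_distrib)

lemma ave_sum: "ave n (\<lambda>p. \<Sum>i\<in>I. f i p :: real) \<omega> = (\<Sum>i\<in>I. ave n (f i) \<omega>)"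
  unfolding ave_def by (subst sum.swap) (simp add: scaleR_sum_right sum_divide_distrib)

lemma norm_ave_le:
  assumes "\<And>p. norm (\<phi> p) \<le> c * wt p"
  shows "norm (ave n \<phi> \<omega>) \<le> c * ave n wt \<omega>"
proof -
  have "norm (ave n \<phi> \<omega>) \<le> (1 / real n) * (\<Sum>t = 1..n. norm (\<phi> (X t \<omega>)))"
    unfolding ave_def by (simp add: divide_right_mono norm_sum)
  also have "\<dots> \<le> (1 / real n) * (\<Sum>t = 1..n. c * wt (X t \<omega>))"
    by (intro mult_left_mono sum_mono assms) auto
  also have "\<dots> = c * ave n wt \<omega>"
    by (simp add: ave_def sum_distrib_left)
  finally show ?thesis .
qed

lemma abs_ave_le: "(\<And>p. \<bar>\<phi> p\<bar> \<le> c * wt p) \<Longrightarrow> \<bar>ave n \<phi> \<omega>\<bar> \<le> c * ave n wt \<omega>"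
  using norm_ave_le[of \<phi> c n \<omega>] by simp

lemma whp_ave_matrix:
  fixes \<phi> :: "(real ^ 'd) \<times> (real ^ 'l) \<Rightarrow> real ^ 'd ^ 'd"
  assumes [measurable]: "\<phi> \<in> borel_measurable borel" and bound: "\<And>p. norm (\<phi> p) \<le> c * wt p" and "0 < \<kappa>"
  shows "whp M (\<lambda>n \<omega>. norm (ave n \<phi> \<omega> - (LINT \<omega>|M. \<phi> (X 0 \<omega>))) \<le> \<kappa>)"
proof -
  let ?E = "LINT \<omega>|M. \<phi> (X 0 \<omega>)" and ?d = "real CARD('d)"
  \<comment> \<open>There are \<open>?d * ?d\<close> entries, whose errors of \<kappa>' sum to
    \<kappa>.\<close>
  define \<kappa>' where "\<kappa>' = \<kappa> / (?d * ?d)"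
  have \<kappa>': "\<kappa>' > 0" using \<open>0 < \<kappa>\<close> by (simp add: \<kappa>'_def)
  have int: "integrable M (\<lambda>\<omega>. \<phi> (X 0 \<omega>))" by (rule dominated_integrable[OF _ bound]) simp
  have whp_entry: "whp M (\<lambda>n \<omega>. \<bar>(ave n \<phi> \<omega> - ?E) $ i $ j\<bar> \<le> \<kappa>')" for i j
  proof -
    have [measurable]: "(\<lambda>x :: real ^ 'd ^ 'd. x $ i $ j) \<in> borel_measurable borel"
      by (intro borel_measurable_continuous_onI continuous_intros)
    have "whp M (\<lambda>n \<omega>. \<bar>ave n (\<lambda>p. \<phi> p $ i $ j) \<omega> - expectation (\<lambda>\<omega>. \<phi> (X 0 \<omega>) $ i $ j)\<bar> \<le> \<kappa>')"
    proof (rule whp_ave[OF _ _ \<kappa>'])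
      show "\<bar>\<phi> p $ i $ j\<bar> \<le> c * wt p" for p
        using component_le_norm_cart[of "\<phi> p $ i" j] Finite_Cartesian_Product.norm_nth_le[of "\<phi> p" i] bound[of p]
        by linarith
    qed measurable
    moreover have "ave n (\<lambda>p. \<phi> p $ i $ j) \<omega> = ave n \<phi> \<omega> $ i $ j" for n \<omega>
      by (rule ave_linear[OF bounded_linear.linear[OF bounded_linear_entry], symmetric])
    moreover have "expectation (\<lambda>\<omega>. \<phi> (X 0 \<omega>) $ i $ j) = ?E $ i $ j"
      by (rule integral_bounded_linear[OF bounded_linear_entry int])
    ultimately show ?thesis by simp
  qed
  have "whp M (\<lambda>n \<omega>. \<forall>i\<in>UNIV. \<forall>j\<in>UNIV. \<bar>(ave n \<phi> \<omega> - ?E) $ i $ j\<bar> \<le> \<kappa>')"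
    by (intro whp_ball whp_entry) auto
  then show ?thesis
  proof (rule whp_mono[where N = 0])
    fix n \<omega> assume e: "\<forall>i\<in>UNIV. \<forall>j\<in>UNIV. \<bar>(ave n \<phi> \<omega> - ?E) $ i $ j\<bar> \<le> \<kappa>'"
    have "norm (ave n \<phi> \<omega> - ?E) \<le> (\<Sum>i\<in>UNIV. \<Sum>j\<in>UNIV. \<bar>(ave n \<phi> \<omega> - ?E) $ i $ j\<bar>)"
      by (rule norm_matrix_le_entries)
    also have "\<dots> \<le> (\<Sum>i\<in>(UNIV::'d set). \<Sum>j\<in>(UNIV::'d set). \<kappa>')"
      using e by (intro sum_mono) blast
    also have "\<dots> = \<kappa>" by (simp add: \<kappa>'_def)
    finally show "norm (ave n \<phi> \<omega> - ?E) \<le> \<kappa>" .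
  qed
qed

lemma whp_wt: "whp M (\<lambda>n \<omega>. ave n wt \<omega> \<le> expectation (\<lambda>\<omega>. wt (X 0 \<omega>)) + 1)"
proof (rule whp_mono[where N = 0])
  show "whp M (\<lambda>n \<omega>. \<bar>ave n wt \<omega> - expectation (\<lambda>\<omega>. wt (X 0 \<omega>))\<bar> \<le> 1)"
    by (rule whp_ave[of _ 1]) (auto simp: wt_nonneg)
qed linarith

lemma res_bound: "W \<in> \<Theta> \<Longrightarrow> norm (res W p) \<le> 2 * C * (1 + norm (eps p))"
proof -
  assume W: "W \<in> \<Theta>"
  have "res W p = eps p - (F W (snd p) - F W0 (snd p))" by (simp add: res_def eps_def)
  have "norm (res W p) \<le> norm (eps p) + (norm (F W (snd p)) + norm (F W0 (snd p)))"
    unfolding \<open>res W p = _\<close>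
    using norm_triangle_ineq4[of "eps p" "F W (snd p) - F W0 (snd p)"]
      norm_triangle_ineq4[of "F W (snd p)" "F W0 (snd p)"] by linarith
  also have "\<dots> \<le> norm (eps p) + (C + C)" by (intro add_mono F_bound W W0_in order_refl)
  also have "\<dots> \<le> 2 * C * (1 + norm (eps p))"
    using mult_right_mono[of 1 "2 * C" "norm (eps p)"] C_ge_1 by (simp add: algebra_simps)
  finally show ?thesis .
qed

lemma outer_res_bound: "W \<in> \<Theta> \<Longrightarrow> norm (outer (res W p) (res W p)) \<le> 4 * C\<^sup>2 * wt p"
proof -
  assume W: "W \<in> \<Theta>"
  have "norm (outer (res W p) (res W p)) \<le> (2 * C * (1 + norm (eps p))) * (2 * C * (1 + norm (eps p)))"
    unfolding norm_outer using C_ge_1 by (intro mult_mono res_bound W) auto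
  also have "\<dots> = 4 * C\<^sup>2 * (1 + norm (eps p))\<^sup>2" by (simp add: power2_eq_square)
  also have "\<dots> \<le> 4 * C\<^sup>2 * wt p" using weight_le_wt[of 0 2 p] by (intro mult_left_mono) auto
  finally show ?thesis .
qed

lemma outer_res_lipschitz:
  assumes W: "W \<in> \<Theta>" and W': "W' \<in> \<Theta>"
  shows "norm (outer (res W p) (res W p) - outer (res W' p) (res W' p)) \<le> (4 * C\<^sup>2 * norm (W - W')) * wt p"
proof -
  have eq: "outer (res W p) (res W p) - outer (res W' p) (res W' p)
      = outer (res W p - res W' p) (res W p) + outer (res W' p) (res W p - res W' p)"
    by (simp add: outer_diff_left outer_diff_right)
  have d: "norm (res W p - res W' p) \<le> C * (1 + norm (snd p)) * norm (W - W')"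
    using F_lipschitz[OF W' W, of "snd p"] by (simp add: res_def norm_minus_commute)
  have "norm (outer (res W p) (res W p) - outer (res W' p) (res W' p))
      \<le> norm (res W p - res W' p) * norm (res W p) + norm (res W' p) * norm (res W p - res W' p)"
    unfolding eq norm_outer[symmetric] by (rule norm_triangle_ineq)
  also have "\<dots> = norm (res W p - res W' p) * (norm (res W p) + norm (res W' p))" by (simp add: algebra_simps)
  also have "\<dots> \<le> (C * (1 + norm (snd p)) * norm (W - W')) * (2 * C * (1 + norm (eps p)) + 2 * C * (1 + norm (eps p)))"
    using C_ge_1 by (intro mult_mono add_mono d res_bound W W') auto
  also have "\<dots> = (4 * C\<^sup>2 * norm (W - W')) * ((1 + norm (snd p)) ^ 1 * (1 + norm (eps p)) ^ 1)"
    by (simp add: power2_eq_square algebra_simps)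
  also have "\<dots> \<le> (4 * C\<^sup>2 * norm (W - W')) * wt p" by (intro mult_left_mono weight_le_wt) auto
  finally show ?thesis .
qed

lemma outer_res_integrable: "W \<in> \<Theta> \<Longrightarrow> integrable M (\<lambda>\<omega>. outer (res W (X 0 \<omega>)) (res W (X 0 \<omega>)))"
  by (rule dominated_integrable[OF outer_res_borel outer_res_bound])

definition mean_wt :: real where "mean_wt = expectation (\<lambda>\<omega>. wt (X 0 \<omega>))"

lemma mean_wt_nonneg: "0 \<le> mean_wt"
  unfolding mean_wt_def by (intro Bochner_Integration.integral_nonneg wt_nonneg)

lemma lim_cov_lipschitz:
  assumes "W \<in> \<Theta>" "W' \<in> \<Theta>"
  shows "norm (lim_cov W - lim_cov W') \<le> 4 * C\<^sup>2 * norm (W - W') * mean_wt"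
proof -
  have "norm (lim_cov W - lim_cov W') =
      norm (LINT \<omega>|M. outer (res W (X 0 \<omega>)) (res W (X 0 \<omega>)) - outer (res W' (X 0 \<omega>)) (res W' (X 0 \<omega>)))"
    unfolding lim_cov_def using outer_res_integrable assms by simp
  also have "\<dots> \<le> expectation (\<lambda>\<omega>. norm (outer (res W (X 0 \<omega>)) (res W (X 0 \<omega>)) - outer (res W' (X 0 \<omega>)) (res W' (X 0 \<omega>))))"
    by (rule integral_norm_bound)
  also have "\<dots> \<le> expectation (\<lambda>\<omega>. (4 * C\<^sup>2 * norm (W - W')) * wt (X 0 \<omega>))"
    using outer_res_integrable assms wt_integrable
    by (intro integral_mono outer_res_lipschitz integrable_norm Bochner_Integration.integrable_diff integrable_mult_right) auto
  finally show ?thesis by (simp add: mean_wt_def)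
qed

lemma emp_cov_lipschitz:
  assumes "W \<in> \<Theta>" "W' \<in> \<Theta>"
  shows "norm (emp_cov n W \<omega> - emp_cov n W' \<omega>) \<le> 4 * C\<^sup>2 * norm (W - W') * ave n wt \<omega>"
  unfolding emp_cov_def ave_diff[symmetric]
  by (intro norm_ave_le outer_res_lipschitz assms)

text \<open>A finite net of \<Theta> suffices, because the empirical covariance and its limit are
  both Lipschitz in \<open>W\<close>, the former with a constant proportional to the average of
  \<open>wt\<close>, which the law of large numbers keeps bounded.\<close>

lemma emp_cov_uniform:
  assumes "0 < \<tau>"
  shows "whp M (\<lambda>n \<omega>. \<forall>W\<in>\<Theta>. norm (emp_cov n W \<omega> - lim_cov W) \<le> \<tau>)"
proof -
  \<comment> \<open>The net is so fine that moving to a nearby net point costs at most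
    \<open>\<tau> / 3\<close> in the empirical covariance and the same in its limit. The 1 added to
    \<open>mean_wt\<close> leaves room for the fluctuation of the average.\<close>
  define \<delta> where "\<delta> = \<tau> / (12 * C\<^sup>2 * (mean_wt + 1))"
  have pos: "12 * C\<^sup>2 * (mean_wt + 1) > 0"
    using C_ge_1 mean_wt_nonneg by (intro mult_pos_pos) auto
  then have \<delta>: "\<delta> > 0" using assms by (simp add: \<delta>_def)
  have \<delta>\<tau>: "4 * C\<^sup>2 * \<delta> * (mean_wt + 1) = \<tau> / 3" using pos by (simp add: \<delta>_def field_simps)
  obtain N where N: "finite N" "N \<subseteq> \<Theta>" "\<Theta> \<subseteq> (\<Union>x\<in>N. ball x \<delta>)"
    using seq_compact_imp_totally_bounded[of \<Theta>] compact \<delta> by (auto simp: compact_eq_seq_compact_metric)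
  have "whp M (\<lambda>n \<omega>. (\<forall>W\<in>N. norm (emp_cov n W \<omega> - lim_cov W) \<le> \<tau> / 3) \<and> ave n wt \<omega> \<le> mean_wt + 1)"
  proof (intro whp_conj whp_ball N(1))
    show "whp M (\<lambda>n \<omega>. norm (emp_cov n W \<omega> - lim_cov W) \<le> \<tau> / 3)" if "W \<in> N" for W
      unfolding emp_cov_def lim_cov_def
      by (rule whp_ave_matrix[OF outer_res_borel outer_res_bound]) (use that N(2) assms in auto)
    show "whp M (\<lambda>n \<omega>. ave n wt \<omega> \<le> mean_wt + 1)" using whp_wt by (simp add: mean_wt_def)
  qed
  then show ?thesis
  proof (rule whp_mono[where N = 0], intro ballI)
    fix n \<omega> W
    assume ev: "(\<forall>W\<in>N. norm (emp_cov n W \<omega> - lim_cov W) \<le> \<tau> / 3) \<and> ave n wt \<omega> \<le> mean_wt + 1" and W: "W \<in> \<Theta>"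
    obtain V where V: "V \<in> N" "dist V W < \<delta>" using N(3) W by auto
    then have V\<Theta>: "V \<in> \<Theta>" and d: "norm (W - V) \<le> \<delta>" using N(2) by (auto simp: dist_norm norm_minus_commute)
    have mw: "0 \<le> ave n wt \<omega>" unfolding ave_def by (simp add: sum_nonneg wt_nonneg)
    have "norm (emp_cov n W \<omega> - emp_cov n V \<omega>) \<le> 4 * C\<^sup>2 * norm (W - V) * ave n wt \<omega>"
      by (rule emp_cov_lipschitz[OF W V\<Theta>])
    also have "\<dots> \<le> 4 * C\<^sup>2 * \<delta> * (mean_wt + 1)"
      using d ev mw \<delta> by (intro mult_mono) auto
    finally have 1: "norm (emp_cov n W \<omega> - emp_cov n V \<omega>) \<le> \<tau> / 3" by (simp add: \<delta>\<tau>)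
    have "norm (lim_cov V - lim_cov W) \<le> 4 * C\<^sup>2 * norm (V - W) * mean_wt"
      by (rule lim_cov_lipschitz[OF V\<Theta> W])
    also have "\<dots> \<le> 4 * C\<^sup>2 * \<delta> * (mean_wt + 1)"
      using d mean_wt_nonneg \<delta> by (intro mult_mono) (auto simp: norm_minus_commute)
    finally have 2: "norm (lim_cov V - lim_cov W) \<le> \<tau> / 3" by (simp add: \<delta>\<tau>)
    have 3: "norm (emp_cov n V \<omega> - lim_cov V) \<le> \<tau> / 3" using ev V by blast
    have "emp_cov n W \<omega> - lim_cov W = (emp_cov n W \<omega> - emp_cov n V \<omega>) + (emp_cov n V \<omega> - lim_cov V) + (lim_cov V - lim_cov W)"
      by simp
    then have "norm (emp_cov n W \<omega> - lim_cov W)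
        = norm ((emp_cov n W \<omega> - emp_cov n V \<omega>) + (emp_cov n V \<omega> - lim_cov V) + (lim_cov V - lim_cov W))"
      by (rule arg_cong)
    then have "norm (emp_cov n W \<omega> - lim_cov W) \<le> norm (emp_cov n W \<omega> - emp_cov n V \<omega>) + norm (emp_cov n V \<omega> - lim_cov V) + norm (lim_cov V - lim_cov W)"
      using norm_triangle_ineq[of "(emp_cov n W \<omega> - emp_cov n V \<omega>) + (emp_cov n V \<omega> - lim_cov V)" "lim_cov V - lim_cov W"]
        norm_triangle_ineq[of "emp_cov n W \<omega> - emp_cov n V \<omega>" "emp_cov n V \<omega> - lim_cov V"] by linarith
    then show "norm (emp_cov n W \<omega> - lim_cov W) \<le> \<tau>" using 1 2 3 by linarith
  qed
qed

lemma lim_cov_W0: "lim_cov W0 = \<Gamma>"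
  unfolding lim_cov_def res_def by (rule cov)

text \<open>The residual at \<open>W\<close> is the noise minus a function \<open>D\<close> of the
  input. Independence removes the cross terms, so the limiting covariance exceeds \<Gamma> by the
  positive semidefinite mean of \<open>outer D D\<close>, and identifiability forbids
  \<open>D\<close> to vanish almost surely.\<close>

lemma det_lim_cov_less:
  assumes W: "W \<in> \<Theta>" and ne: "W \<noteq> W0"
  shows "det \<Gamma> < det (lim_cov W)"
proof -
  define D where "D p = F W (snd p) - F W0 (snd p)" for p :: "(real ^ 'd) \<times> (real ^ 'l)"
  have [measurable]: "D \<in> borel_measurable borel" unfolding D_def[abs_def] by measurable
  have Db: "norm (D p) \<le> 2 * C" for p
    unfolding D_def using norm_triangle_ineq4[of "F W (snd p)" "F W0 (snd p)"] F_bound[OF W, of "snd p"] F_bound[OF W0_in, of "snd p"]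
    by linarith
  have [measurable]: "(\<lambda>p. outer (D p) (D p)) \<in> borel_measurable borel" by (intro borel_measurable_outer) measurable
  have DD_bound: "norm (outer (D p) (D p)) \<le> (2 * C) * (2 * C) * wt p" for p
  proof -
    have "norm (outer (D p) (D p)) \<le> (2 * C) * (2 * C)"
      unfolding norm_outer using C_ge_1 by (intro mult_mono Db) auto
    also have "\<dots> \<le> (2 * C) * (2 * C) * wt p"
      using mult_left_mono[OF eps_le_wt(3)[of p], of "(2 * C) * (2 * C)"] by simp
    finally show ?thesis .
  qed
  have DD_int: "integrable M (\<lambda>\<omega>. outer (D (X 0 \<omega>)) (D (X 0 \<omega>)))"
    by (rule dominated_integrable[OF _ DD_bound]) measurable
  define P where "P = (LINT \<omega>|M. outer (D (X 0 \<omega>)) (D (X 0 \<omega>)))"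
  have "lim_cov W = \<Gamma> + P"
  proof -
    have "lim_cov W $ i $ j = (\<Gamma> + P) $ i $ j" for i j
    proof -
      have [measurable]: "(\<lambda>x :: real ^ 'd. x $ i) \<in> borel_measurable borel" for i
        by (intro borel_measurable_continuous_onI continuous_intros)
      have comp: "\<bar>D p $ i\<bar> \<le> 2 * C" for p i using component_le_norm_cart[of "D p" i] Db[of p] by linarith
      have g: "(\<lambda>z. (F W z - F W0 z) $ i) \<in> borel_measurable borel" for i
        by (rule measurable_compose[OF borel_measurable_diff[OF F_measurable F_measurable]]) measurable
      have cross: "expectation (\<lambda>\<omega>. eps (X 0 \<omega>) $ i * D (X 0 \<omega>) $ j) = 0"
        and cross_int: "integrable M (\<lambda>\<omega>. eps (X 0 \<omega>) $ i * D (X 0 \<omega>) $ j)" for i j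
      proof -
        have "integrable M (\<lambda>\<omega>. D (X 0 \<omega>) $ j)"
          by (rule integrable_const_bound[of _ "2 * C"]) (use comp in auto)
        then show "expectation (\<lambda>\<omega>. eps (X 0 \<omega>) $ i * D (X 0 \<omega>) $ j) = 0"
          using expectation_eps_mult(1)[OF g[of j], of i] by (simp add: D_def)
        show "integrable M (\<lambda>\<omega>. eps (X 0 \<omega>) $ i * D (X 0 \<omega>) $ j)"
        proof (rule dominated_integrable[of _ "2 * C"])
          fix p
          have "norm (eps p $ i * D p $ j) \<le> wt p * (2 * C)"
            unfolding real_norm_def abs_mult using C_ge_1
            by (intro mult_mono comp order_trans[OF component_le_norm_cart eps_le_wt(1)]) (auto simp: wt_nonneg)
          then show "norm (eps p $ i * D p $ j) \<le> 2 * C * wt p" by (simp add: mult.commute)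
        qed measurable
      qed
      have ee: "outer (eps p) (eps p) $ i $ j = eps p $ i * eps p $ j" for p by simp
      have ee_int: "integrable M (\<lambda>\<omega>. eps (X 0 \<omega>) $ i * eps (X 0 \<omega>) $ j)"
        using integrable_bounded_linear[OF bounded_linear_entry outer_eps_integrable, of i j] by simp
      have DDij: "integrable M (\<lambda>\<omega>. D (X 0 \<omega>) $ i * D (X 0 \<omega>) $ j)"
        using integrable_bounded_linear[OF bounded_linear_entry DD_int, of i j] by simp
      have "outer (res W p) (res W p) $ i $ j
          = eps p $ i * eps p $ j - eps p $ i * D p $ j - eps p $ j * D p $ i + D p $ i * D p $ j" for p
        by (simp add: res_def eps_def D_def algebra_simps)
      then have "lim_cov W $ i $ j = expectation (\<lambda>\<omega>. eps (X 0 \<omega>) $ i * eps (X 0 \<omega>) $ j - eps (X 0 \<omega>) $ i * D (X 0 \<omega>) $ j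
          - eps (X 0 \<omega>) $ j * D (X 0 \<omega>) $ i + D (X 0 \<omega>) $ i * D (X 0 \<omega>) $ j)"
        unfolding lim_cov_def
        using integral_bounded_linear[OF bounded_linear_entry outer_res_integrable[OF W], of i j] by simp
      also have "\<dots> = expectation (\<lambda>\<omega>. eps (X 0 \<omega>) $ i * eps (X 0 \<omega>) $ j) + expectation (\<lambda>\<omega>. D (X 0 \<omega>) $ i * D (X 0 \<omega>) $ j)"
        using ee_int cross_int DDij cross by simp
      also have "expectation (\<lambda>\<omega>. D (X 0 \<omega>) $ i * D (X 0 \<omega>) $ j) = P $ i $ j"
        unfolding P_def using integral_bounded_linear[OF bounded_linear_entry DD_int, of i j] by simp
      also have "expectation (\<lambda>\<omega>. eps (X 0 \<omega>) $ i * eps (X 0 \<omega>) $ j) = \<Gamma> $ i $ j"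
        using integral_bounded_linear[OF bounded_linear_entry outer_eps_integrable, of i j] cov by (simp add: eps_def)
      finally show ?thesis by simp
    qed
    then show ?thesis by (simp add: vec_eq_iff)
  qed
  moreover have "det \<Gamma> < det (\<Gamma> + P)"
  proof (rule det_strict_mono[OF \<Gamma>_pos_def])
    fix x
    have "x \<bullet> (P *v x) = expectation (\<lambda>\<omega>. (x \<bullet> D (X 0 \<omega>)) * (D (X 0 \<omega>) \<bullet> x))"
      unfolding P_def using integral_bounded_linear[OF bounded_linear_matrix_form DD_int, of x x]
      by (simp add: matrix_form_outer)
    also have "0 \<le> \<dots>" by (intro Bochner_Integration.integral_nonneg) (simp add: inner_commute)
    finally show "0 \<le> x \<bullet> (P *v x)" .
  next
    fix A :: "real ^ 'd ^ 'd" assume A: "pos_def A"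
    have nonneg: "0 \<le> x \<bullet> (A *v x)" for x using A unfolding pos_def_def by (cases "x = 0") (auto intro: less_imp_le)
    have int: "integrable M (\<lambda>\<omega>. D (X 0 \<omega>) \<bullet> (A *v D (X 0 \<omega>)))"
      using integrable_bounded_linear[OF bounded_linear_trace_mul DD_int, of A] by (simp add: trace_matrix_mul_outer)
    have tr: "trace (A ** P) = expectation (\<lambda>\<omega>. D (X 0 \<omega>) \<bullet> (A *v D (X 0 \<omega>)))"
      unfolding P_def using integral_bounded_linear[OF bounded_linear_trace_mul DD_int, of A] by (simp add: trace_matrix_mul_outer)
    have "trace (A ** P) \<noteq> 0"
    proof
      assume "trace (A ** P) = 0"
      then have "AE \<omega> in M. D (X 0 \<omega>) \<bullet> (A *v D (X 0 \<omega>)) = 0"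
        unfolding tr using integral_nonneg_eq_0_iff_AE[OF int] nonneg by auto
      then have "AE \<omega> in M. F W (snd (X 0 \<omega>)) = F W0 (snd (X 0 \<omega>))"
      proof (rule AE_mp, intro AE_I2 impI)
        fix \<omega> assume "D (X 0 \<omega>) \<bullet> (A *v D (X 0 \<omega>)) = 0"
        then have "D (X 0 \<omega>) = 0" using A unfolding pos_def_def by force
        then show "F W (snd (X 0 \<omega>)) = F W0 (snd (X 0 \<omega>))" by (simp add: D_def)
      qed
      with identifiable[OF W] ne show False by blast
    qed
    moreover have "0 \<le> trace (A ** P)" unfolding tr by (intro Bochner_Integration.integral_nonneg nonneg)
    ultimately show "0 < trace (A ** P)" by simp
  qed
  ultimately show ?thesis by simp
qed

lemma continuous_on_lim_cov: "continuous_on \<Theta> lim_cov"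
proof (rule continuous_onI)
  fix e :: real and V assume "V \<in> \<Theta>" "0 < e"
  show "\<exists>d>0. \<forall>x'\<in>\<Theta>. dist x' V < d \<longrightarrow> dist (lim_cov x') (lim_cov V) \<le> e"
  proof (intro exI conjI ballI impI)
    let ?c = "4 * C\<^sup>2 * mean_wt + 1"
    have c: "?c > 0" using mean_wt_nonneg by (simp add: add_nonneg_pos)
    show "0 < e / ?c" using c \<open>0 < e\<close> by simp
    fix x' assume x': "x' \<in> \<Theta>" "dist x' V < e / ?c"
    have "dist (lim_cov x') (lim_cov V) \<le> 4 * C\<^sup>2 * norm (x' - V) * mean_wt"
      unfolding dist_norm by (rule lim_cov_lipschitz[OF x'(1) \<open>V \<in> \<Theta>\<close>])
    also have "\<dots> \<le> ?c * norm (x' - V)" by (simp add: algebra_simps)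
    also have "\<dots> \<le> ?c * (e / ?c)" using x'(2) c by (intro mult_left_mono) (auto simp: dist_norm)
    also have "\<dots> = e" using c by simp
    finally show "dist (lim_cov x') (lim_cov V) \<le> e" .
  qed
qed

text \<open>Compactness turns the strict inequality away from \<open>W0\<close> into a uniform
  gap.\<close>

lemma det_lim_cov_separation:
  assumes "0 < \<delta>"
  shows "\<exists>\<kappa>>0. \<forall>W\<in>\<Theta>. \<delta> \<le> norm (W - W0) \<longrightarrow> det \<Gamma> + \<kappa> \<le> det (lim_cov W)"
proof (cases "\<Theta> - ball W0 \<delta> = {}")
  case True
  then show ?thesis by (intro exI[of _ 1]) (auto simp: dist_norm norm_minus_commute)
next
  case False
  have "compact (\<Theta> - ball W0 \<delta>)" by (rule compact_diff[OF compact open_ball])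
  moreover have "continuous_on (\<Theta> - ball W0 \<delta>) (\<lambda>W. det (lim_cov W))"
    by (rule continuous_on_compose2[OF continuous_on_det[of UNIV] continuous_on_subset[OF continuous_on_lim_cov]]) auto
  ultimately obtain V where V: "V \<in> \<Theta> - ball W0 \<delta>" "\<And>W. W \<in> \<Theta> - ball W0 \<delta> \<Longrightarrow> det (lim_cov V) \<le> det (lim_cov W)"
    using continuous_attains_inf[OF _ False] by blast
  have "V \<noteq> W0" using V(1) assms by auto
  then have "det \<Gamma> < det (lim_cov V)" using V(1) by (intro det_lim_cov_less) auto
  then show ?thesis
    by (intro exI[of _ "det (lim_cov V) - det \<Gamma>"])
       (auto simp: dist_norm norm_minus_commute intro!: V(2))
qed

lemma det_uniform:
  assumes "0 < \<kappa>"
  shows "whp M (\<lambda>n \<omega>. \<forall>W\<in>\<Theta>. \<bar>det (emp_cov n W \<omega>) - det (lim_cov W)\<bar> \<le> \<kappa>)"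
proof -
  obtain R where R: "\<And>W. W \<in> \<Theta> \<Longrightarrow> norm (lim_cov W) \<le> R"
    using compact_imp_bounded[OF compact_continuous_image[OF continuous_on_lim_cov compact]]
    unfolding bounded_iff by auto
  \<comment> \<open>Once the uniform error is at most 1, all matrices involved lie in this
    ball.\<close>
  have "uniformly_continuous_on (cball (0 :: real ^ 'd ^ 'd) (R + 1)) det"
    by (intro compact_uniformly_continuous continuous_on_det compact_cball)
  from this[unfolded uniformly_continuous_on_def, rule_format, OF assms] obtain d where d: "d > 0"
    "\<And>A B. A \<in> cball 0 (R + 1) \<Longrightarrow> B \<in> cball 0 (R + 1) \<Longrightarrow> dist B A < d \<Longrightarrow> dist (det B) (det (A :: real ^ 'd ^ 'd)) < \<kappa>"
    by blast
  define \<tau> where "\<tau> = min 1 (d / 2)"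
  have \<tau>: "\<tau> > 0" "\<tau> \<le> 1" "\<tau> < d" using d(1) by (auto simp: \<tau>_def)
  from emp_cov_uniform[OF \<tau>(1)] show ?thesis
  proof (rule whp_mono[where N = 0], intro ballI)
    fix n \<omega> W assume ev: "\<forall>W\<in>\<Theta>. norm (emp_cov n W \<omega> - lim_cov W) \<le> \<tau>" and W: "W \<in> \<Theta>"
    then have c: "norm (emp_cov n W \<omega> - lim_cov W) \<le> \<tau>" by blast
    then have "norm (emp_cov n W \<omega>) \<le> R + 1"
      using R[OF W] \<tau>(2) norm_triangle_ineq2[of "emp_cov n W \<omega>" "lim_cov W"] by linarith
    then have "dist (det (emp_cov n W \<omega>)) (det (lim_cov W)) < \<kappa>"
      using c \<tau>(3) R[OF W] by (intro d(2)) (auto simp: dist_norm)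
    then show "\<bar>det (emp_cov n W \<omega>) - det (lim_cov W)\<bar> \<le> \<kappa>" by (simp add: dist_real_def)
  qed
qed

text \<open>The claim concerns all of \<Theta> rather than a minimiser, so it serves both estimators
  at once: any weight vector that does no worse than \<open>W0\<close> lies within \<delta> of it.
  Positivity of all determinants makes the cost finite on this event.\<close>

lemma consistency:
  assumes "0 < \<delta>"
  shows "whp M (\<lambda>n \<omega>. \<forall>W\<in>\<Theta>. 0 < det (emp_cov n W \<omega>) \<and>
    (\<delta> \<le> norm (W - W0) \<longrightarrow> det (emp_cov n W0 \<omega>) < det (emp_cov n W \<omega>)))"
proof -
  obtain \<kappa>0 where \<kappa>0: "\<kappa>0 > 0" "\<forall>W\<in>\<Theta>. \<delta> \<le> norm (W - W0) \<longrightarrow> det \<Gamma> + \<kappa>0 \<le> det (lim_cov W)"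
    using det_lim_cov_separation[OF assms] by blast
  have \<Gamma>: "det \<Gamma> > 0" by (rule pos_def_det_pos[OF \<Gamma>_pos_def])
  \<comment> \<open>Two errors of \<kappa> stay below the gap \<open>\<kappa>0\<close>, and one
    error leaves at least half of \<open>det \<Gamma>\<close>.\<close>
  define \<kappa> where "\<kappa> = min (\<kappa>0 / 3) (det \<Gamma> / 2)"
  have \<kappa>: "0 < \<kappa>" "\<kappa> \<le> \<kappa>0 / 3" "\<kappa> \<le> det \<Gamma> / 2" using \<kappa>0(1) \<Gamma> by (auto simp: \<kappa>_def)
  from det_uniform[OF \<kappa>(1)] show ?thesis
  proof (rule whp_mono[where N = 0], intro ballI conjI impI)
    fix n \<omega> W assume ev: "\<forall>W\<in>\<Theta>. \<bar>det (emp_cov n W \<omega>) - det (lim_cov W)\<bar> \<le> \<kappa>" and W: "W \<in> \<Theta>"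
    have a: "\<bar>det (emp_cov n W \<omega>) - det (lim_cov W)\<bar> \<le> \<kappa>" using ev W by blast
    have b: "\<bar>det (emp_cov n W0 \<omega>) - det \<Gamma>\<bar> \<le> \<kappa>" using ev W0_in lim_cov_W0 by auto
    have "det \<Gamma> \<le> det (lim_cov W)"
      using det_lim_cov_less[OF W] lim_cov_W0 by (cases "W = W0") auto
    then show "0 < det (emp_cov n W \<omega>)" using a \<kappa>(3) \<Gamma> by linarith
    assume "\<delta> \<le> norm (W - W0)"
    then have "det \<Gamma> + \<kappa>0 \<le> det (lim_cov W)" using \<kappa>0(2) W by blast
    then show "det (emp_cov n W0 \<omega>) < det (emp_cov n W \<omega>)" using a b \<kappa>(1,2) by linarith
  qed
qed

end

section \<open>Local expansion of the cost function\<close>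

lemma linear_axis_expansion:
  fixes f :: "real ^ 'n \<Rightarrow> 'b::real_vector"
  assumes "linear f"
  shows "f h = (\<Sum>k\<in>UNIV. h $ k *\<^sub>R f (axis k 1))"
proof -
  have "h = (\<Sum>k\<in>UNIV. h $ k *\<^sub>R axis k 1)"
    by (simp only: scalar_mult_eq_scaleR[symmetric] basis_expansion)
  then have "f h = f (\<Sum>k\<in>UNIV. h $ k *\<^sub>R axis k 1)" by (rule arg_cong)
  then show ?thesis by (simp add: linear_sum[OF assms] linear_scale[OF assms])
qed

lemma quadratic_sum_bound:
  fixes h :: "real ^ 'n"
  assumes "\<And>k l. \<bar>m k l\<bar> \<le> c"
  shows "\<bar>\<Sum>k\<in>UNIV. \<Sum>l\<in>UNIV. h $ k * h $ l * m k l\<bar> \<le> (real CARD('n))\<^sup>2 * c * (norm h)\<^sup>2"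
proof -
  have "\<bar>\<Sum>k\<in>UNIV. \<Sum>l\<in>UNIV. h $ k * h $ l * m k l\<bar> \<le> (\<Sum>k\<in>(UNIV::'n set). \<Sum>l\<in>(UNIV::'n set). norm h * norm h * c)"
  proof (rule order_trans[OF sum_abs], intro sum_mono order_trans[OF sum_abs])
    fix k l
    show "\<bar>h $ k * h $ l * m k l\<bar> \<le> norm h * norm h * c"
      unfolding abs_mult by (intro mult_mono component_le_norm_cart assms) auto
  qed
  then show ?thesis by (simp add: power2_eq_square algebra_simps)
qed

context regression_sample
begin

abbreviation J_axis :: "'w \<Rightarrow> (real ^ 'd) \<times> (real ^ 'l) \<Rightarrow> real ^ 'd" where
  "J_axis k p \<equiv> J (snd p) (axis k 1)"

text \<open>The matrix \<open>I0\<close> for a general regression function. The index order follows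
  from \<open>trace (\<Gamma>i ** outer u v) = v \<bullet> (\<Gamma>i *v u)\<close>.\<close>

definition info :: "real ^ 'w ^ 'w" where
  "info = (\<chi> k l. expectation (\<lambda>\<omega>. J_axis l (X 0 \<omega>) \<bullet> (\<Gamma>i *v J_axis k (X 0 \<omega>))))"

text \<open>Up to the factor \<open>- sqrt n / 2\<close>, this is the gradient at \<open>W0\<close>
  of the empirical covariance traced against the inverse of \<Gamma>.\<close>

definition score :: "nat \<Rightarrow> 'a \<Rightarrow> real ^ 'w" where
  "score n \<omega> = (\<chi> k. (\<Sum>t = 1..n. J_axis k (X t \<omega>) \<bullet> (\<Gamma>i *v eps (X t \<omega>))) / sqrt (real n))"

definition noise_sum :: "nat \<Rightarrow> 'd \<Rightarrow> 'w \<Rightarrow> 'd \<Rightarrow> 'a \<Rightarrow> real" where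
  "noise_sum n i k j \<omega> = (\<Sum>t = 1..n. eps (X t \<omega>) $ i * J_axis k (X t \<omega>) $ j) / sqrt (real n)"

text \<open>One scalar that dominates all normalised sums pairing a noise coordinate with a Jacobian
  entry. When it is bounded by \<open>K\<close>, every average linear in both the noise and the
  first-order increment is of order \<open>norm h / sqrt n\<close>.\<close>

definition noise_size :: "nat \<Rightarrow> 'a \<Rightarrow> real" where
  "noise_size n \<omega> = (\<Sum>i\<in>UNIV. \<Sum>j\<in>UNIV. \<Sum>k\<in>UNIV. \<bar>noise_sum n i k j \<omega>\<bar>)"

definition incr :: "real ^ 'w \<Rightarrow> (real ^ 'd) \<times> (real ^ 'l) \<Rightarrow> real ^ 'd" where
  "incr h p = F (W0 + h) (snd p) - F W0 (snd p)"

lemma axis_norm: "norm (axis k (1::real)) = 1" by (rule norm_axis_1)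

lemma J_axis_bound: "norm (J_axis k p) \<le> C * (1 + norm (snd p))"
  using J_bound[of "snd p" "axis k 1"] by (simp add: axis_norm)

lemma eps_J_square_bound: "(eps p $ i * J_axis k p $ j)\<^sup>2 \<le> C\<^sup>2 * wt p"
proof -
  have "\<bar>eps p $ i * J_axis k p $ j\<bar> \<le> (1 + norm (eps p)) * (C * (1 + norm (snd p)))"
    unfolding abs_mult
    by (intro mult_mono order_trans[OF component_le_norm_cart] J_axis_bound) auto
  then have "\<bar>eps p $ i * J_axis k p $ j\<bar>\<^sup>2 \<le> ((1 + norm (eps p)) * (C * (1 + norm (snd p))))\<^sup>2"
    by (rule power_mono) simp
  also have "\<dots> = C\<^sup>2 * ((1 + norm (snd p))\<^sup>2 * (1 + norm (eps p))\<^sup>2)" by (simp add: power_mult_distrib)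
  also have "\<dots> \<le> C\<^sup>2 * wt p" by (intro mult_left_mono weight_le_wt) auto
  finally show ?thesis by simp
qed

lemma vec_nth_borel [measurable]: "(\<lambda>x :: real ^ 'n. x $ i) \<in> borel_measurable borel"
  by (intro borel_measurable_continuous_onI continuous_intros)

lemma J_nth_integrable: "integrable M (\<lambda>\<omega>. J (snd (X 0 \<omega>)) v $ j)"
proof (rule dominated_integrable[of "\<lambda>p. J (snd p) v $ j" "C * norm v"])
  fix p :: "(real ^ 'd) \<times> (real ^ 'l)"
  have "norm (J (snd p) v $ j) \<le> norm (J (snd p) v)" using component_le_norm_cart by simp
  also have "\<dots> \<le> C * norm v * (1 + norm (snd p))" using J_bound[of "snd p" v] by (simp add: mult_ac)
  also have "\<dots> \<le> C * norm v * wt p"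
    using weight_le_wt[of 1 0 p] C_ge_1 by (intro mult_left_mono) auto
  finally show "norm (J (snd p) v $ j) \<le> C * norm v * wt p" .
qed measurable

lemma noise_size_tight: "tight M noise_size"
  unfolding noise_size_def[abs_def]
proof (intro tight_sum finite)
  fix i j :: 'd and k :: 'w
  have [measurable]: "(\<lambda>p. eps p $ i * J_axis k p $ j) \<in> borel_measurable borel" by measurable
  have "tight M (\<lambda>n \<omega>. \<bar>(\<Sum>t = 1..n. (\<lambda>p. eps p $ i * J_axis k p $ j) (X t \<omega>)) / sqrt (real n)\<bar>)"
  proof (rule tight_normalized_sum)
    show "iid_seq M (\<lambda>t \<omega>. (\<lambda>p. eps p $ i * J_axis k p $ j) (X t \<omega>))"
      by (rule iid_seq_compose[OF iid]) measurable
    show "integrable M (\<lambda>\<omega>. ((\<lambda>p. eps p $ i * J_axis k p $ j) (X 0 \<omega>))\<^sup>2)"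
      by (rule dominated_integrable[of "\<lambda>p. (eps p $ i * J_axis k p $ j)\<^sup>2" "C\<^sup>2"]) (use eps_J_square_bound in auto)
    show "expectation (\<lambda>\<omega>. (\<lambda>p. eps p $ i * J_axis k p $ j) (X 0 \<omega>)) = 0"
      using expectation_eps_mult(1)[of "\<lambda>z. J z (axis k 1) $ j" i] J_nth_integrable J_measurable
      by (simp add: measurable_compose[OF J_measurable vec_nth_borel])
  qed
  then show "tight M (\<lambda>n \<omega>. \<bar>noise_sum n i k j \<omega>\<bar>)" by (simp add: noise_sum_def)
qed

lemma inverse_form_bound:
  "\<exists>\<gamma>\<ge>0. (\<forall>x. norm (\<Gamma>i *v x) \<le> \<gamma> * norm x) \<and> (\<forall>x y. \<bar>x \<bullet> (\<Gamma>i *v y)\<bar> \<le> \<gamma> * (norm x * norm y))"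
proof -
  obtain \<gamma> where \<gamma>: "0 < \<gamma>" "\<And>x. norm (\<Gamma>i *v x) \<le> norm x * \<gamma>"
    using bounded_linear.pos_bounded[OF matrix_vector_mul_bounded_linear[of \<Gamma>i]] by auto
  have "\<bar>x \<bullet> (\<Gamma>i *v y)\<bar> \<le> \<gamma> * (norm x * norm y)" for x y
  proof -
    have "\<bar>x \<bullet> (\<Gamma>i *v y)\<bar> \<le> norm x * (norm y * \<gamma>)"
      using Cauchy_Schwarz_ineq2[of x "\<Gamma>i *v y"] mult_left_mono[OF \<gamma>(2)[of y] norm_ge_zero[of x]] by linarith
    then show ?thesis by (simp add: mult_ac)
  qed
  with \<gamma> show ?thesis by (intro exI[of _ \<gamma>]) (simp add: mult.commute)
qed

lemma score_inner: "score n \<omega> \<bullet> v = (\<Sum>t = 1..n. J (snd (X t \<omega>)) v \<bullet> (\<Gamma>i *v eps (X t \<omega>))) / sqrt (real n)"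
proof -
  have "J (snd p) v \<bullet> (\<Gamma>i *v eps p) = (\<Sum>k\<in>UNIV. v $ k * (J_axis k p \<bullet> (\<Gamma>i *v eps p)))" for p
    by (subst linear_axis_expansion[OF J_linear]) (simp add: inner_sum_left)
  then have "(\<Sum>t = 1..n. J (snd (X t \<omega>)) v \<bullet> (\<Gamma>i *v eps (X t \<omega>)))
      = (\<Sum>k\<in>UNIV. v $ k * (\<Sum>t = 1..n. J_axis k (X t \<omega>) \<bullet> (\<Gamma>i *v eps (X t \<omega>))))"
    by (simp add: sum_distrib_left) (rule sum.swap)
  moreover have "score n \<omega> \<bullet> v = (\<Sum>k\<in>UNIV. (\<Sum>t = 1..n. J_axis k (X t \<omega>) \<bullet> (\<Gamma>i *v eps (X t \<omega>))) / sqrt (real n) * v $ k)"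
    unfolding inner_vec_def[of "score n \<omega>" v] inner_real_def by (simp only: score_def vec_lambda_beta)
  moreover have "\<dots> = (\<Sum>k\<in>UNIV. v $ k * (\<Sum>t = 1..n. J_axis k (X t \<omega>) \<bullet> (\<Gamma>i *v eps (X t \<omega>)))) / sqrt (real n)"
    unfolding sum_divide_distrib[of _ UNIV] by (intro sum.cong refl) simp
  ultimately show ?thesis by (simp only:)
qed

text \<open>Each coordinate of the score is a fixed linear combination of the noise sums, so
  tightness of \<open>noise_size\<close> controls the score as well.\<close>

lemma score_bound:
  "\<exists>c\<ge>0. \<forall>n \<omega>. norm (score n \<omega>) \<le> c * noise_size n \<omega>"
proof -
  define c where "c = (\<Sum>i\<in>UNIV. \<Sum>j\<in>UNIV. \<bar>\<Gamma>i $ j $ i\<bar>)"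
  have c: "\<bar>\<Gamma>i $ j $ i\<bar> \<le> c" for i j
  proof -
    have "\<bar>\<Gamma>i $ j $ i\<bar> \<le> (\<Sum>j\<in>UNIV. \<bar>\<Gamma>i $ j $ i\<bar>)" by (rule member_le_sum) auto
    also have "\<dots> \<le> c" unfolding c_def by (rule member_le_sum[of i]) (auto intro: sum_nonneg)
    finally show ?thesis .
  qed
  have c0: "0 \<le> c" unfolding c_def by (intro sum_nonneg) auto
  have "norm (score n \<omega>) \<le> c * noise_size n \<omega>" for n \<omega>
  proof -
    have comp: "score n \<omega> $ k = (\<Sum>i\<in>UNIV. \<Sum>j\<in>UNIV. \<Gamma>i $ j $ i * noise_sum n i k j \<omega>)" for k
    proof -
      have "J_axis k p \<bullet> (\<Gamma>i *v eps p) = (\<Sum>i\<in>UNIV. \<Sum>j\<in>UNIV. \<Gamma>i $ j $ i * (eps p $ i * J_axis k p $ j))" for p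
      proof -
        have "J_axis k p \<bullet> (\<Gamma>i *v eps p) = (\<Sum>j\<in>UNIV. \<Sum>i\<in>UNIV. \<Gamma>i $ j $ i * (eps p $ i * J_axis k p $ j))"
          by (simp add: inner_vec_def matrix_vector_mult_def sum_distrib_left mult_ac)
        also have "\<dots> = (\<Sum>i\<in>UNIV. \<Sum>j\<in>UNIV. \<Gamma>i $ j $ i * (eps p $ i * J_axis k p $ j))" by (rule sum.swap)
        finally show ?thesis .
      qed
      then have "(\<Sum>t = 1..n. J_axis k (X t \<omega>) \<bullet> (\<Gamma>i *v eps (X t \<omega>)))
          = (\<Sum>t = 1..n. \<Sum>i\<in>UNIV. \<Sum>j\<in>UNIV. \<Gamma>i $ j $ i * (eps (X t \<omega>) $ i * J_axis k (X t \<omega>) $ j))"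
        by (simp only:)
      also have "\<dots> = (\<Sum>i\<in>UNIV. \<Sum>t = 1..n. \<Sum>j\<in>UNIV. \<Gamma>i $ j $ i * (eps (X t \<omega>) $ i * J_axis k (X t \<omega>) $ j))"
        by (rule sum.swap)
      also have "\<dots> = (\<Sum>i\<in>UNIV. \<Sum>j\<in>UNIV. \<Sum>t = 1..n. \<Gamma>i $ j $ i * (eps (X t \<omega>) $ i * J_axis k (X t \<omega>) $ j))"
        by (intro sum.cong refl sum.swap)
      also have "\<dots> = (\<Sum>i\<in>UNIV. \<Sum>j\<in>UNIV. \<Gamma>i $ j $ i * (\<Sum>t = 1..n. eps (X t \<omega>) $ i * J_axis k (X t \<omega>) $ j))"
        by (simp only: sum_distrib_left)
      finally have "score n \<omega> $ k = (\<Sum>i\<in>UNIV. \<Sum>j\<in>UNIV. \<Gamma>i $ j $ i * (\<Sum>t = 1..n. eps (X t \<omega>) $ i * J_axis k (X t \<omega>) $ j)) / sqrt (real n)"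
        by (simp only: score_def vec_lambda_beta)
      also have "\<dots> = (\<Sum>i\<in>UNIV. \<Sum>j\<in>UNIV. \<Gamma>i $ j $ i * noise_sum n i k j \<omega>)"
        unfolding sum_divide_distrib[of _ UNIV] noise_sum_def by (intro sum.cong refl) simp
      finally show ?thesis .
    qed
    have "norm (score n \<omega>) \<le> (\<Sum>k\<in>UNIV. \<bar>score n \<omega> $ k\<bar>)" by (rule norm_le_l1_cart)
    also have "\<dots> \<le> (\<Sum>k\<in>UNIV. \<Sum>i\<in>UNIV. \<Sum>j\<in>UNIV. c * \<bar>noise_sum n i k j \<omega>\<bar>)"
      unfolding comp
    proof (intro sum_mono order_trans[OF sum_abs])
      fix k i j
      show "\<bar>\<Gamma>i $ j $ i * noise_sum n i k j \<omega>\<bar> \<le> c * \<bar>noise_sum n i k j \<omega>\<bar>"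
        unfolding abs_mult by (intro mult_right_mono c) auto
    qed
    also have "\<dots> = (\<Sum>i\<in>UNIV. \<Sum>k\<in>UNIV. \<Sum>j\<in>UNIV. c * \<bar>noise_sum n i k j \<omega>\<bar>)" by (rule sum.swap)
    also have "\<dots> = (\<Sum>i\<in>UNIV. \<Sum>j\<in>UNIV. \<Sum>k\<in>UNIV. c * \<bar>noise_sum n i k j \<omega>\<bar>)" by (intro sum.cong refl sum.swap)
    also have "\<dots> = c * noise_size n \<omega>" by (simp only: noise_size_def sum_distrib_left)
    finally show ?thesis .
  qed
  with c0 show ?thesis by blast
qed

lemma incr_bounds:
  assumes "norm h \<le> 1"
  shows "norm (incr h p) \<le> C * (1 + norm (snd p)) * norm h"
    and "norm (incr h p - J (snd p) h) \<le> C * (1 + norm (snd p))\<^sup>2 * (norm h)\<^sup>2"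
    and "norm (incr h p - J (snd p) h - B (snd p) h h) \<le> C * (1 + norm (snd p)) ^ 3 * norm h ^ 3"
  unfolding incr_def using F_lipschitz_W0[OF assms] F_expansion_1[OF assms] F_expansion_2[OF assms] by blast+

lemma emp_cov_diff:
  "emp_cov n (W0 + h) \<omega> - emp_cov n W0 \<omega>
    = ave n (\<lambda>p. outer (incr h p) (incr h p) - (outer (eps p) (incr h p) + outer (incr h p) (eps p))) \<omega>"
proof -
  have "outer (res (W0 + h) p) (res (W0 + h) p) - outer (res W0 p) (res W0 p)
      = outer (incr h p) (incr h p) - (outer (eps p) (incr h p) + outer (incr h p) (eps p))" for p
  proof -
    have "res (W0 + h) p = eps p - incr h p" "res W0 p = eps p" by (simp_all add: res_def eps_def incr_def)
    then show ?thesis by (simp add: outer_diff_left outer_diff_right)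
  qed
  then show ?thesis by (simp add: emp_cov_def ave_diff[symmetric])
qed

text \<open>Only the term linear in both the noise and \<open>h\<close> has to use the root-n rate,
  supplied by \<open>noise_size\<close>. The others are products of two increments, or of the noise
  with the second-order remainder of the network, hence quadratic in \<open>h\<close>.\<close>

lemma emp_cov_diff_norm:
  assumes h: "norm h \<le> 1"
  shows "norm (emp_cov n (W0 + h) \<omega> - emp_cov n W0 \<omega>)
    \<le> (C\<^sup>2 + 2 * C) * ave n wt \<omega> * (norm h)\<^sup>2 + 2 * noise_size n \<omega> * (norm h / sqrt (real n))"
proof -
  define R where "R p = incr h p - J (snd p) h" for p
  let ?lin = "\<lambda>p. outer (eps p) (J (snd p) h) + outer (J (snd p) h) (eps p)"
  let ?rem = "\<lambda>p. outer (incr h p) (incr h p) - (outer (eps p) (R p) + outer (R p) (eps p))"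
  have split: "outer (incr h p) (incr h p) - (outer (eps p) (incr h p) + outer (incr h p) (eps p)) = ?rem p - ?lin p" for p
    by (simp add: R_def outer_diff_left outer_diff_right)
  have "norm (?rem p) \<le> ((C\<^sup>2 + 2 * C) * (norm h)\<^sup>2) * wt p" for p
  proof -
    have "norm (?rem p) \<le> norm (incr h p) * norm (incr h p) + (norm (eps p) * norm (R p) + norm (R p) * norm (eps p))"
      using norm_triangle_ineq4[of "outer (incr h p) (incr h p)" "outer (eps p) (R p) + outer (R p) (eps p)"]
        norm_triangle_ineq[of "outer (eps p) (R p)" "outer (R p) (eps p)"] unfolding norm_outer by linarith
    also have "norm (incr h p) * norm (incr h p) \<le> (C * (1 + norm (snd p)) * norm h) * (C * (1 + norm (snd p)) * norm h)"
      using C_ge_1 by (intro mult_mono incr_bounds h) auto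
    also have "\<dots> = C\<^sup>2 * (norm h)\<^sup>2 * (1 + norm (snd p))\<^sup>2" by (simp add: power2_eq_square)
    also have "\<dots> \<le> C\<^sup>2 * (norm h)\<^sup>2 * wt p"
      using weight_le_wt[of 2 0 p] by (intro mult_left_mono) auto
    also have "norm (eps p) * norm (R p) + norm (R p) * norm (eps p) = 2 * (norm (eps p) * norm (R p))" by simp
    also have "norm (eps p) * norm (R p) \<le> (1 + norm (eps p)) * (C * (1 + norm (snd p))\<^sup>2 * (norm h)\<^sup>2)"
      unfolding R_def using C_ge_1 by (intro mult_mono incr_bounds h) auto
    also have "\<dots> = C * (norm h)\<^sup>2 * ((1 + norm (snd p))\<^sup>2 * (1 + norm (eps p)) ^ 1)" by simp
    also have "\<dots> \<le> C * (norm h)\<^sup>2 * wt p"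
      using C_ge_1 by (intro mult_left_mono weight_le_wt) auto
    finally show ?thesis by (simp add: algebra_simps)
  qed
  then have rem: "norm (ave n ?rem \<omega>) \<le> ((C\<^sup>2 + 2 * C) * (norm h)\<^sup>2) * ave n wt \<omega>" by (rule norm_ave_le)
  have ent: "\<bar>ave n (\<lambda>p. eps p $ i * J (snd p) h $ j) \<omega>\<bar> \<le> (\<Sum>k\<in>UNIV. \<bar>noise_sum n i k j \<omega>\<bar>) * (norm h / sqrt (real n))" for i j
  proof -
    have "eps p $ i * J (snd p) h $ j = (\<Sum>k\<in>UNIV. h $ k * (eps p $ i * J_axis k p $ j))" for p
      by (subst linear_axis_expansion[OF J_linear]) (simp add: sum_distrib_left mult_ac)
    then have "ave n (\<lambda>p. eps p $ i * J (snd p) h $ j) \<omega> = (\<Sum>k\<in>UNIV. h $ k * ave n (\<lambda>p. eps p $ i * J_axis k p $ j) \<omega>)"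
      by (simp add: ave_sum ave_mult)
    also have "\<dots> = (\<Sum>k\<in>UNIV. h $ k * (noise_sum n i k j \<omega> / sqrt (real n)))"
      by (intro sum.cong refl arg_cong2[where f = "(*)"]) (simp add: ave_def noise_sum_def)
    finally have "\<bar>ave n (\<lambda>p. eps p $ i * J (snd p) h $ j) \<omega>\<bar> \<le> (\<Sum>k\<in>UNIV. \<bar>h $ k * (noise_sum n i k j \<omega> / sqrt (real n))\<bar>)"
      by (simp only: sum_abs)
    also have "\<dots> \<le> (\<Sum>k\<in>UNIV. norm h * (\<bar>noise_sum n i k j \<omega>\<bar> / sqrt (real n)))"
    proof (rule sum_mono)
      fix k
      show "\<bar>h $ k * (noise_sum n i k j \<omega> / sqrt (real n))\<bar> \<le> norm h * (\<bar>noise_sum n i k j \<omega>\<bar> / sqrt (real n))"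
        unfolding abs_mult by (intro mult_mono component_le_norm_cart) auto
    qed
    also have "\<dots> = (\<Sum>k\<in>UNIV. \<bar>noise_sum n i k j \<omega>\<bar>) * (norm h / sqrt (real n))"
      unfolding sum_distrib_right by (intro sum.cong refl) simp
    finally show ?thesis .
  qed
  have "norm (ave n ?lin \<omega>) \<le> (\<Sum>i\<in>UNIV. \<Sum>j\<in>UNIV. \<bar>ave n ?lin \<omega> $ i $ j\<bar>)" by (rule norm_matrix_le_entries)
  also have "\<dots> \<le> (\<Sum>i\<in>UNIV. \<Sum>j\<in>UNIV. (\<Sum>k\<in>UNIV. \<bar>noise_sum n i k j \<omega>\<bar>) * (norm h / sqrt (real n))
      + (\<Sum>k\<in>UNIV. \<bar>noise_sum n j k i \<omega>\<bar>) * (norm h / sqrt (real n)))"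
  proof (intro sum_mono)
    fix i j
    have "ave n ?lin \<omega> $ i $ j = ave n (\<lambda>p. ?lin p $ i $ j) \<omega>"
      by (rule ave_linear[OF bounded_linear.linear[OF bounded_linear_entry]])
    also have "(\<lambda>p. ?lin p $ i $ j) = (\<lambda>p. eps p $ i * J (snd p) h $ j + eps p $ j * J (snd p) h $ i)"
      by (simp add: fun_eq_iff)
    also have "ave n (\<lambda>p. eps p $ i * J (snd p) h $ j + eps p $ j * J (snd p) h $ i) \<omega>
        = ave n (\<lambda>p. eps p $ i * J (snd p) h $ j) \<omega> + ave n (\<lambda>p. eps p $ j * J (snd p) h $ i) \<omega>" by (rule ave_add)
    finally show "\<bar>ave n ?lin \<omega> $ i $ j\<bar> \<le> (\<Sum>k\<in>UNIV. \<bar>noise_sum n i k j \<omega>\<bar>) * (norm h / sqrt (real n))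
      + (\<Sum>k\<in>UNIV. \<bar>noise_sum n j k i \<omega>\<bar>) * (norm h / sqrt (real n))"
      using ent[of i j] ent[of j i] by linarith
  qed
  also have "\<dots> = 2 * noise_size n \<omega> * (norm h / sqrt (real n))"
  proof -
    have "(\<Sum>i\<in>UNIV. \<Sum>j\<in>UNIV. \<Sum>k\<in>UNIV. \<bar>noise_sum n j k i \<omega>\<bar>) = noise_size n \<omega>"
      unfolding noise_size_def by (rule sum.swap)
    then show ?thesis
      by (simp only: sum.distrib sum_distrib_right[symmetric]) (simp add: noise_size_def)
  qed
  finally have lin: "norm (ave n ?lin \<omega>) \<le> 2 * noise_size n \<omega> * (norm h / sqrt (real n))" .
  have "norm (emp_cov n (W0 + h) \<omega> - emp_cov n W0 \<omega>) = norm (ave n ?rem \<omega> - ave n ?lin \<omega>)"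
    unfolding emp_cov_diff split by (simp only: ave_diff)
  also have "\<dots> \<le> norm (ave n ?rem \<omega>) + norm (ave n ?lin \<omega>)" by (rule norm_triangle_ineq4)
  also have "\<dots> \<le> ((C\<^sup>2 + 2 * C) * (norm h)\<^sup>2) * ave n wt \<omega> + 2 * noise_size n \<omega> * (norm h / sqrt (real n))"
    using rem lin by (rule add_mono)
  finally show ?thesis by (simp add: mult_ac)
qed

lemma info_form: "x \<bullet> (info *v y) = (\<Sum>k\<in>UNIV. \<Sum>l\<in>UNIV. x $ k * y $ l * info $ k $ l)"
  by (simp add: inner_vec_def matrix_vector_mult_def sum_distrib_left mult_ac)

lemma JJ_axis_expansion:
  "J (snd p) v \<bullet> (\<Gamma>i *v J (snd p) v) = (\<Sum>k\<in>UNIV. \<Sum>l\<in>UNIV. v $ k * v $ l * (J_axis l p \<bullet> (\<Gamma>i *v J_axis k p)))"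
proof -
  have 1: "J (snd p) v = (\<Sum>k\<in>UNIV. v $ k *\<^sub>R J_axis k p)" by (rule linear_axis_expansion[OF J_linear])
  have "J (snd p) v \<bullet> (\<Gamma>i *v J (snd p) v) = (\<Sum>k\<in>UNIV. v $ k * (J_axis k p \<bullet> (\<Gamma>i *v J (snd p) v)))"
    by (subst 1) (simp add: inner_sum_left)
  also have "\<dots> = (\<Sum>k\<in>UNIV. v $ k * (J (snd p) v \<bullet> (\<Gamma>i *v J_axis k p)))"
    by (simp only: \<Gamma>i_sym[of "J_axis _ p"])
  also have "\<dots> = (\<Sum>k\<in>UNIV. v $ k * (\<Sum>l\<in>UNIV. v $ l * (J_axis l p \<bullet> (\<Gamma>i *v J_axis k p))))"
    by (subst 1) (simp add: inner_sum_left)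
  finally show ?thesis by (simp add: sum_distrib_left mult_ac)
qed

text \<open>After expansion of the network to second order, the trace splits into the information
  term \<open>?JJ\<close>, the score term \<open>?JE\<close>, the noise-weighted second-order term
  \<open>?BE\<close>, and two cubic remainders. The factor 3 counts one error \<kappa> from
  \<open>?JJ\<close> and two from \<open>?BE\<close>, which enters doubled; the cubic constant is
  \<open>2 * C\<^sup>2\<close> from \<open>?DD\<close> plus twice \<open>C\<close> from
  \<open>?SE\<close>.\<close>

lemma trace_diff_expansion:
  assumes h: "norm h \<le> 1" and n: "n \<ge> 1" and \<gamma>: "0 \<le> \<gamma>" "\<And>x y. \<bar>x \<bullet> (\<Gamma>i *v y)\<bar> \<le> \<gamma> * (norm x * norm y)"
    and JJ: "\<And>k l. \<bar>ave n (\<lambda>p. J_axis l p \<bullet> (\<Gamma>i *v J_axis k p)) \<omega> - info $ k $ l\<bar> \<le> \<kappa>"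
    and BE: "\<And>k l. \<bar>ave n (\<lambda>p. B (snd p) (axis k 1) (axis l 1) \<bullet> (\<Gamma>i *v eps p)) \<omega>\<bar> \<le> \<kappa>"
  shows "\<bar>trace (\<Gamma>i ** (emp_cov n (W0 + h) \<omega> - emp_cov n W0 \<omega>))
      - (h \<bullet> (info *v h) - 2 * (score n \<omega> \<bullet> h) / sqrt (real n))\<bar>
    \<le> 3 * (real CARD('w))\<^sup>2 * \<kappa> * (norm h)\<^sup>2 + (2 * C\<^sup>2 + 2 * C) * \<gamma> * ave n wt \<omega> * norm h ^ 3"
proof -
  let ?s2 = "(real CARD('w))\<^sup>2"
  let ?JJ = "\<lambda>p. J (snd p) h \<bullet> (\<Gamma>i *v J (snd p) h)"
  let ?DD = "\<lambda>p. incr h p \<bullet> (\<Gamma>i *v incr h p) - ?JJ p"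
  let ?JE = "\<lambda>p. J (snd p) h \<bullet> (\<Gamma>i *v eps p)"
  let ?BE = "\<lambda>p. B (snd p) h h \<bullet> (\<Gamma>i *v eps p)"
  let ?SE = "\<lambda>p. (incr h p - J (snd p) h - B (snd p) h h) \<bullet> (\<Gamma>i *v eps p)"
  have "trace (\<Gamma>i ** (outer (incr h p) (incr h p) - (outer (eps p) (incr h p) + outer (incr h p) (eps p))))
      = (?JJ p + ?DD p) - 2 * (?JE p + ?BE p + ?SE p)" for p
  proof -
    note L = bounded_linear.linear[OF bounded_linear_trace_mul[of \<Gamma>i]]
    have "trace (\<Gamma>i ** (outer (incr h p) (incr h p) - (outer (eps p) (incr h p) + outer (incr h p) (eps p))))
        = incr h p \<bullet> (\<Gamma>i *v incr h p) - (incr h p \<bullet> (\<Gamma>i *v eps p) + eps p \<bullet> (\<Gamma>i *v incr h p))"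
      unfolding linear_diff[OF L] linear_add[OF L] trace_matrix_mul_outer ..
    also have "eps p \<bullet> (\<Gamma>i *v incr h p) = incr h p \<bullet> (\<Gamma>i *v eps p)" by (rule \<Gamma>i_sym)
    finally show ?thesis by (simp add: inner_diff_left)
  qed
  then have "trace (\<Gamma>i ** (emp_cov n (W0 + h) \<omega> - emp_cov n W0 \<omega>))
      = ave n (\<lambda>p. (?JJ p + ?DD p) - 2 * (?JE p + ?BE p + ?SE p)) \<omega>"
    unfolding emp_cov_diff ave_linear[OF bounded_linear.linear[OF bounded_linear_trace_mul]] by simp
  also have "\<dots> = (ave n ?JJ \<omega> + ave n ?DD \<omega>) - 2 * (ave n ?JE \<omega> + ave n ?BE \<omega> + ave n ?SE \<omega>)"
    by (simp only: ave_diff ave_add ave_mult)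
  finally have tr: "trace (\<Gamma>i ** (emp_cov n (W0 + h) \<omega> - emp_cov n W0 \<omega>))
      = (ave n ?JJ \<omega> + ave n ?DD \<omega>) - 2 * (ave n ?JE \<omega> + ave n ?BE \<omega> + ave n ?SE \<omega>)" .
  \<comment> \<open>One root of \<open>n\<close> normalises the score, the other is left as a
    divisor.\<close>
  have sq: "real n = sqrt (real n) * sqrt (real n)" by simp
  have JE: "ave n ?JE \<omega> = (score n \<omega> \<bullet> h) / sqrt (real n)"
    unfolding score_inner ave_def by (subst sq) (simp del: real_sqrt_mult_self)
  have "\<bar>ave n ?JJ \<omega> - h \<bullet> (info *v h)\<bar> \<le> ?s2 * \<kappa> * (norm h)\<^sup>2"
  proof -
    have "ave n ?JJ \<omega> = (\<Sum>k\<in>UNIV. \<Sum>l\<in>UNIV. h $ k * h $ l * ave n (\<lambda>p. J_axis l p \<bullet> (\<Gamma>i *v J_axis k p)) \<omega>)"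
      by (simp only: JJ_axis_expansion ave_sum ave_mult)
    then have "ave n ?JJ \<omega> - h \<bullet> (info *v h)
        = (\<Sum>k\<in>UNIV. \<Sum>l\<in>UNIV. h $ k * h $ l * (ave n (\<lambda>p. J_axis l p \<bullet> (\<Gamma>i *v J_axis k p)) \<omega> - info $ k $ l))"
      unfolding info_form by (simp only: sum_subtractf[symmetric] right_diff_distrib)
    then show ?thesis using quadratic_sum_bound[of _ \<kappa> h, OF JJ] by simp
  qed
  moreover have "\<bar>ave n ?BE \<omega>\<bar> \<le> ?s2 * \<kappa> * (norm h)\<^sup>2"
  proof -
    have "?BE p = (\<Sum>k\<in>UNIV. \<Sum>l\<in>UNIV. h $ k * h $ l * (B (snd p) (axis k 1) (axis l 1) \<bullet> (\<Gamma>i *v eps p)))" for p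
    proof -
      have l1: "linear (\<lambda>x. B (snd p) x h)" and l2: "linear (B (snd p) x)" for x
        using B_bilinear[of "snd p"] by (auto simp: bilinear_def)
      have "B (snd p) h h = (\<Sum>k\<in>UNIV. h $ k *\<^sub>R (\<Sum>l\<in>UNIV. h $ l *\<^sub>R B (snd p) (axis k 1) (axis l 1)))"
        by (subst linear_axis_expansion[OF l1], subst linear_axis_expansion[OF l2, of _ h]) simp
      then show ?thesis by (simp add: inner_sum_left sum_distrib_left mult_ac)
    qed
    then have "ave n ?BE \<omega> = (\<Sum>k\<in>UNIV. \<Sum>l\<in>UNIV. h $ k * h $ l * ave n (\<lambda>p. B (snd p) (axis k 1) (axis l 1) \<bullet> (\<Gamma>i *v eps p)) \<omega>)"
      by (simp only: ave_sum ave_mult)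
    then show ?thesis using quadratic_sum_bound[of _ \<kappa> h, OF BE] by simp
  qed
  moreover have "\<bar>ave n ?SE \<omega>\<bar> \<le> (C * \<gamma> * norm h ^ 3) * ave n wt \<omega>"
  proof (rule abs_ave_le)
    fix p
    have "\<bar>?SE p\<bar> \<le> \<gamma> * (norm (incr h p - J (snd p) h - B (snd p) h h) * norm (eps p))" by (rule \<gamma>(2))
    also have "\<dots> \<le> \<gamma> * ((C * (1 + norm (snd p)) ^ 3 * norm h ^ 3) * (1 + norm (eps p)))"
      using C_ge_1 \<gamma>(1) by (intro mult_left_mono mult_mono incr_bounds h) auto
    also have "\<dots> = (C * \<gamma> * norm h ^ 3) * ((1 + norm (snd p)) ^ 3 * (1 + norm (eps p)) ^ 1)" by simp
    also have "\<dots> \<le> (C * \<gamma> * norm h ^ 3) * wt p" using C_ge_1 \<gamma>(1) by (intro mult_left_mono weight_le_wt) auto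
    finally show "\<bar>?SE p\<bar> \<le> (C * \<gamma> * norm h ^ 3) * wt p" .
  qed
  moreover have "\<bar>ave n ?DD \<omega>\<bar> \<le> (2 * C\<^sup>2 * \<gamma> * norm h ^ 3) * ave n wt \<omega>"
  proof (rule abs_ave_le)
    fix p
    let ?R = "incr h p - J (snd p) h"
    have eq: "?DD p = ?R \<bullet> (\<Gamma>i *v incr h p) + J (snd p) h \<bullet> (\<Gamma>i *v ?R)"
      by (simp add: inner_diff_left inner_diff_right matrix_vector_mult_diff_distrib)
    have "\<bar>?DD p\<bar> \<le> \<gamma> * (norm ?R * norm (incr h p)) + \<gamma> * (norm (J (snd p) h) * norm ?R)"
      unfolding eq using \<gamma>(2)[of ?R "incr h p"] \<gamma>(2)[of "J (snd p) h" ?R] by linarith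
    also have "\<dots> \<le> \<gamma> * ((C * (1 + norm (snd p))\<^sup>2 * (norm h)\<^sup>2) * (C * (1 + norm (snd p)) * norm h))
        + \<gamma> * ((C * (1 + norm (snd p)) * norm h) * (C * (1 + norm (snd p))\<^sup>2 * (norm h)\<^sup>2))"
      using C_ge_1 \<gamma>(1) by (intro add_mono mult_left_mono mult_mono incr_bounds h J_bound) auto
    also have "\<dots> = (2 * C\<^sup>2 * \<gamma> * norm h ^ 3) * ((1 + norm (snd p)) ^ 3 * (1 + norm (eps p)) ^ 0)"
      by (simp add: power2_eq_square power3_eq_cube)
    also have "\<dots> \<le> (2 * C\<^sup>2 * \<gamma> * norm h ^ 3) * wt p" using C_ge_1 \<gamma>(1) by (intro mult_left_mono weight_le_wt) auto
    finally show "\<bar>?DD p\<bar> \<le> (2 * C\<^sup>2 * \<gamma> * norm h ^ 3) * wt p" .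
  qed
  ultimately have "\<bar>trace (\<Gamma>i ** (emp_cov n (W0 + h) \<omega> - emp_cov n W0 \<omega>))
      - (h \<bullet> (info *v h) - 2 * (score n \<omega> \<bullet> h) / sqrt (real n))\<bar>
    \<le> 3 * (?s2 * \<kappa> * (norm h)\<^sup>2) + ((2 * C\<^sup>2 * \<gamma> * norm h ^ 3) * ave n wt \<omega> + 2 * ((C * \<gamma> * norm h ^ 3) * ave n wt \<omega>))"
    unfolding tr JE by (simp add: abs_le_iff)
  then show ?thesis by (simp add: algebra_simps)
qed

end

section \<open>The limit law\<close>

context regression_sample
begin

lemma JJ_borel [measurable]:
  "(\<lambda>p :: (real ^ 'd) \<times> (real ^ 'l). J (snd p) u \<bullet> (\<Gamma>i *v J (snd p) v)) \<in> borel_measurable borel"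
  by (intro borel_measurable_inner borel_measurable_matrix_vector J_snd_borel)

lemma JJ_bound:
  assumes \<gamma>: "0 \<le> \<gamma>" "\<And>x y. \<bar>x \<bullet> (\<Gamma>i *v y)\<bar> \<le> \<gamma> * (norm x * norm y)"
  shows "\<bar>J (snd p) u \<bullet> (\<Gamma>i *v J (snd p) v)\<bar> \<le> \<gamma> * C\<^sup>2 * norm u * norm v * wt p"
proof -
  have "\<bar>J (snd p) u \<bullet> (\<Gamma>i *v J (snd p) v)\<bar> \<le> \<gamma> * (norm (J (snd p) u) * norm (J (snd p) v))" by (rule \<gamma>(2))
  also have "\<dots> \<le> \<gamma> * ((C * (1 + norm (snd p)) * norm u) * (C * (1 + norm (snd p)) * norm v))"
    using C_ge_1 \<gamma>(1) by (intro mult_left_mono mult_mono J_bound) auto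
  also have "\<dots> = \<gamma> * C\<^sup>2 * norm u * norm v * ((1 + norm (snd p))\<^sup>2 * (1 + norm (eps p)) ^ 0)"
    by (simp add: power2_eq_square)
  also have "\<dots> \<le> \<gamma> * C\<^sup>2 * norm u * norm v * wt p"
    using \<gamma>(1) by (intro mult_left_mono weight_le_wt) auto
  finally show ?thesis .
qed

lemma JJ_integrable: "integrable M (\<lambda>\<omega>. J (snd (X 0 \<omega>)) u \<bullet> (\<Gamma>i *v J (snd (X 0 \<omega>)) v))"
proof -
  obtain \<gamma> where "0 \<le> \<gamma>" "\<And>x y. \<bar>x \<bullet> (\<Gamma>i *v y)\<bar> \<le> \<gamma> * (norm x * norm y)" using inverse_form_bound by blast
  then show ?thesis
    by (intro dominated_integrable[OF JJ_borel, of _ _ "\<gamma> * C\<^sup>2 * norm u * norm v"]) (simp add: JJ_bound)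
qed

lemma linear_eps_mean:
  fixes w :: "real ^ 'l \<Rightarrow> real ^ 'd"
  assumes [measurable]: "w \<in> borel_measurable borel" and int: "\<And>a. integrable M (\<lambda>\<omega>. w (snd (X 0 \<omega>)) $ a)"
    and dom: "\<And>p. norm (w (snd p)) * norm (eps p) \<le> c * wt p"
  shows "expectation (\<lambda>\<omega>. w (snd (X 0 \<omega>)) \<bullet> eps (X 0 \<omega>)) = 0"
proof -
  have wp [measurable]: "(\<lambda>p. w (snd p)) \<in> borel_measurable (borel :: ((real ^ 'd) \<times> (real ^ 'l)) measure)"
    by (rule measurable_compose[OF snd_borel]) simp
  have i: "integrable M (\<lambda>\<omega>. eps (X 0 \<omega>) $ a * w (snd (X 0 \<omega>)) $ a)" for a
  proof (rule dominated_integrable[of "\<lambda>p. eps p $ a * w (snd p) $ a" c])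
    fix p :: "(real ^ 'd) \<times> (real ^ 'l)"
    have "\<bar>eps p $ a * w (snd p) $ a\<bar> \<le> norm (eps p) * norm (w (snd p))"
      unfolding abs_mult by (intro mult_mono component_le_norm_cart) auto
    then show "norm (eps p $ a * w (snd p) $ a) \<le> c * wt p" using dom[of p] by (simp add: mult.commute)
  qed (rule borel_measurable_times measurable_compose[OF eps_borel vec_nth_borel] measurable_compose[OF wp vec_nth_borel])+
  have "w (snd p) \<bullet> eps p = (\<Sum>a\<in>UNIV. eps p $ a * w (snd p) $ a)" for p
    by (simp add: inner_vec_def mult.commute)
  then have "expectation (\<lambda>\<omega>. w (snd (X 0 \<omega>)) \<bullet> eps (X 0 \<omega>)) = (\<Sum>a\<in>UNIV. expectation (\<lambda>\<omega>. eps (X 0 \<omega>) $ a * w (snd (X 0 \<omega>)) $ a))"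
    using i by (simp add: Bochner_Integration.integral_sum)
  also have "\<dots> = 0"
    using expectation_eps_mult(1)[OF measurable_compose[OF assms(1) vec_nth_borel] int] by simp
  finally show ?thesis .
qed

lemma whp_JJ:
  assumes "0 < \<kappa>"
  shows "whp M (\<lambda>n \<omega>. \<forall>k\<in>UNIV. \<forall>l\<in>UNIV. \<bar>ave n (\<lambda>p. J_axis l p \<bullet> (\<Gamma>i *v J_axis k p)) \<omega> - info $ k $ l\<bar> \<le> \<kappa>)"
proof (intro whp_ball finite)
  fix k l
  obtain \<gamma> where \<gamma>: "0 \<le> \<gamma>" "\<And>x y. \<bar>x \<bullet> (\<Gamma>i *v y)\<bar> \<le> \<gamma> * (norm x * norm y)" using inverse_form_bound by blast
  have "info $ k $ l = expectation (\<lambda>\<omega>. J_axis l (X 0 \<omega>) \<bullet> (\<Gamma>i *v J_axis k (X 0 \<omega>)))" by (simp add: info_def)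
  then show "whp M (\<lambda>n \<omega>. \<bar>ave n (\<lambda>p. J_axis l p \<bullet> (\<Gamma>i *v J_axis k p)) \<omega> - info $ k $ l\<bar> \<le> \<kappa>)"
    by (simp only:) (rule whp_ave[OF JJ_borel JJ_bound[OF \<gamma>] assms])
qed

text \<open>The noise is centered and independent of the input, so the second derivative of the
  network, which meets it linearly, averages out.\<close>

lemma whp_BE:
  assumes "0 < \<kappa>"
  shows "whp M (\<lambda>n \<omega>. \<forall>k\<in>UNIV. \<forall>l\<in>UNIV. \<bar>ave n (\<lambda>p. B (snd p) (axis k 1) (axis l 1) \<bullet> (\<Gamma>i *v eps p)) \<omega>\<bar> \<le> \<kappa>)"
proof (intro whp_ball finite)
  fix k l
  obtain \<gamma> where \<gamma>: "0 \<le> \<gamma>" "\<And>x. norm (\<Gamma>i *v x) \<le> \<gamma> * norm x" "\<And>x y. \<bar>x \<bullet> (\<Gamma>i *v y)\<bar> \<le> \<gamma> * (norm x * norm y)"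
    using inverse_form_bound by blast
  let ?b = "\<lambda>z. B z (axis k 1) (axis l 1)"
  have b: "norm (?b z) \<le> C * (1 + norm z)\<^sup>2" for z
    using B_bound[of z "axis k 1" "axis l 1"] by (simp add: axis_norm)
  have bound: "norm (\<Gamma>i *v ?b (snd p)) * norm (eps p) \<le> \<gamma> * C * wt p" for p
  proof -
    have "norm (\<Gamma>i *v ?b (snd p)) * norm (eps p) \<le> (\<gamma> * (C * (1 + norm (snd p))\<^sup>2)) * (1 + norm (eps p))"
      using \<gamma>(1) C_ge_1
      by (intro mult_mono order_trans[OF \<gamma>(2)] mult_left_mono b) auto
    also have "\<dots> = \<gamma> * C * ((1 + norm (snd p))\<^sup>2 * (1 + norm (eps p)) ^ 1)" by simp
    also have "\<dots> \<le> \<gamma> * C * wt p" using \<gamma>(1) C_ge_1 by (intro mult_left_mono weight_le_wt) auto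
    finally show ?thesis .
  qed
  have bm [measurable]: "?b \<in> borel_measurable borel" by (rule B_measurable)
  have gm: "(\<lambda>z. \<Gamma>i *v ?b z) \<in> borel_measurable borel" by (intro borel_measurable_matrix_vector bm)
  have int: "integrable M (\<lambda>\<omega>. (\<Gamma>i *v ?b (snd (X 0 \<omega>))) $ a)" for a
  proof (rule dominated_integrable[of "\<lambda>p. (\<Gamma>i *v ?b (snd p)) $ a" "\<gamma> * C"])
    fix p :: "(real ^ 'd) \<times> (real ^ 'l)"
    have "\<bar>(\<Gamma>i *v ?b (snd p)) $ a\<bar> \<le> \<gamma> * (C * (1 + norm (snd p))\<^sup>2)"
      by (intro order_trans[OF component_le_norm_cart] order_trans[OF \<gamma>(2)] mult_left_mono b \<gamma>(1))
    also have "\<dots> = \<gamma> * C * ((1 + norm (snd p))\<^sup>2 * (1 + norm (eps p)) ^ 0)" by simp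
    also have "\<dots> \<le> \<gamma> * C * wt p" using \<gamma>(1) C_ge_1 by (intro mult_left_mono weight_le_wt) auto
    finally show "norm ((\<Gamma>i *v ?b (snd p)) $ a) \<le> \<gamma> * C * wt p" by simp
  qed (rule measurable_compose[OF measurable_compose[OF snd_borel gm] vec_nth_borel])
  have eq: "?b (snd p) \<bullet> (\<Gamma>i *v eps p) = (\<Gamma>i *v ?b (snd p)) \<bullet> eps p" for p
    by (simp only: \<Gamma>i_sym[of "?b (snd p)"]) (rule inner_commute)
  have "expectation (\<lambda>\<omega>. ?b (snd (X 0 \<omega>)) \<bullet> (\<Gamma>i *v eps (X 0 \<omega>))) = 0"
    unfolding eq by (rule linear_eps_mean[OF gm int bound])
  moreover have "whp M (\<lambda>n \<omega>. \<bar>ave n (\<lambda>p. ?b (snd p) \<bullet> (\<Gamma>i *v eps p)) \<omega>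
      - expectation (\<lambda>\<omega>. ?b (snd (X 0 \<omega>)) \<bullet> (\<Gamma>i *v eps (X 0 \<omega>)))\<bar> \<le> \<kappa>)"
  proof (rule whp_ave[OF _ _ assms])
    show "(\<lambda>p. ?b (snd p) \<bullet> (\<Gamma>i *v eps p)) \<in> borel_measurable borel"
      by (intro borel_measurable_inner borel_measurable_matrix_vector eps_borel B_snd_borel)
    show "\<bar>?b (snd p) \<bullet> (\<Gamma>i *v eps p)\<bar> \<le> \<gamma> * C * wt p" for p
      unfolding eq using Cauchy_Schwarz_ineq2[of "\<Gamma>i *v ?b (snd p)" "eps p"] bound[of p] by linarith
  qed
  ultimately show "whp M (\<lambda>n \<omega>. \<bar>ave n (\<lambda>p. ?b (snd p) \<bullet> (\<Gamma>i *v eps p)) \<omega>\<bar> \<le> \<kappa>)" by simp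
qed

text \<open>The strict derivative replaces the logarithm by a trace, with an error small relative to
  the change of the covariance, itself bounded by a multiple of
  \<open>(norm h)\<^sup>2 + norm h / sqrt n\<close>. The event is chosen before \<open>h\<close>,
  which makes the expansion uniform over the ball.\<close>

lemma local_expansion:
  assumes "0 < \<rho>"
  shows "\<exists>\<delta>>0. whp M (\<lambda>n \<omega>. noise_size n \<omega> \<le> K \<longrightarrow> (\<forall>h. norm h \<le> \<delta> \<longrightarrow>
    \<bar>ln (det (emp_cov n (W0 + h) \<omega>)) - ln (det (emp_cov n W0 \<omega>))
      - (h \<bullet> (info *v h) - 2 * (score n \<omega> \<bullet> h) / sqrt (real n))\<bar>
    \<le> \<rho> * ((norm h)\<^sup>2 + norm h / sqrt (real n))))"
proof -
  obtain \<gamma> where \<gamma>: "0 \<le> \<gamma>" "\<And>x y. \<bar>x \<bullet> (\<Gamma>i *v y)\<bar> \<le> \<gamma> * (norm x * norm y)" using inverse_form_bound by blast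
  define m where "m = mean_wt + 1"
  define K' where "K' = max K 0"
  define Q where "Q = (C\<^sup>2 + 2 * C) * m"
  define P where "P = (2 * C\<^sup>2 + 2 * C) * \<gamma> * m"
  \<comment> \<open>The coefficient \<rho> of the squared norm is spent in thirds: \<eta> pays for
    the strict derivative, \<kappa> for the averages, \<delta> for the cubic remainder. In front of
    \<open>norm h / sqrt n\<close> the whole of \<rho> is available to \<eta>.\<close>
  define \<eta> where "\<eta> = \<rho> / (3 * Q + 2 * K' + 1)"
  let ?s2 = "(real CARD('w))\<^sup>2"
  define \<kappa> where "\<kappa> = \<rho> / (9 * ?s2)"
  have m: "m \<ge> 1" using mean_wt_nonneg by (simp add: m_def)
  have nn: "0 \<le> Q" "0 \<le> P" "0 \<le> K'" using m C_ge_1 \<gamma>(1) by (auto simp: Q_def P_def K'_def)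
  then have den: "0 < 3 * Q + 2 * K' + 1" by linarith
  have \<eta>: "0 < \<eta>" using assms den by (simp add: \<eta>_def)
  have \<eta>_eq: "\<eta> * (3 * Q + 2 * K' + 1) = \<rho>" using den by (simp add: \<eta>_def)
  have "0 \<le> \<eta> * Q" "0 \<le> \<eta> * K'" using \<eta> nn by auto
  then have \<eta>Q: "\<eta> * Q \<le> \<rho> / 3" "\<eta> * (2 * K') \<le> \<rho>" using \<eta>_eq \<eta> by (auto simp: algebra_simps)
  have \<kappa>: "0 < \<kappa>" "3 * ?s2 * \<kappa> = \<rho> / 3" using assms by (auto simp: \<kappa>_def)
  obtain d where d: "0 < d" "\<And>A B. A \<in> ball \<Gamma> d \<Longrightarrow> B \<in> ball \<Gamma> d \<Longrightarrow>
      \<bar>ln (det A) - ln (det B) - trace (\<Gamma>i ** (A - B))\<bar> \<le> \<eta> * norm (A - B)"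
    using ln_det_strict_derivative[OF pos_def_det_pos[OF \<Gamma>_pos_def] \<eta>] by blast
  \<comment> \<open>The bound 1 admits the Taylor estimates. The last bound keeps the change of the
    covariance below \<open>d / 2\<close>, so that with an error of at most \<open>d / 4\<close> at
    \<open>W0\<close> both matrices stay in the ball where the strict derivative is valid.\<close>
  define \<delta> where "\<delta> = min 1 (min (\<rho> / (3 * P + 1)) (d / (2 * (Q + 2 * K') + 2)))"
  have \<delta>1: "\<delta> \<le> \<rho> / (3 * P + 1)" "\<delta> \<le> d / (2 * (Q + 2 * K') + 2)" by (auto simp: \<delta>_def)
  have \<delta>: "0 < \<delta>" "\<delta> \<le> 1" using assms nn d(1) by (auto simp: \<delta>_def intro!: divide_pos_pos)
  have \<delta>P: "P * \<delta> \<le> \<rho> / 3"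
    using \<delta>1(1) nn(2) \<delta>(1) by (simp add: pos_le_divide_eq algebra_simps)
  have \<delta>Q: "(Q + 2 * K') * \<delta> < d / 2"
    using \<delta>1(2) nn(1,3) \<delta>(1) by (simp add: pos_le_divide_eq algebra_simps)
  have "whp M (\<lambda>n \<omega>. (ave n wt \<omega> \<le> m \<and> norm (emp_cov n W0 \<omega> - \<Gamma>) \<le> d / 4) \<and>
      (\<forall>k\<in>UNIV. \<forall>l\<in>UNIV. \<bar>ave n (\<lambda>p. J_axis l p \<bullet> (\<Gamma>i *v J_axis k p)) \<omega> - info $ k $ l\<bar> \<le> \<kappa>) \<and>
      (\<forall>k\<in>UNIV. \<forall>l\<in>UNIV. \<bar>ave n (\<lambda>p. B (snd p) (axis k 1) (axis l 1) \<bullet> (\<Gamma>i *v eps p)) \<omega>\<bar> \<le> \<kappa>))"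
  proof (intro whp_conj whp_JJ whp_BE \<kappa>(1))
    show "whp M (\<lambda>n \<omega>. ave n wt \<omega> \<le> m)" using whp_wt by (simp add: m_def mean_wt_def)
    show "whp M (\<lambda>n \<omega>. norm (emp_cov n W0 \<omega> - \<Gamma>) \<le> d / 4)"
      unfolding emp_cov_def lim_cov_W0[symmetric] lim_cov_def
      by (rule whp_ave_matrix[OF outer_res_borel outer_res_bound[OF W0_in]]) (use d(1) in auto)
  qed
  then have "whp M (\<lambda>n \<omega>. noise_size n \<omega> \<le> K \<longrightarrow> (\<forall>h. norm h \<le> \<delta> \<longrightarrow>
    \<bar>ln (det (emp_cov n (W0 + h) \<omega>)) - ln (det (emp_cov n W0 \<omega>))
      - (h \<bullet> (info *v h) - 2 * (score n \<omega> \<bullet> h) / sqrt (real n))\<bar>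
    \<le> \<rho> * ((norm h)\<^sup>2 + norm h / sqrt (real n))))"
  proof (rule whp_mono[where N = 1], intro allI impI)
    fix n \<omega> and h :: "real ^ 'w"
    assume n: "1 \<le> n" and ev: "(ave n wt \<omega> \<le> m \<and> norm (emp_cov n W0 \<omega> - \<Gamma>) \<le> d / 4) \<and>
      (\<forall>k\<in>UNIV. \<forall>l\<in>UNIV. \<bar>ave n (\<lambda>p. J_axis l p \<bullet> (\<Gamma>i *v J_axis k p)) \<omega> - info $ k $ l\<bar> \<le> \<kappa>) \<and>
      (\<forall>k\<in>UNIV. \<forall>l\<in>UNIV. \<bar>ave n (\<lambda>p. B (snd p) (axis k 1) (axis l 1) \<bullet> (\<Gamma>i *v eps p)) \<omega>\<bar> \<le> \<kappa>)"
      and K: "noise_size n \<omega> \<le> K" and h: "norm h \<le> \<delta>"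
    have h1: "norm h \<le> 1" using h \<delta>(2) by linarith
    let ?q = "norm h / sqrt (real n)"
    let ?\<Delta> = "emp_cov n (W0 + h) \<omega> - emp_cov n W0 \<omega>"
    have q: "0 \<le> ?q" "?q \<le> norm h" using n by (auto simp: divide_le_eq mult_le_cancel_left1)
    have \<Delta>: "norm ?\<Delta> \<le> Q * (norm h)\<^sup>2 + 2 * K' * ?q"
    proof (rule order_trans[OF emp_cov_diff_norm[OF h1]], rule add_mono)
      show "(C\<^sup>2 + 2 * C) * ave n wt \<omega> * (norm h)\<^sup>2 \<le> Q * (norm h)\<^sup>2"
        unfolding Q_def using ev C_ge_1 by (intro mult_right_mono mult_left_mono) auto
      show "2 * noise_size n \<omega> * ?q \<le> 2 * K' * ?q"
        using K q(1) by (intro mult_right_mono) (auto simp: K'_def)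
    qed
    also have "\<dots> \<le> Q * norm h + 2 * K' * norm h"
      using nn q h1 by (intro add_mono mult_left_mono) (auto simp: power2_eq_square mult_left_le)
    also have "\<dots> = (Q + 2 * K') * norm h" by (simp add: algebra_simps)
    also have "\<dots> \<le> (Q + 2 * K') * \<delta>" using nn h by (intro mult_left_mono) auto
    finally have \<Delta>d: "norm ?\<Delta> < d / 2" using \<delta>Q by linarith
    have c0: "norm (emp_cov n W0 \<omega> - \<Gamma>) \<le> d / 4" using ev by blast
    have b0: "emp_cov n W0 \<omega> \<in> ball \<Gamma> d" using c0 d(1) by (simp add: dist_norm norm_minus_commute)
    have "norm (emp_cov n (W0 + h) \<omega> - \<Gamma>) \<le> norm ?\<Delta> + norm (emp_cov n W0 \<omega> - \<Gamma>)"
      using norm_triangle_ineq[of ?\<Delta> "emp_cov n W0 \<omega> - \<Gamma>"] by simp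
    then have b1: "emp_cov n (W0 + h) \<omega> \<in> ball \<Gamma> d" using \<Delta>d c0 d(1) by (simp add: dist_norm norm_minus_commute)
    let ?L = "ln (det (emp_cov n (W0 + h) \<omega>)) - ln (det (emp_cov n W0 \<omega>))"
    let ?T = "trace (\<Gamma>i ** ?\<Delta>)"
    let ?q2 = "h \<bullet> (info *v h) - 2 * (score n \<omega> \<bullet> h) / sqrt (real n)"
    have "\<bar>?L - ?T\<bar> \<le> \<eta> * norm ?\<Delta>" using d(2)[OF b1 b0] .
    also have "\<dots> \<le> \<eta> * (Q * (norm h)\<^sup>2 + 2 * K' * ?q)" using \<Delta> \<eta> by (intro mult_left_mono) auto
    also have "\<dots> = \<eta> * Q * (norm h)\<^sup>2 + \<eta> * (2 * K') * ?q" by (simp add: algebra_simps)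
    also have "\<dots> \<le> \<rho> / 3 * (norm h)\<^sup>2 + \<rho> * ?q" using \<eta>Q q by (intro add_mono mult_right_mono) auto
    finally have 1: "\<bar>?L - ?T\<bar> \<le> \<rho> / 3 * (norm h)\<^sup>2 + \<rho> * ?q" .
    have "\<bar>?T - ?q2\<bar> \<le> 3 * ?s2 * \<kappa> * (norm h)\<^sup>2 + (2 * C\<^sup>2 + 2 * C) * \<gamma> * ave n wt \<omega> * norm h ^ 3"
      using ev by (intro trace_diff_expansion h1 n \<gamma>) auto
    also have "\<dots> \<le> \<rho> / 3 * (norm h)\<^sup>2 + \<rho> / 3 * (norm h)\<^sup>2"
    proof (rule add_mono)
      show "3 * ?s2 * \<kappa> * (norm h)\<^sup>2 \<le> \<rho> / 3 * (norm h)\<^sup>2" by (simp only: \<kappa>(2))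
      have "(2 * C\<^sup>2 + 2 * C) * \<gamma> * ave n wt \<omega> * norm h ^ 3 \<le> P * norm h ^ 3"
        unfolding P_def using ev C_ge_1 \<gamma>(1) by (intro mult_right_mono mult_left_mono) auto
      also have "\<dots> = P * norm h * (norm h)\<^sup>2" by (simp add: power2_eq_square power3_eq_cube)
      also have "\<dots> \<le> P * \<delta> * (norm h)\<^sup>2" using nn h by (intro mult_right_mono mult_left_mono) auto
      also have "\<dots> \<le> \<rho> / 3 * (norm h)\<^sup>2" using \<delta>P by (intro mult_right_mono) auto
      finally show "(2 * C\<^sup>2 + 2 * C) * \<gamma> * ave n wt \<omega> * norm h ^ 3 \<le> \<rho> / 3 * (norm h)\<^sup>2" .
    qed
    finally have "\<bar>?L - ?q2\<bar> \<le> \<rho> / 3 * (norm h)\<^sup>2 + \<rho> * ?q + (\<rho> / 3 * (norm h)\<^sup>2 + \<rho> / 3 * (norm h)\<^sup>2)"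
      using 1 by linarith
    then show "\<bar>?L - ?q2\<bar> \<le> \<rho> * ((norm h)\<^sup>2 + norm h / sqrt (real n))" by (simp add: algebra_simps)
  qed
  with \<delta>(1) show ?thesis by blast
qed

lemma info_sym: "x \<bullet> (info *v y) = y \<bullet> (info *v x)"
proof -
  have "info $ k $ l = info $ l $ k" for k l
    unfolding info_def by (simp add: \<Gamma>i_sym[of "J_axis l _"])
  then have "x \<bullet> (info *v y) = (\<Sum>k\<in>UNIV. \<Sum>l\<in>UNIV. y $ l * x $ k * info $ l $ k)"
    unfolding info_form by (intro sum.cong refl) (metis mult.commute)
  also have "\<dots> = (\<Sum>l\<in>UNIV. \<Sum>k\<in>UNIV. y $ l * x $ k * info $ l $ k)" by (rule sum.swap)
  also have "\<dots> = y \<bullet> (info *v x)" by (simp only: info_form)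
  finally show ?thesis .
qed

lemma info_expectation: "v \<bullet> (info *v v) = expectation (\<lambda>\<omega>. J (snd (X 0 \<omega>)) v \<bullet> (\<Gamma>i *v J (snd (X 0 \<omega>)) v))"
proof -
  have "expectation (\<lambda>\<omega>. J (snd (X 0 \<omega>)) v \<bullet> (\<Gamma>i *v J (snd (X 0 \<omega>)) v))
      = (\<Sum>k\<in>UNIV. \<Sum>l\<in>UNIV. v $ k * v $ l * expectation (\<lambda>\<omega>. J_axis l (X 0 \<omega>) \<bullet> (\<Gamma>i *v J_axis k (X 0 \<omega>))))"
    unfolding JJ_axis_expansion
    using JJ_integrable by (simp add: Bochner_Integration.integral_sum Bochner_Integration.integrable_sum)
  then show ?thesis unfolding info_form by (simp add: info_def)
qed

text \<open>In the direction \<open>v\<close> the score is a normalised sum of scalars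
  \<open>w \<bullet> eps\<close>, where \<open>w = \<Gamma>i *v J z v\<close> is a function of the
  input. By independence their variance is the mean of \<open>w \<bullet> (\<Gamma> *v w)\<close>,
  and one \<Gamma> cancels against the inverse, leaving the information form. Treating all
  directions in this way replaces a multivariate central limit theorem.\<close>

lemma score_char:
  "(\<lambda>n. CLINT \<omega>|M. iexp (score n \<omega> \<bullet> v)) \<longlonglongrightarrow> complex_of_real (exp (- (v \<bullet> (info *v v)) / 2))"
proof -
  obtain \<gamma> where \<gamma>: "0 \<le> \<gamma>" "\<And>x. norm (\<Gamma>i *v x) \<le> \<gamma> * norm x" "\<And>x y. \<bar>x \<bullet> (\<Gamma>i *v y)\<bar> \<le> \<gamma> * (norm x * norm y)"
    using inverse_form_bound by blast
  define w where "w z = \<Gamma>i *v J z v" for z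
  define \<xi> where "\<xi> p = w (snd p) \<bullet> eps p" for p
  have wm: "w \<in> borel_measurable borel" unfolding w_def[abs_def] by (intro borel_measurable_matrix_vector J_measurable)
  have wsm [measurable]: "(\<lambda>p. w (snd p)) \<in> borel_measurable (borel :: ((real ^ 'd) \<times> (real ^ 'l)) measure)"
    by (rule measurable_compose[OF snd_borel wm])
  have \<xi>m [measurable]: "\<xi> \<in> borel_measurable borel"
    unfolding \<xi>_def[abs_def] by (intro borel_measurable_inner wsm eps_borel)
  have \<xi>_eq: "J (snd p) v \<bullet> (\<Gamma>i *v eps p) = \<xi> p" for p
    unfolding \<xi>_def w_def by (simp only: \<Gamma>i_sym[of "J (snd p) v"]) (rule inner_commute)
  define c where "c = \<gamma> * C * norm v"
  have c: "0 \<le> c" using \<gamma>(1) C_ge_1 by (simp add: c_def)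
  have wb: "norm (w z) \<le> c * (1 + norm z)" for z
  proof -
    have "norm (w z) \<le> \<gamma> * (C * (1 + norm z) * norm v)"
      unfolding w_def by (intro order_trans[OF \<gamma>(2)] mult_left_mono J_bound \<gamma>(1))
    then show ?thesis by (simp add: c_def mult_ac)
  qed
  have we: "norm (w (snd p)) * norm (eps p) \<le> c * ((1 + norm (snd p)) * (1 + norm (eps p)))" for p
  proof -
    have "norm (w (snd p)) * norm (eps p) \<le> (c * (1 + norm (snd p))) * (1 + norm (eps p))"
      using c by (intro mult_mono wb) auto
    then show ?thesis by (simp add: mult_ac)
  qed
  have dom: "norm (w (snd p)) * norm (eps p) \<le> c * wt p" for p
    using we[of p] mult_left_mono[OF weight_le_wt[of 1 1 p] c] by simp
  have w_int: "integrable M (\<lambda>\<omega>. w (snd (X 0 \<omega>)) $ a)" for a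
  proof (rule dominated_integrable[of "\<lambda>p. w (snd p) $ a" c])
    show "norm (w (snd p) $ a) \<le> c * wt p" for p
      using component_le_norm_cart[of "w (snd p)" a] wb[of "snd p"] mult_left_mono[OF weight_le_wt[of 1 0 p] c] by simp
  qed (rule measurable_compose[OF wsm vec_nth_borel])
  have ww: "\<bar>w (snd p) $ a * w (snd p) $ b\<bar> \<le> c\<^sup>2 * (1 + norm (snd p))\<^sup>2" for p a b
  proof -
    have "\<bar>w (snd p) $ a * w (snd p) $ b\<bar> \<le> (c * (1 + norm (snd p))) * (c * (1 + norm (snd p)))"
      unfolding abs_mult using c by (intro mult_mono order_trans[OF component_le_norm_cart wb]) auto
    then show ?thesis by (simp add: power2_eq_square mult_ac)
  qed
  have ww_int: "integrable M (\<lambda>\<omega>. w (snd (X 0 \<omega>)) $ a * w (snd (X 0 \<omega>)) $ b)" for a b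
  proof (rule dominated_integrable[of "\<lambda>p. w (snd p) $ a * w (snd p) $ b" "c\<^sup>2"])
    show "norm (w (snd p) $ a * w (snd p) $ b) \<le> c\<^sup>2 * wt p" for p
      using ww[of p a b] mult_left_mono[OF weight_le_wt[of 2 0 p], of "c\<^sup>2"] by simp
  qed (intro borel_measurable_times measurable_compose[OF wsm vec_nth_borel])
  have \<xi>2: "(\<xi> p)\<^sup>2 \<le> c\<^sup>2 * wt p" for p
  proof -
    have "\<bar>\<xi> p\<bar> \<le> c * ((1 + norm (snd p)) * (1 + norm (eps p)))"
      unfolding \<xi>_def using Cauchy_Schwarz_ineq2[of "w (snd p)" "eps p"] we[of p] by linarith
    then have "\<bar>\<xi> p\<bar>\<^sup>2 \<le> (c * ((1 + norm (snd p)) * (1 + norm (eps p))))\<^sup>2" by (rule power_mono) simp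
    also have "\<dots> = c\<^sup>2 * ((1 + norm (snd p))\<^sup>2 * (1 + norm (eps p))\<^sup>2)" by (simp add: power_mult_distrib)
    also have "\<dots> \<le> c\<^sup>2 * wt p" by (intro mult_left_mono weight_le_wt) auto
    finally show ?thesis by simp
  qed
  have sq: "integrable M (\<lambda>\<omega>. (\<xi> (X 0 \<omega>))\<^sup>2)"
    by (rule dominated_integrable[of "\<lambda>p. (\<xi> p)\<^sup>2" "c\<^sup>2"]) (use \<xi>2 in auto)
  have mean: "expectation (\<lambda>\<omega>. \<xi> (X 0 \<omega>)) = 0"
    unfolding \<xi>_def by (rule linear_eps_mean[OF wm w_int dom])
  have "expectation (\<lambda>\<omega>. (\<xi> (X 0 \<omega>))\<^sup>2) = v \<bullet> (info *v v)"
  proof -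
    let ?t = "\<lambda>a b p. eps p $ a * eps p $ b * (w (snd p) $ a * w (snd p) $ b)"
    have "(\<xi> p)\<^sup>2 = (\<Sum>a\<in>UNIV. \<Sum>b\<in>UNIV. ?t a b p)" for p
      unfolding \<xi>_def inner_vec_def power2_eq_square sum_product by (intro sum.cong refl) (simp add: mult_ac)
    moreover have t_int: "integrable M (\<lambda>\<omega>. ?t a b (X 0 \<omega>))" for a b
    proof (rule dominated_integrable[of "?t a b" "c\<^sup>2"])
      fix p :: "(real ^ 'd) \<times> (real ^ 'l)"
      have "\<bar>?t a b p\<bar> \<le> ((1 + norm (eps p)) * (1 + norm (eps p))) * (c\<^sup>2 * (1 + norm (snd p))\<^sup>2)"
        unfolding abs_mult[of "_ * _" "_ * _"] abs_mult[of "eps p $ a"]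
        by (intro mult_mono ww order_trans[OF component_le_norm_cart]) auto
      also have "\<dots> = c\<^sup>2 * ((1 + norm (snd p))\<^sup>2 * (1 + norm (eps p))\<^sup>2)" by (simp add: power2_eq_square)
      also have "\<dots> \<le> c\<^sup>2 * wt p" by (intro mult_left_mono weight_le_wt) auto
      finally show "norm (?t a b p) \<le> c\<^sup>2 * wt p" by simp
    qed (intro borel_measurable_times measurable_compose[OF wsm vec_nth_borel] measurable_compose[OF eps_borel vec_nth_borel])
    ultimately have "expectation (\<lambda>\<omega>. (\<xi> (X 0 \<omega>))\<^sup>2) = (\<Sum>a\<in>UNIV. \<Sum>b\<in>UNIV. expectation (\<lambda>\<omega>. ?t a b (X 0 \<omega>)))"
      by (simp add: Bochner_Integration.integral_sum Bochner_Integration.integrable_sum)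
    also have "\<dots> = (\<Sum>a\<in>UNIV. \<Sum>b\<in>UNIV. \<Gamma> $ a $ b * expectation (\<lambda>\<omega>. w (snd (X 0 \<omega>)) $ a * w (snd (X 0 \<omega>)) $ b))"
    proof (intro sum.cong refl)
      fix a b
      show "expectation (\<lambda>\<omega>. ?t a b (X 0 \<omega>)) = \<Gamma> $ a $ b * expectation (\<lambda>\<omega>. w (snd (X 0 \<omega>)) $ a * w (snd (X 0 \<omega>)) $ b)"
        by (rule expectation_eps_mult(2)[of "\<lambda>z. w z $ a * w z $ b", OF _ ww_int])
           (intro borel_measurable_times measurable_compose[OF wm vec_nth_borel])
    qed
    also have "\<dots> = expectation (\<lambda>\<omega>. \<Sum>a\<in>UNIV. \<Sum>b\<in>UNIV. \<Gamma> $ a $ b * (w (snd (X 0 \<omega>)) $ a * w (snd (X 0 \<omega>)) $ b))"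
      using ww_int by (simp add: Bochner_Integration.integral_sum Bochner_Integration.integrable_sum)
    also have "\<dots> = expectation (\<lambda>\<omega>. J (snd (X 0 \<omega>)) v \<bullet> (\<Gamma>i *v J (snd (X 0 \<omega>)) v))"
    proof (rule Bochner_Integration.integral_cong[OF refl])
      fix \<omega>
      let ?z = "snd (X 0 \<omega>)"
      have "(\<Sum>a\<in>UNIV. \<Sum>b\<in>UNIV. \<Gamma> $ a $ b * (w ?z $ a * w ?z $ b)) = w ?z \<bullet> (\<Gamma> *v w ?z)"
        by (simp add: inner_vec_def matrix_vector_mult_def sum_distrib_left mult_ac)
      also have "\<Gamma> *v w ?z = J ?z v"
        using matrix_inv_left_right(1)[OF cov_invertible] by (simp add: w_def matrix_vector_mul_assoc)
      finally show "(\<Sum>a\<in>UNIV. \<Sum>b\<in>UNIV. \<Gamma> $ a $ b * (w ?z $ a * w ?z $ b)) = J ?z v \<bullet> (\<Gamma>i *v J ?z v)"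
        by (simp add: w_def inner_commute)
    qed
    finally show ?thesis by (simp only: info_expectation)
  qed
  moreover have "score n \<omega> \<bullet> v = (\<Sum>t = 1..n. \<xi> (X t \<omega>)) / sqrt (real n)" for n \<omega>
    unfolding score_inner \<xi>_eq ..
  ultimately show ?thesis
    using iid_sum_char_tendsto[OF iid_seq_compose[OF iid \<xi>m] sq mean] by simp
qed

lemma score_measurable [measurable]: "(\<lambda>\<omega>. score n \<omega> \<bullet> v) \<in> borel_measurable M"
proof -
  have "(\<lambda>p. J (snd p) v \<bullet> (\<Gamma>i *v eps p)) \<in> borel_measurable borel"
    by (intro borel_measurable_inner borel_measurable_matrix_vector eps_borel J_snd_borel)
  from measurable_compose[OF X_measurable this]
  have [measurable]: "(\<lambda>\<omega>. J (snd (X t \<omega>)) v \<bullet> (\<Gamma>i *v eps (X t \<omega>))) \<in> borel_measurable M" for t .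
  show ?thesis unfolding score_inner by measurable
qed

text \<open>Minimality is asked for on samples where all determinants are positive, an event whose
  probability tends to one; elsewhere the logarithmic cost may be infinite. \<open>V\<close>
  collects the directions available under the null hypothesis, and its codimension \<open>r\<close>
  becomes the number of degrees of freedom.\<close>

theorem likelihood_ratio_limit:
  fixes Ws Wq :: "nat \<Rightarrow> 'a \<Rightarrow> real ^ 'w" and T :: "nat \<Rightarrow> 'a \<Rightarrow> real"
  assumes pd: "pos_def info"
    and \<Theta>q: "\<Theta>q \<subseteq> \<Theta>" "W0 \<in> \<Theta>q" and V: "subspace V" "dim V + r = CARD('w)"
    and \<Theta>qV: "\<And>W. W \<in> \<Theta>q \<Longrightarrow> W - W0 \<in> V"
    and \<delta>0: "0 < \<delta>0" "\<And>h. norm h \<le> \<delta>0 \<Longrightarrow> W0 + h \<in> \<Theta>" "\<And>h. h \<in> V \<Longrightarrow> norm h \<le> \<delta>0 \<Longrightarrow> W0 + h \<in> \<Theta>q"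
    and Ws: "\<And>n \<omega>. n \<ge> 1 \<Longrightarrow> \<omega> \<in> space M \<Longrightarrow> Ws n \<omega> \<in> \<Theta>"
      "\<And>n \<omega> W. n \<ge> 1 \<Longrightarrow> \<omega> \<in> space M \<Longrightarrow> \<forall>W\<in>\<Theta>. 0 < det (emp_cov n W \<omega>) \<Longrightarrow> W \<in> \<Theta> \<Longrightarrow>
        det (emp_cov n (Ws n \<omega>) \<omega>) \<le> det (emp_cov n W \<omega>)"
    and Wq: "\<And>n \<omega>. n \<ge> 1 \<Longrightarrow> \<omega> \<in> space M \<Longrightarrow> Wq n \<omega> \<in> \<Theta>q"
      "\<And>n \<omega> W. n \<ge> 1 \<Longrightarrow> \<omega> \<in> space M \<Longrightarrow> \<forall>W\<in>\<Theta>. 0 < det (emp_cov n W \<omega>) \<Longrightarrow> W \<in> \<Theta>q \<Longrightarrow>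
        det (emp_cov n (Wq n \<omega>) \<omega>) \<le> det (emp_cov n W \<omega>)"
    and T_meas: "\<And>n. T n \<in> borel_measurable M"
    and T: "\<And>n \<omega>. n \<ge> 1 \<Longrightarrow> \<omega> \<in> space M \<Longrightarrow> \<forall>W\<in>\<Theta>. 0 < det (emp_cov n W \<omega>) \<Longrightarrow>
      T n \<omega> = real n * (ln (det (emp_cov n (Wq n \<omega>) \<omega>)) - ln (det (emp_cov n (Ws n \<omega>) \<omega>)))"
  shows "\<And>e. 0 < e \<Longrightarrow> whp M (\<lambda>n \<omega>. \<bar>T n \<omega> - (sqrt (real n) *\<^sub>R (Ws n \<omega> - Wq n \<omega>)) \<bullet>
      (info *v (sqrt (real n) *\<^sub>R (Ws n \<omega> - Wq n \<omega>)))\<bar> \<le> e)"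
    and "weak_conv_m (\<lambda>n. distr M borel (T n)) (chi_square r)"
proof -
  interpret Q: quadratic_form info by (unfold_locales) (rule pd, rule info_sym)
  obtain b :: "nat \<Rightarrow> real ^ 'w" where
      b: "\<And>i j. i < r \<Longrightarrow> j < r \<Longrightarrow> Q.ip (b i) (b j) = (if i = j then 1 else 0)"
      and bV: "\<And>i v. i < r \<Longrightarrow> v \<in> V \<Longrightarrow> Q.ip (b i) v = 0"
      and Vb: "\<And>x. (\<And>i. i < r \<Longrightarrow> Q.ip (b i) x = 0) \<Longrightarrow> x \<in> V"
    using Q.orthonormal_complement[OF V] by blast
  define Xi where "Xi n i \<omega> = score n \<omega> \<bullet> b i" for n i \<omega>
  \<comment> \<open>\<open>us\<close> minimises the limiting quadratic form on the whole space. Its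
    components along the orthonormal basis are the numbers \<open>Xi\<close>; subtracting them gives
    the projection \<open>uq\<close> onto \<open>V\<close>.\<close>
  define us where "us n \<omega> = matrix_inv info *v score n \<omega>" for n \<omega>
  define uq where "uq n \<omega> = us n \<omega> - (\<Sum>i<r. Xi n i \<omega> *\<^sub>R b i)" for n \<omega>
  have us: "info *v us n \<omega> = score n \<omega>" for n \<omega>
    using matrix_inv_left_right(1)[OF pos_def_invertible[OF pd]] by (simp add: us_def matrix_vector_mul_assoc)
  have ipus: "Q.ip v (us n \<omega>) = score n \<omega> \<bullet> v" for v n \<omega> by (simp add: Q.ip_def us inner_commute)
  have sum_b: "(\<Sum>i<r. c i * Q.ip (b j) (b i)) = c j" if "j < r" for c :: "nat \<Rightarrow> real" and j
  proof -
    have "(\<Sum>i<r. c i * Q.ip (b j) (b i)) = (\<Sum>i<r. if j = i then c i else 0)"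
      using b[OF that] by (intro sum.cong) auto
    then show ?thesis using that by simp
  qed
  have sum_b': "(\<Sum>i<r. c i * Q.ip (b i) (b j)) = c j" if "j < r" for c :: "nat \<Rightarrow> real" and j
    using sum_b[OF that, of c] by (simp only: Q.ip_commute[of "b j"])
  have uqV: "uq n \<omega> \<in> V" for n \<omega>
  proof (rule Vb)
    fix j assume j: "j < r"
    show "Q.ip (b j) (uq n \<omega>) = 0"
      using sum_b[OF j, of "\<lambda>i. Xi n i \<omega>"] by (simp add: uq_def ipus) (simp add: Xi_def)
  qed
  have diff: "us n \<omega> - uq n \<omega> = (\<Sum>i<r. Xi n i \<omega> *\<^sub>R b i)" for n \<omega> by (simp add: uq_def)
  have orth: "Q.ip v (us n \<omega> - uq n \<omega>) = 0" if "v \<in> V" for v n \<omega>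
    unfolding diff using bV[OF _ that] Q.ip_commute[of v] by simp
  have nsq_diff: "Q.nsq (us n \<omega> - uq n \<omega>) = (\<Sum>i<r. (Xi n i \<omega>)\<^sup>2)" for n \<omega>
  proof -
    have "Q.nsq (us n \<omega> - uq n \<omega>) = (\<Sum>j<r. Xi n j \<omega> * (\<Sum>i<r. Xi n i \<omega> * Q.ip (b i) (b j)))"
      unfolding diff Q.nsq_def Q.ip_sum(1) Q.ip_linear(5) Q.ip_sum(2) Q.ip_linear(6) ..
    also have "\<dots> = (\<Sum>j<r. Xi n j \<omega> * Xi n j \<omega>)" using sum_b' by (intro sum.cong refl) simp
    finally show ?thesis by (simp add: power2_eq_square)
  qed
  have main: "whp M (\<lambda>n \<omega>. \<bar>T n \<omega> - Q.nsq (sqrt (real n) *\<^sub>R (Ws n \<omega> - Wq n \<omega>))\<bar> \<le> e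
      \<and> \<bar>T n \<omega> - (\<Sum>i<r. (Xi n i \<omega>)\<^sup>2)\<bar> \<le> e)" if e: "0 < e" for e
  proof (rule whp_tight[OF noise_size_tight])
    fix K
    obtain c where c: "0 \<le> c" "\<And>n \<omega>. norm (score n \<omega>) \<le> c * noise_size n \<omega>" using score_bound by blast
    \<comment> \<open>\<open>max K 0\<close> makes the bound nonnegative, as the deterministic lemma
      requires.\<close>
    define K' where "K' = c * max K 0"
    have K': "0 \<le> K'" using c(1) by (simp add: K'_def)
    from Q.perturbed_minimizers[OF K' e] obtain \<rho> L where \<rho>: "0 < \<rho>" and L: "0 < L" and pert: "\<forall>\<psi> g r V us uq xs xq.
      norm g \<le> K' \<longrightarrow> L \<le> r \<longrightarrow>
      (\<forall>u. norm u \<le> r \<longrightarrow> \<bar>\<psi> u - (Q.nsq u - 2 * (g \<bullet> u))\<bar> \<le> \<rho> * ((norm u)\<^sup>2 + norm u)) \<longrightarrow>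
      norm xs \<le> r \<longrightarrow> (\<forall>u. norm u \<le> r \<longrightarrow> \<psi> xs \<le> \<psi> u) \<longrightarrow>
      subspace V \<longrightarrow> xq \<in> V \<longrightarrow> norm xq \<le> r \<longrightarrow> (\<forall>u\<in>V. norm u \<le> r \<longrightarrow> \<psi> xq \<le> \<psi> u) \<longrightarrow>
      info *v us = g \<longrightarrow> uq \<in> V \<longrightarrow> (\<forall>v\<in>V. Q.ip v (us - uq) = 0) \<longrightarrow>
      \<bar>\<psi> xq - \<psi> xs - Q.nsq (xs - xq)\<bar> \<le> e \<and> \<bar>\<psi> xq - \<psi> xs - Q.nsq (us - uq)\<bar> \<le> e"
      by (elim exE conjE) (rule that; assumption)
    from local_expansion[OF \<rho>, of K] obtain \<delta>1 where \<delta>1: "0 < \<delta>1" and ex: "whp M (\<lambda>n \<omega>. noise_size n \<omega> \<le> K \<longrightarrow> (\<forall>h. norm h \<le> \<delta>1 \<longrightarrow>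
      \<bar>ln (det (emp_cov n (W0 + h) \<omega>)) - ln (det (emp_cov n W0 \<omega>))
        - (h \<bullet> (info *v h) - 2 * (score n \<omega> \<bullet> h) / sqrt (real n))\<bar>
      \<le> \<rho> * ((norm h)\<^sup>2 + norm h / sqrt (real n))))"
      by (elim exE conjE) (rule that; assumption)
    define \<delta> where "\<delta> = min \<delta>0 \<delta>1"
    have \<delta>: "0 < \<delta>" "\<delta> \<le> \<delta>0" "\<delta> \<le> \<delta>1" using \<delta>0(1) \<delta>1 by (auto simp: \<delta>_def)
    \<comment> \<open>From this sample size on, the rescaled ball has radius at least
      \<open>L\<close>.\<close>
    obtain N :: nat where N: "(L / \<delta>)\<^sup>2 \<le> real N" using real_arch_simple by blast
    from whp_conj[OF ex consistency[OF \<delta>(1)]]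
    show "whp M (\<lambda>n \<omega>. noise_size n \<omega> \<le> K \<longrightarrow> \<bar>T n \<omega> - Q.nsq (sqrt (real n) *\<^sub>R (Ws n \<omega> - Wq n \<omega>))\<bar> \<le> e
      \<and> \<bar>T n \<omega> - (\<Sum>i<r. (Xi n i \<omega>)\<^sup>2)\<bar> \<le> e)"
    proof (rule whp_mono[where N = "max N 1"], intro impI)
      fix n \<omega>
      assume nN: "max N 1 \<le> n" and \<omega>: "\<omega> \<in> space M" and K: "noise_size n \<omega> \<le> K"
        and ev: "(noise_size n \<omega> \<le> K \<longrightarrow> (\<forall>h. norm h \<le> \<delta>1 \<longrightarrow>
          \<bar>ln (det (emp_cov n (W0 + h) \<omega>)) - ln (det (emp_cov n W0 \<omega>))
            - (h \<bullet> (info *v h) - 2 * (score n \<omega> \<bullet> h) / sqrt (real n))\<bar>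
          \<le> \<rho> * ((norm h)\<^sup>2 + norm h / sqrt (real n)))) \<and>
          (\<forall>W\<in>\<Theta>. 0 < det (emp_cov n W \<omega>) \<and>
            (\<delta> \<le> norm (W - W0) \<longrightarrow> det (emp_cov n W0 \<omega>) < det (emp_cov n W \<omega>)))"
      have n: "1 \<le> n" "N \<le> n" using nN by auto
      define sn where "sn = sqrt (real n)"
      have sn: "0 < sn" "sn * sn = real n" using n by (auto simp: sn_def)
      have pos: "\<forall>W\<in>\<Theta>. 0 < det (emp_cov n W \<omega>)" using ev by blast
      let ?U = "\<lambda>W. ln (det (emp_cov n W \<omega>))"
      \<comment> \<open>The cost increment multiplied by \<open>n\<close>, in the local coordinate
        that scales \<open>W - W0\<close> by the root of \<open>n\<close>; the estimators become
        \<open>xs\<close> and \<open>xq\<close>.\<close>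
      define \<psi> where "\<psi> u = real n * (?U (W0 + (1 / sn) *\<^sub>R u) - ?U W0)" for u
      define xs xq where "xs = sn *\<^sub>R (Ws n \<omega> - W0)" and "xq = sn *\<^sub>R (Wq n \<omega> - W0)"
      have Ws_in: "Ws n \<omega> \<in> \<Theta>" and Wq_in: "Wq n \<omega> \<in> \<Theta>q" using Ws(1) Wq(1) n \<omega> by auto
      have Wq_in': "Wq n \<omega> \<in> \<Theta>" using Wq_in \<Theta>q by auto
      have le_s: "?U (Ws n \<omega>) \<le> ?U W" if "W \<in> \<Theta>" for W
        using Ws(2)[OF n(1) \<omega> pos that] pos Ws_in that by simp
      have le_q: "?U (Wq n \<omega>) \<le> ?U W" if "W \<in> \<Theta>q" for W
        using Wq(2)[OF n(1) \<omega> pos that] pos Wq_in' that \<Theta>q(1) by auto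
      have close: "norm (W - W0) < \<delta>" if W: "W \<in> \<Theta>" and le: "det (emp_cov n W \<omega>) \<le> det (emp_cov n W0 \<omega>)" for W
      proof (rule ccontr)
        assume "\<not> ?thesis"
        then have "det (emp_cov n W0 \<omega>) < det (emp_cov n W \<omega>)" using ev W by auto
        then show False using le by simp
      qed
      \<comment> \<open>\<open>W0\<close> belongs to both parameter sets, so neither estimator does
        worse than \<open>W0\<close>, and consistency places both within \<delta> of it.\<close>
      have cs: "norm (Ws n \<omega> - W0) < \<delta>" by (rule close[OF Ws_in Ws(2)[OF n(1) \<omega> pos W0_in]])
      have cq: "norm (Wq n \<omega> - W0) < \<delta>" by (rule close[OF Wq_in' Wq(2)[OF n(1) \<omega> pos \<Theta>q(2)]])
      have scale: "norm ((1 / sn) *\<^sub>R u) \<le> \<delta>" if "norm u \<le> sn * \<delta>" for u :: "real ^ 'w"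
        using that sn(1) by (simp add: field_simps)
      have xs_id: "W0 + (1 / sn) *\<^sub>R xs = Ws n \<omega>" and xq_id: "W0 + (1 / sn) *\<^sub>R xq = Wq n \<omega>"
        using sn(1) by (simp_all add: xs_def xq_def)
      have a2: "L \<le> sn * \<delta>"
      proof -
        have "(L / \<delta>)\<^sup>2 \<le> real n" using N n(2) by linarith
        then have "L / \<delta> \<le> sn" unfolding sn_def by (rule real_le_rsqrt)
        then show ?thesis using \<delta>(1) by (simp add: divide_le_eq)
      qed
      have a1: "norm (score n \<omega>) \<le> K'"
      proof -
        have "norm (score n \<omega>) \<le> c * noise_size n \<omega>" by (rule c(2))
        also have "\<dots> \<le> K'" unfolding K'_def using c(1) K by (intro mult_left_mono) auto
        finally show ?thesis .
      qed
      have a3: "\<forall>u. norm u \<le> sn * \<delta> \<longrightarrow> \<bar>\<psi> u - (Q.nsq u - 2 * (score n \<omega> \<bullet> u))\<bar> \<le> \<rho> * ((norm u)\<^sup>2 + norm u)"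
      proof (intro allI impI)
        fix u :: "real ^ 'w" assume u: "norm u \<le> sn * \<delta>"
        let ?h = "(1 / sn) *\<^sub>R u"
        have "norm ?h \<le> \<delta>1" using scale[OF u] \<delta>(3) by linarith
        then have "\<bar>?U (W0 + ?h) - ?U W0 - (?h \<bullet> (info *v ?h) - 2 * (score n \<omega> \<bullet> ?h) / sn)\<bar>
            \<le> \<rho> * ((norm ?h)\<^sup>2 + norm ?h / sn)" using ev K unfolding sn_def by blast
        then have "real n * \<bar>?U (W0 + ?h) - ?U W0 - (?h \<bullet> (info *v ?h) - 2 * (score n \<omega> \<bullet> ?h) / sn)\<bar>
            \<le> real n * (\<rho> * ((norm ?h)\<^sup>2 + norm ?h / sn))" by (intro mult_left_mono) auto
        moreover have "real n * \<bar>?U (W0 + ?h) - ?U W0 - (?h \<bullet> (info *v ?h) - 2 * (score n \<omega> \<bullet> ?h) / sn)\<bar>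
            = \<bar>\<psi> u - (Q.nsq u - 2 * (score n \<omega> \<bullet> u))\<bar>"
        proof -
          have e1: "?h \<bullet> (info *v ?h) = Q.nsq u / real n"
            unfolding sn(2)[symmetric] by (simp add: Q.nsq_def Q.ip_def matrix_vector_mult_scaleR)
          have e2: "2 * (score n \<omega> \<bullet> ?h) / sn = 2 * (score n \<omega> \<bullet> u) / real n"
            unfolding sn(2)[symmetric] by simp
          have "\<psi> u - (Q.nsq u - 2 * (score n \<omega> \<bullet> u))
              = real n * (?U (W0 + ?h) - ?U W0 - (?h \<bullet> (info *v ?h) - 2 * (score n \<omega> \<bullet> ?h) / sn))"
            unfolding \<psi>_def e1 e2 using n(1) by (simp add: field_simps)
          then show ?thesis by (simp add: abs_mult)
        qed
        moreover have "real n * (\<rho> * ((norm ?h)\<^sup>2 + norm ?h / sn)) = \<rho> * ((norm u)\<^sup>2 + norm u)"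
          unfolding sn(2)[symmetric] using sn(1) by (simp add: power2_eq_square field_simps)
        ultimately show "\<bar>\<psi> u - (Q.nsq u - 2 * (score n \<omega> \<bullet> u))\<bar> \<le> \<rho> * ((norm u)\<^sup>2 + norm u)" by linarith
      qed
      have a4: "norm xs \<le> sn * \<delta>" and a8: "norm xq \<le> sn * \<delta>"
        using cs cq sn(1) by (auto simp: xs_def xq_def)
      have a5: "\<forall>u. norm u \<le> sn * \<delta> \<longrightarrow> \<psi> xs \<le> \<psi> u"
      proof (intro allI impI)
        fix u :: "real ^ 'w" assume "norm u \<le> sn * \<delta>"
        then have "W0 + (1 / sn) *\<^sub>R u \<in> \<Theta>" using scale \<delta>(2) by (intro \<delta>0(2)) force
        then show "\<psi> xs \<le> \<psi> u" unfolding \<psi>_def xs_id using le_s by (intro mult_left_mono) auto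
      qed
      have a9: "\<forall>u\<in>V. norm u \<le> sn * \<delta> \<longrightarrow> \<psi> xq \<le> \<psi> u"
      proof (intro ballI impI)
        fix u assume u: "u \<in> V" "norm u \<le> sn * \<delta>"
        have "W0 + (1 / sn) *\<^sub>R u \<in> \<Theta>q"
          using scale[OF u(2)] \<delta>(2) subspace_scale[OF V(1) u(1)] by (intro \<delta>0(3)) auto
        then show "\<psi> xq \<le> \<psi> u" unfolding \<psi>_def xq_id using le_q by (intro mult_left_mono) auto
      qed
      have a7: "xq \<in> V" unfolding xq_def by (intro subspace_scale V \<Theta>qV Wq_in)
      have a12: "\<forall>v\<in>V. Q.ip v (us n \<omega> - uq n \<omega>) = 0" using orth by blast
      note pert' = pert[THEN spec[of _ \<psi>], THEN spec[of _ "score n \<omega>"], THEN spec[of _ "sn * \<delta>"], THEN spec[of _ V],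
          THEN spec[of _ "us n \<omega>"], THEN spec[of _ "uq n \<omega>"], THEN spec[of _ xs], THEN spec[of _ xq]]
      have res: "\<bar>\<psi> xq - \<psi> xs - Q.nsq (xs - xq)\<bar> \<le> e \<and> \<bar>\<psi> xq - \<psi> xs - Q.nsq (us n \<omega> - uq n \<omega>)\<bar> \<le> e"
        by (rule pert'[THEN mp, THEN mp, THEN mp, THEN mp, THEN mp, THEN mp, THEN mp, THEN mp, THEN mp, THEN mp, THEN mp, THEN mp,
              OF a1 a2 a3 a4 a5 V(1) a7 a8 a9 us uqV a12])
      have "T n \<omega> = \<psi> xq - \<psi> xs"
        using T[OF n(1) \<omega> pos] unfolding \<psi>_def xs_id xq_id by (simp add: algebra_simps)
      moreover have "sqrt (real n) *\<^sub>R (Ws n \<omega> - Wq n \<omega>) = xs - xq"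
        by (simp add: xs_def xq_def sn_def algebra_simps)
      ultimately show "\<bar>T n \<omega> - Q.nsq (sqrt (real n) *\<^sub>R (Ws n \<omega> - Wq n \<omega>))\<bar> \<le> e
          \<and> \<bar>T n \<omega> - (\<Sum>i<r. (Xi n i \<omega>)\<^sup>2)\<bar> \<le> e"
        using res nsq_diff by simp
    qed
  qed
  show "whp M (\<lambda>n \<omega>. \<bar>T n \<omega> - (sqrt (real n) *\<^sub>R (Ws n \<omega> - Wq n \<omega>)) \<bullet>
      (info *v (sqrt (real n) *\<^sub>R (Ws n \<omega> - Wq n \<omega>)))\<bar> \<le> e)" if "0 < e" for e
    using main[OF that] by (rule whp_mono[where N = 0]) (simp add: Q.nsq_def Q.ip_def)
  show "weak_conv_m (\<lambda>n. distr M borel (T n)) (chi_square r)"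
  proof (rule chi_square_limit[where X = Xi])
    show "Xi n i \<in> borel_measurable M" for n i unfolding Xi_def[abs_def] by (rule score_measurable)
    show "T n \<in> borel_measurable M" for n by (rule T_meas)
    show "whp M (\<lambda>n \<omega>. \<bar>T n \<omega> - (\<Sum>i<r. (Xi n i \<omega>)\<^sup>2)\<bar> \<le> e)" if "0 < e" for e
      using main[OF that] by (rule whp_mono[where N = 0]) simp
    fix c :: "nat \<Rightarrow> real"
    \<comment> \<open>A linear combination of the \<open>Xi\<close> is the score in the direction
      \<open>?v\<close>, whose squared \<open>ip\<close>-length is the sum of the squared
      coefficients because the basis is orthonormal.\<close>
    let ?v = "\<Sum>i<r. c i *\<^sub>R b i"
    have "?v \<bullet> (info *v ?v) = (\<Sum>j<r. c j * (\<Sum>i<r. c i * Q.ip (b i) (b j)))"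
      unfolding Q.ip_def[symmetric] Q.ip_sum(1) Q.ip_linear(5) Q.ip_sum(2) Q.ip_linear(6) ..
    also have "\<dots> = (\<Sum>j<r. (c j)\<^sup>2)" using sum_b' by (intro sum.cong refl) (simp add: power2_eq_square)
    finally have "?v \<bullet> (info *v ?v) = (\<Sum>j<r. (c j)\<^sup>2)" .
    moreover have "score n \<omega> \<bullet> ?v = (\<Sum>i<r. c i * Xi n i \<omega>)" for n \<omega>
      by (simp add: Xi_def inner_sum_right)
    ultimately show "(\<lambda>n. CLINT \<omega>|M. iexp (\<Sum>i<r. c i * Xi n i \<omega>)) \<longlonglongrightarrow> complex_of_real (exp (- (\<Sum>i<r. (c i)\<^sup>2) / 2))"
      using score_char[of ?v] by simp
  qed
qed

end

section \<open>Transfer from the general limit theorem to the perceptron\<close>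

context prob_space
begin

lemma whp_imp_small_oP_1:
  assumes "\<And>e. 0 < e \<Longrightarrow> whp M (\<lambda>n \<omega>. \<bar>R n \<omega>\<bar> \<le> e)"
  shows "small_oP_1 M R"
  unfolding small_oP_1_def
proof (intro allI impI LIMSEQ_I)
  fix e \<gamma> :: real assume e: "0 < e" and \<gamma>: "0 < \<gamma>"
  then have "0 < \<gamma> / 2" by simp
  then obtain N where N: "\<forall>n\<ge>N. \<exists>A\<in>sets M. prob A \<ge> 1 - \<gamma> / 2 \<and> (\<forall>\<omega>\<in>A. \<bar>R n \<omega>\<bar> \<le> e)"
    using assms[OF e] unfolding whp_def by blast
  show "\<exists>no. \<forall>n\<ge>no. norm (prob {\<omega> \<in> space M. \<bar>R n \<omega>\<bar> > e} - 0) < \<gamma>"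
  proof (intro exI[of _ N] allI impI)
    fix n assume "N \<le> n"
    then obtain A where A: "A \<in> sets M" "prob A \<ge> 1 - \<gamma> / 2" "\<forall>\<omega>\<in>A. \<bar>R n \<omega>\<bar> \<le> e" using N by blast
    \<comment> \<open>The enclosing event is measurable by the choice of \<open>A\<close>, which is
      what monotonicity of the measure asks for.\<close>
    have "prob {\<omega> \<in> space M. \<bar>R n \<omega>\<bar> > e} \<le> prob (space M - A)"
    proof (rule finite_measure_mono)
      show "{\<omega> \<in> space M. \<bar>R n \<omega>\<bar> > e} \<subseteq> space M - A" using A(3) by force
    qed (use A(1) in auto)
    also have "\<dots> \<le> \<gamma> / 2" using prob_compl[OF A(1)] A(2) by simp
    finally show "norm (prob {\<omega> \<in> space M. \<bar>R n \<omega>\<bar> > e} - 0) < \<gamma>" using \<gamma> by simp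
  qed
qed

lemma indep_rv_cong:
  assumes "indep_rv M U V" "\<And>\<omega>. \<omega> \<in> space M \<Longrightarrow> U' \<omega> = U \<omega>"
  shows "indep_rv M U' V"
proof -
  have "U' -` A \<inter> space M = U -` A \<inter> space M" for A using assms(2) by auto
  moreover have "U' \<in> borel_measurable M \<longleftrightarrow> U \<in> borel_measurable M"
    using assms(2) by (rule measurable_cong)
  ultimately show ?thesis using assms(1) by (simp add: indep_rv_def)
qed

end

lemma subspace_null_outside: "subspace (null_outside K)"
  by (auto simp: subspace_def null_outside_def)

lemma dim_null_outside: "dim (null_outside (K :: 'k::finite set)) = card K"
proof -
  let ?d = "(\<lambda>k. axis k (1::real)) ` K"
  have inj: "inj_on (\<lambda>k. axis k (1::real)) K" by (auto simp: inj_on_def axis_eq_axis)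
  have "null_outside K = {x :: real ^ 'k. \<forall>i\<in>Basis. i \<notin> ?d \<longrightarrow> x \<bullet> i = 0}"
    by (auto simp: null_outside_def Basis_vec_def inner_axis axis_eq_axis)
  moreover have "dim {x :: real ^ 'k. \<forall>i\<in>Basis. i \<notin> ?d \<longrightarrow> x \<bullet> i = 0} = card ?d"
    by (rule dim_substandard) (auto simp: Basis_vec_def)
  ultimately show ?thesis by (simp add: card_image[OF inj])
qed

text \<open>Joint continuity in weights and input makes the cost measurable when it is evaluated at
  a random weight vector such as an estimator.\<close>

lemma continuous_on_mlp: "continuous_on UNIV (\<lambda>p. mlp (fst p) (snd p))"
proof -
  have hid: "continuous_on UNIV (\<lambda>p. hidden_input (fst p :: real ^ ('d::finite, 'l::finite, 'h::finite) weight) (snd p) j)" for j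
    unfolding hidden_input_def by (intro continuous_intros)
  have "continuous_on UNIV (\<lambda>p. \<chi> i. (\<Sum>j\<in>UNIV. (fst p :: real ^ ('d::finite, 'l::finite, 'h::finite) weight) $ Inl (i, Some j)
      * tanh (hidden_input (fst p) (snd p) j)) + fst p $ Inl (i, None))"
    by (intro continuous_on_vec_lambda continuous_intros hid) (simp add: cosh_real_nonzero)
  then show ?thesis by (simp add: mlp_def hidden_input_def)
qed

lemma borel_measurable_log_ext: "log_ext \<in> borel_measurable borel"
  unfolding log_ext_def[abs_def] by measurable

lemma borel_measurable_cost:
  fixes W :: "'a \<Rightarrow> real ^ ('d::finite, 'l::finite, 'h::finite) weight"
  assumes Y: "\<And>t. Y t \<in> borel_measurable M" and Z: "\<And>t. Z t \<in> borel_measurable M" and W: "W \<in> borel_measurable M"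
  shows "(\<lambda>\<omega>. cost n (\<lambda>t. Y t \<omega>) (\<lambda>t. Z t \<omega>) (W \<omega>)) \<in> borel_measurable M"
proof -
  have m: "(\<lambda>\<omega>. mlp (W \<omega>) (Z t \<omega>)) \<in> borel_measurable M" for t
    by (rule borel_measurable_continuous_Pair[OF W Z]) (rule continuous_on_mlp)
  have d: "det \<in> borel_measurable (borel :: (real ^ 'd ^ 'd) measure)"
    by (intro borel_measurable_continuous_onI continuous_on_det)
  have "(\<lambda>\<omega>. (1 / real n) *\<^sub>R (\<Sum>t = 1..n. outer (Y t \<omega> - mlp (W \<omega>) (Z t \<omega>)) (Y t \<omega> - mlp (W \<omega>) (Z t \<omega>)))) \<in> borel_measurable M"
    by (intro borel_measurable_scaleR borel_measurable_const borel_measurable_sum borel_measurable_outer borel_measurable_diff Y m)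
  from measurable_compose[OF measurable_compose[OF this d] borel_measurable_log_ext]
  show ?thesis unfolding cost_def .
qed

lemma INF_arg_min:
  fixes f :: "'a \<Rightarrow> ereal"
  assumes "is_arg_min f (\<lambda>x. x \<in> S) m"
  shows "(INF x\<in>S. f x) = f m"
  using assms unfolding is_arg_min_def
  by (intro antisym INF_greatest INF_lower) (auto simp: not_less)

theorem mainTheorem6:
  fixes M :: "'a measure"
    and Y \<epsilon> :: "nat \<Rightarrow> 'a \<Rightarrow> real ^ 'd::finite"
    and Z :: "nat \<Rightarrow> 'a \<Rightarrow> real ^ 'l::finite"
    and W0 :: "real ^ ('d, 'l, 'h::finite) weight"
    and \<Theta>s \<Theta>q :: "(real ^ ('d, 'l, 'h) weight) set"
    and Ws Wq :: "nat \<Rightarrow> 'a \<Rightarrow> real ^ ('d, 'l, 'h) weight"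
    and \<Gamma>0 :: "real ^ 'd ^ 'd"
    and I0 :: "real ^ ('d, 'l, 'h) weight ^ ('d, 'l, 'h) weight"
    and K :: "('d, 'l, 'h) weight set"
    and q s :: nat
    and T :: "nat \<Rightarrow> 'a \<Rightarrow> real"
  assumes prob: "prob_space M"
    and iid_data: "iid_seq M (\<lambda>t \<omega>. (Y t \<omega>, Z t \<omega>))"
    and regression: "\<And>t \<omega>. \<omega> \<in> space M \<Longrightarrow> Y t \<omega> = mlp W0 (Z t \<omega>) + \<epsilon> t \<omega>"
    and iid_noise: "iid_seq M \<epsilon>"
    and noise_indep: "\<And>t. indep_rv M (\<epsilon> t) (Z t)"
    and noise_square: "\<And>t. integrable M (\<lambda>\<omega>. norm (\<epsilon> t \<omega>) ^ 2)"
    and noise_centered: "\<And>t. (LINT \<omega>|M. \<epsilon> t \<omega>) = 0"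
    and noise_cov: "\<And>t. (LINT \<omega>|M. outer (\<epsilon> t \<omega>) (\<epsilon> t \<omega>)) = \<Gamma>0"
    and cov_invertible: "invertible \<Gamma>0"
    and Z_cube: "\<And>t. integrable M (\<lambda>\<omega>. norm (Z t \<omega>) ^ 3)"
    and s_def: "s = CARD(('d, 'l, 'h) weight)"
    and q_def: "q = card K"
    and q_less: "q < s"
    and compact_s: "compact \<Theta>s"
    and compact_q: "compact \<Theta>q"
    and sub: "\<Theta>q \<subseteq> \<Theta>s"
    and null_weights: "\<Theta>q \<subseteq> null_outside K"
    and H0: "W0 \<in> \<Theta>q"
    and inner_s: "W0 \<in> interior \<Theta>s"
    and inner_q: "W0 \<in> (top_of_set (null_outside K)) interior_of \<Theta>q"
    and identifiable:
      "\<And>W. W \<in> \<Theta>s \<Longrightarrow> (AE \<omega> in M. mlp W (Z 0 \<omega>) = mlp W0 (Z 0 \<omega>)) \<Longrightarrow> mlp_equiv W0 W"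
    and quotient: "\<And>W. W \<in> \<Theta>s \<Longrightarrow> mlp_equiv W0 W \<Longrightarrow> W = W0"
    and I0_def: "I0 = info_matrix M (Z 0) \<Gamma>0 W0"
    and hessian_pos_def: "pos_def (2 *\<^sub>R I0)"
    and Ws_measurable: "\<And>n. Ws n \<in> borel_measurable M"
    and Wq_measurable: "\<And>n. Wq n \<in> borel_measurable M"
    and Ws_argmin: "\<And>n \<omega>. n \<ge> 1 \<Longrightarrow> \<omega> \<in> space M \<Longrightarrow>
      is_arg_min (cost n (\<lambda>t. Y t \<omega>) (\<lambda>t. Z t \<omega>)) (\<lambda>W. W \<in> \<Theta>s) (Ws n \<omega>)"
    and Wq_argmin: "\<And>n \<omega>. n \<ge> 1 \<Longrightarrow> \<omega> \<in> space M \<Longrightarrow>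
      is_arg_min (cost n (\<lambda>t. Y t \<omega>) (\<lambda>t. Z t \<omega>)) (\<lambda>W. W \<in> \<Theta>q) (Wq n \<omega>)"
    and T_def: "\<And>n \<omega>. T n \<omega> = test_statistic n (\<lambda>t. Y t \<omega>) (\<lambda>t. Z t \<omega>) \<Theta>q \<Theta>s"
  shows "small_oP_1 M (\<lambda>n \<omega>. T n \<omega> -
           (sqrt (real n) *\<^sub>R (Ws n \<omega> - Wq n \<omega>)) \<bullet> (I0 *v (sqrt (real n) *\<^sub>R (Ws n \<omega> - Wq n \<omega>))))
         \<and> weak_conv_m (\<lambda>n. distr M borel (T n)) (chi_square (s - q))"
proof -
  interpret prob_space M by (rule prob)
  obtain C where sr: "smooth_regression mlp W0 \<Theta>s (mlp_J W0) (mlp_B W0) C"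
    using mlp_smooth_regression[OF compact_imp_bounded[OF compact_s]] by blast
  define X where "X t \<omega> = (Y t \<omega>, Z t \<omega>)" for t \<omega>
  have X_eps: "fst (X t \<omega>) - mlp W0 (snd (X t \<omega>)) = \<epsilon> t \<omega>" if "\<omega> \<in> space M" for t \<omega>
    using regression[OF that] by (simp add: X_def)
  have W0_s: "W0 \<in> \<Theta>s" using H0 sub by auto
  \<comment> \<open>The large parameter set plays the role of \<Theta>. The noise \<epsilon> agrees
    with the residual at \<open>W0\<close> on the sample space only, hence the congruence
    rules.\<close>
  interpret R: regression_sample M mlp W0 \<Theta>s "mlp_J W0" "mlp_B W0" C X \<Gamma>0
  proof (intro regression_sample.intro prob sr regression_sample_axioms.intro)
    show "iid_seq M X" using iid_data by (simp add: X_def[abs_def])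
    show "indep_rv M (\<lambda>\<omega>. fst (X 0 \<omega>) - mlp W0 (snd (X 0 \<omega>))) (\<lambda>\<omega>. snd (X 0 \<omega>))"
      using indep_rv_cong[OF noise_indep X_eps] by (simp add: X_def)
    show "integrable M (\<lambda>\<omega>. (norm (fst (X 0 \<omega>) - mlp W0 (snd (X 0 \<omega>))))\<^sup>2)"
      using noise_square[of 0] X_eps by (simp cong: Bochner_Integration.integrable_cong)
    show "(LINT \<omega>|M. fst (X 0 \<omega>) - mlp W0 (snd (X 0 \<omega>))) = 0"
      using noise_centered[of 0] X_eps by (simp cong: Bochner_Integration.integral_cong)
    show "integrable M (\<lambda>\<omega>. norm (snd (X 0 \<omega>)) ^ 3)" using Z_cube[of 0] by (simp add: X_def)
    show "(LINT \<omega>|M. outer (fst (X 0 \<omega>) - mlp W0 (snd (X 0 \<omega>))) (fst (X 0 \<omega>) - mlp W0 (snd (X 0 \<omega>)))) = \<Gamma>0"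
      using noise_cov[of 0] X_eps by (simp cong: Bochner_Integration.integral_cong)
    \<comment> \<open>Identifiability gives equality up to the symmetry group, and working in the
      quotient leaves \<open>W0\<close> as the only representative.\<close>
    show "W = W0" if "W \<in> \<Theta>s" "AE \<omega> in M. mlp W (snd (X 0 \<omega>)) = mlp W0 (snd (X 0 \<omega>))" for W
      using quotient[OF that(1) identifiable[OF that(1)]] that(2) by (simp add: X_def)
  qed (use cov_invertible W0_s compact_s in auto)
  \<comment> \<open>The trace against the inverse covariance is a bounded linear map, so it passes
    under the expectation, and the partial derivatives are the values of the Jacobian on the
    axes.\<close>
  have info: "R.info = I0"
  proof -
    have "R.info $ k $ l = I0 $ k $ l" for k l
    proof -
      have "integrable M (\<lambda>\<omega>. outer (R.J_axis k (X 0 \<omega>)) (R.J_axis l (X 0 \<omega>)))"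
      proof (rule R.dominated_integrable[of "\<lambda>p. outer (R.J_axis k p) (R.J_axis l p)" "C\<^sup>2"])
        fix p :: "(real ^ 'd) \<times> (real ^ 'l)"
        have "norm (outer (R.J_axis k p) (R.J_axis l p)) \<le> (C * (1 + norm (snd p))) * (C * (1 + norm (snd p)))"
          unfolding norm_outer using R.C_ge_1 by (intro mult_mono R.J_axis_bound) auto
        also have "\<dots> = C\<^sup>2 * ((1 + norm (snd p))\<^sup>2 * (1 + norm (R.eps p)) ^ 0)" by (simp add: power2_eq_square)
        also have "\<dots> \<le> C\<^sup>2 * R.wt p" by (intro mult_left_mono R.weight_le_wt) auto
        finally show "norm (outer (R.J_axis k p) (R.J_axis l p)) \<le> C\<^sup>2 * R.wt p" .
      qed (intro borel_measurable_outer R.J_snd_borel)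
      from integral_bounded_linear[OF bounded_linear_trace_mul this, of "matrix_inv \<Gamma>0"]
      show ?thesis
        by (simp add: R.info_def I0_def info_matrix_def mlp_partial_eq X_def trace_matrix_mul_outer)
    qed
    then show ?thesis by (simp add: vec_eq_iff)
  qed
  have pd: "pos_def R.info"
    using hessian_pos_def unfolding info pos_def_def
    by (auto simp: scaleR_matrix_vector_assoc[symmetric])
  have emp: "cost n (\<lambda>t. Y t \<omega>) (\<lambda>t. Z t \<omega>) W = log_ext (det (R.emp_cov n W \<omega>))" for n \<omega> W
    by (simp add: cost_def R.emp_cov_def R.ave_def R.res_def X_def)
  obtain d1 where d1: "0 < d1" "cball W0 d1 \<subseteq> \<Theta>s"
    using inner_s unfolding mem_interior_cball by blast
  \<comment> \<open>The interior is taken relative to the null subspace, since in the full space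
    \<Theta>q has empty interior when \<open>q < s\<close>.\<close>
  obtain d2 where d2: "0 < d2" "cball W0 d2 \<inter> null_outside K \<subseteq> \<Theta>q"
  proof -
    obtain U where U: "open U" "W0 \<in> null_outside K \<inter> U" "null_outside K \<inter> U \<subseteq> \<Theta>q"
      using inner_q unfolding interior_of_def openin_subtopology_Int2 openin_open by auto
    then obtain d where "0 < d" "cball W0 d \<subseteq> U" unfolding open_contains_cball by blast
    with U(3) that[of d] show ?thesis by blast
  qed
  define \<delta>0 where "\<delta>0 = min d1 d2"
  have W0_V: "W0 \<in> null_outside K" using H0 null_weights by auto
  have \<delta>0: "0 < \<delta>0" using d1 d2 by (simp add: \<delta>0_def)
  have in_s: "W0 + h \<in> \<Theta>s" if "norm h \<le> \<delta>0" for h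
    using that d1(2) by (auto simp: \<delta>0_def dist_norm)
  have in_q: "W0 + h \<in> \<Theta>q" if "h \<in> null_outside K" "norm h \<le> \<delta>0" for h
    using that d2(2) subspace_add[OF subspace_null_outside W0_V that(1)] by (auto simp: \<delta>0_def dist_norm)
  have finite_cost: "cost n (\<lambda>t. Y t \<omega>) (\<lambda>t. Z t \<omega>) W = ereal (ln (det (R.emp_cov n W \<omega>)))"
    if "0 < det (R.emp_cov n W \<omega>)" for n \<omega> W using that by (simp add: emp log_ext_def)
  have det_le: "det (R.emp_cov n m \<omega>) \<le> det (R.emp_cov n W \<omega>)"
    if "is_arg_min (cost n (\<lambda>t. Y t \<omega>) (\<lambda>t. Z t \<omega>)) (\<lambda>W. W \<in> S) m"
      "\<forall>W\<in>\<Theta>s. 0 < det (R.emp_cov n W \<omega>)" "W \<in> S" "S \<subseteq> \<Theta>s" for n \<omega> m W S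
  proof -
    have m: "m \<in> S" and le: "cost n (\<lambda>t. Y t \<omega>) (\<lambda>t. Z t \<omega>) m \<le> cost n (\<lambda>t. Y t \<omega>) (\<lambda>t. Z t \<omega>) W"
      using that(1,3) by (auto simp: is_arg_min_def not_less)
    have p: "0 < det (R.emp_cov n m \<omega>)" "0 < det (R.emp_cov n W \<omega>)" using that(2-4) m by auto
    show ?thesis using le unfolding finite_cost[OF p(1)] finite_cost[OF p(2)] using p by simp
  qed
  \<comment> \<open>Both infima are attained at the estimators, so measurability of the statistic
    reduces to that of the cost at a measurable weight vector.\<close>
  have T_eq: "T n \<omega> = real n * real_of_ereal (cost n (\<lambda>t. Y t \<omega>) (\<lambda>t. Z t \<omega>) (Wq n \<omega>) - cost n (\<lambda>t. Y t \<omega>) (\<lambda>t. Z t \<omega>) (Ws n \<omega>))"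
    if "n \<ge> 1" "\<omega> \<in> space M" for n \<omega>
    unfolding T_def test_statistic_def INF_arg_min[OF Wq_argmin[OF that]] INF_arg_min[OF Ws_argmin[OF that]] ..
  have Y_meas: "Y t \<in> borel_measurable M" and Z_meas: "Z t \<in> borel_measurable M" for t
    using measurable_compose[OF R.X_measurable[of t] R.fst_borel] measurable_compose[OF R.X_measurable[of t] R.snd_borel]
    by (simp_all add: X_def)
  have T_meas: "T n \<in> borel_measurable M" for n
  proof (cases "n \<ge> 1")
    case True
    have "(\<lambda>\<omega>. real n * real_of_ereal (cost n (\<lambda>t. Y t \<omega>) (\<lambda>t. Z t \<omega>) (Wq n \<omega>) - cost n (\<lambda>t. Y t \<omega>) (\<lambda>t. Z t \<omega>) (Ws n \<omega>))) \<in> borel_measurable M"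
      by (intro borel_measurable_times borel_measurable_const borel_measurable_real_of_ereal borel_measurable_ereal_diff
          borel_measurable_cost Y_meas Z_meas Ws_measurable Wq_measurable)
    then show ?thesis using T_eq[OF True] by (simp cong: measurable_cong)
  next
    case False
    \<comment> \<open>For \<open>n = 0\<close> the factor \<open>real n\<close> annihilates the
      statistic, whatever the infima are.\<close>
    then have "T n = (\<lambda>_. 0)" by (simp add: fun_eq_iff T_def test_statistic_def)
    then show ?thesis by simp
  qed
  have card_le: "dim (null_outside K) + (s - q) = CARD(('d, 'l, 'h) weight)"
    using q_less by (simp add: dim_null_outside s_def q_def)
  have Ws_in: "Ws n \<omega> \<in> \<Theta>s" and Wq_in: "Wq n \<omega> \<in> \<Theta>q" if "n \<ge> 1" "\<omega> \<in> space M" for n \<omega>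
    using Ws_argmin[OF that] Wq_argmin[OF that] by (auto simp: is_arg_min_def)
  have T_ln: "T n \<omega> = real n * (ln (det (R.emp_cov n (Wq n \<omega>) \<omega>)) - ln (det (R.emp_cov n (Ws n \<omega>) \<omega>)))"
    if "n \<ge> 1" "\<omega> \<in> space M" "\<forall>W\<in>\<Theta>s. 0 < det (R.emp_cov n W \<omega>)" for n \<omega>
  proof -
    have "0 < det (R.emp_cov n (Wq n \<omega>) \<omega>)" "0 < det (R.emp_cov n (Ws n \<omega>) \<omega>)"
      using that(3) Ws_in[OF that(1,2)] Wq_in[OF that(1,2)] sub by auto
    then show ?thesis unfolding T_eq[OF that(1,2)] by (simp add: finite_cost)
  qed
  have diff_V: "W - W0 \<in> null_outside K" if "W \<in> \<Theta>q" for W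
    using subspace_diff[OF subspace_null_outside _ W0_V] that null_weights by auto
  have det_s: "det (R.emp_cov n (Ws n \<omega>) \<omega>) \<le> det (R.emp_cov n W \<omega>)"
    if "n \<ge> 1" "\<omega> \<in> space M" "\<forall>W\<in>\<Theta>s. 0 < det (R.emp_cov n W \<omega>)" "W \<in> \<Theta>s" for n \<omega> W
    by (rule det_le[OF Ws_argmin[OF that(1,2)] that(3,4) order_refl])
  have det_q: "det (R.emp_cov n (Wq n \<omega>) \<omega>) \<le> det (R.emp_cov n W \<omega>)"
    if "n \<ge> 1" "\<omega> \<in> space M" "\<forall>W\<in>\<Theta>s. 0 < det (R.emp_cov n W \<omega>)" "W \<in> \<Theta>q" for n \<omega> W
    by (rule det_le[OF Wq_argmin[OF that(1,2)] that(3,4) sub])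
  note limit = R.likelihood_ratio_limit[where \<Theta>q = \<Theta>q and V = "null_outside K" and r = "s - q" and ?\<delta>0.0 = \<delta>0
      and Ws = Ws and Wq = Wq and T = T, unfolded info]
  show ?thesis
  proof (intro conjI whp_imp_small_oP_1)
    show "whp M (\<lambda>n \<omega>. \<bar>T n \<omega> - (sqrt (real n) *\<^sub>R (Ws n \<omega> - Wq n \<omega>)) \<bullet>
        (I0 *v (sqrt (real n) *\<^sub>R (Ws n \<omega> - Wq n \<omega>)))\<bar> \<le> e)" if e: "0 < e" for e
      by (rule limit(1)) (fact pd[unfolded info] sub H0 subspace_null_outside card_le diff_V \<delta>0 in_s in_q
          Ws_in det_s Wq_in det_q T_meas T_ln e)+
    show "weak_conv_m (\<lambda>n. distr M borel (T n)) (chi_square (s - q))"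
      by (rule limit(2)) (fact pd[unfolded info] sub H0 subspace_null_outside card_le diff_V \<delta>0 in_s in_q
          Ws_in det_s Wq_in det_q T_meas T_ln)+
  qed
qed

end
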